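(* Let $p(\cdot)\in\mathcal{P}(\mathbb{R}^n)\cap LH(\mathbb{R}^n)$ with $p_+<\infty$ and let $W:\mathbb{R}^n\to\mathcal{S}_d$ be a matrix weight. If $W\in\mathcal{A}_{p(\cdot)}$, then there exists $r>1$ such that for all $s\in[1,r]$, $W\in\mathcal{A}_{s p(\cdot)}$.
   Context: Cubes in $\mathbb{R}^n$ have sides parallel to the coordinate axes. $\mathcal{P}(\mathbb{R}^n)$ is the set of exponent functions, i.e. Lebesgue measurable $p(\cdot):\mathbb{R}^n\to[1,\infty]$; $p_+=\operatorname{ess\,sup}_{\mathbb{R}^n}p$, $p_-=\operatorname{ess\,inf}_{\mathbb{R}^n}p$. The conjugate exponent $p'(\cdot)$ satisfies $\frac1{p(x)}+\frac1{p'(x)}=1$ (with $1/\infty=0$). With $\Omega_\infty=\{x:p(x)=\infty\}$, the modular is $\rho_{p(\cdot)}(f)=\int_{\mathbb{R}^n\setminus\Omega_\infty}|f(x)|^{p(x)}dx+\|f\|_{L^\infty(\Omega_\infty)}$ and the norm is $\|f\|_{L^{p(\cdot)}(\mathbb{R}^n)}=\inf\{\lambda>0:\rho_{p(\cdot)}(f/\lambda)\le1\}$. A subscript ($L^{p(\cdot)}_x$, $L^{p(\cdot)}_y$) indicates the variable in which the norm is taken. Log-Hölder continuity: $u(\cdot):\mathbb{R}^n\to\mathbb{R}$ is in $LH(\mathbb{R}^n)$ if there is $C_0$ with $|u(x)-u(y)|\le\frac{C_0}{-\log|x-y|}$ whenever $|x-y|<1/2$, and there are constants $C_\infty,u_\infty$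 with $|u(x)-u_\infty|\le\frac{C_\infty}{\log(e+|x|)}$ for all $x$. $\mathcal{S}_d$ is the set of $d\times d$ self-adjoint positive semi-definite matrices and $|A|_{\mathrm{op}}=\sup_{\mathbf{e}\in\mathbb{R}^d,|\mathbf{e}|=1}|A\mathbf{e}|$. A matrix weight is a measurable $W:\mathbb{R}^n\to\mathcal{S}_d$ with $|W(\cdot)|_{\mathrm{op}}\in L^1_{\mathrm{loc}}(\mathbb{R}^n)$; it is invertible if it is positive definite a.e. For an exponent function $p(\cdot)$, $W\in\mathcal{A}_{p(\cdot)}$ means that $W$ is an invertible matrix weight with $$[W]_{\mathcal{A}_{p(\cdot)}}=\sup_Q|Q|^{-1}\Big\|\,\big\||W(x)W^{-1}(y)|_{\mathrm{op}}\chi_Q(y)\big\|_{L^{p'(\cdot)}_y(\mathbb{R}^n)}\chi_Q(x)\Big\|_{L^{p(\cdot)}_x(\mathbb{R}^n)}<\infty,$$ the supremum being over all cubes $Q\subset\mathbb{R}^n$. *)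

theory Defs
  imports "HOL-Analysis.Analysis" "HOL-Probability.Essential_Supremum"
begin

section \<open>Variable exponents\<close>

definition exponent_functions :: "((real ^ 'n) \<Rightarrow> ereal) set" where
  "exponent_functions = {p. p \<in> borel_measurable lebesgue \<and> (\<forall>x. 1 \<le> p x)}"

text \<open>In \<^typ>\<open>ereal\<close> one has \<open>inverse 0 = \<infinity>\<close> and \<open>inverse \<infinity> = 0\<close>, so exponents \<open>1\<close> and \<open>\<infinity>\<close>
  are conjugate to each other.\<close>

definition conj_exponent :: "('a \<Rightarrow> ereal) \<Rightarrow> 'a \<Rightarrow> ereal" where
  "conj_exponent p x = inverse (1 - inverse (p x))"

text \<open>For \<open>x = y\<close> the bound reads \<open>0 \<le> C0 / 0\<close>, where both \<open>ln 0\<close> and division by \<open>0\<close> are \<open>0\<close> in HOL;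
  it holds, just as it does under the usual reading \<open>- log 0 = \<infinity>\<close>.\<close>

definition log_holder :: "((real ^ 'n) \<Rightarrow> real) set" where
  "log_holder = {u.
     (\<exists>C0. \<forall>x y. norm (x - y) < 1 / 2 \<longrightarrow> \<bar>u x - u y\<bar> \<le> C0 / (- ln (norm (x - y)))) \<and>
     (\<exists>C_inf u_inf. \<forall>x. \<bar>u x - u_inf\<bar> \<le> C_inf / ln (exp 1 + norm x))}"


section \<open>The variable Lebesgue norm\<close>

text \<open>The modular and the norm depend only on \<open>\<bar>f\<bar>\<close>. They are defined for functions with values in
  \<open>[0,\<infinity>]\<close>, since the inner norm in the constant of a matrix weight may be infinite.\<close>

definition ennreal_powr :: "ennreal \<Rightarrow> real \<Rightarrow> ennreal" where
  "ennreal_powr t a = (if t = \<infinity> then \<infinity> else ennreal (enn2real t powr a))"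

definition modular :: "((real ^ 'n) \<Rightarrow> ereal) \<Rightarrow> ((real ^ 'n) \<Rightarrow> ennreal) \<Rightarrow> ennreal" where
  "modular p f =
     (\<integral>\<^sup>+x\<in>- {x. p x = \<infinity>}. ennreal_powr (f x) (real_of_ereal (p x)) \<partial>lebesgue)
     + esssup (restrict_space lebesgue {x. p x = \<infinity>}) f"

definition Lp_norm :: "((real ^ 'n) \<Rightarrow> ereal) \<Rightarrow> ((real ^ 'n) \<Rightarrow> ennreal) \<Rightarrow> ennreal" where
  "Lp_norm p f = Inf {ennreal c | c. 0 < c \<and> modular p (\<lambda>x. f x / ennreal c) \<le> 1}"


section \<open>Matrix weights\<close>

definition pos_semidef :: "real ^ 'd ^ 'd \<Rightarrow> bool" where
  "pos_semidef A \<longleftrightarrow> transpose A = A \<and> (\<forall>v. 0 \<le> v \<bullet> (A *v v))"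

definition pos_def :: "real ^ 'd ^ 'd \<Rightarrow> bool" where
  "pos_def A \<longleftrightarrow> transpose A = A \<and> (\<forall>v. v \<noteq> 0 \<longrightarrow> 0 < v \<bullet> (A *v v))"

definition op_norm :: "real ^ 'd ^ 'd \<Rightarrow> real" where
  "op_norm A = onorm ((*v) A)"

definition matrix_weight :: "((real ^ 'n) \<Rightarrow> real ^ 'd ^ 'd) \<Rightarrow> bool" where
  "matrix_weight W \<longleftrightarrow>
     W \<in> borel_measurable lebesgue \<and> (\<forall>x. pos_semidef (W x)) \<and>
     (\<forall>K. compact K \<longrightarrow> set_integrable lebesgue K (\<lambda>x. op_norm (W x)))"

definition invertible_weight :: "((real ^ 'n) \<Rightarrow> real ^ 'd ^ 'd) \<Rightarrow> bool" where
  "invertible_weight W \<longleftrightarrow> matrix_weight W \<and> (AE x in lebesgue. pos_def (W x))"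

definition cubes :: "(real ^ 'n) set set" where
  "cubes = {cbox a (a + vec l) | a l. 0 < l}"

definition A_const :: "((real ^ 'n) \<Rightarrow> ereal) \<Rightarrow> ((real ^ 'n) \<Rightarrow> real ^ 'd ^ 'd) \<Rightarrow> ennreal" where
  "A_const p W = (SUP Q\<in>cubes. inverse (emeasure lebesgue Q) *
     Lp_norm p (\<lambda>x.
       Lp_norm (conj_exponent p)
         (\<lambda>y. ennreal (op_norm (W x ** matrix_inv (W y))) * indicator Q y) * indicator Q x))"

definition A_class :: "((real ^ 'n) \<Rightarrow> ereal) \<Rightarrow> ((real ^ 'n) \<Rightarrow> real ^ 'd ^ 'd) set" where
  "A_class p = {W. invertible_weight W \<and> A_const p W < \<infinity>}"

end

theory Submission
  imports Defs
begin

text \<open>Write \<open>k x y = |W(x) W\<inverse>(y)|\<close> for the operator norm of the quotient and, for a cube \<open>Q\<close>, let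
  \<open>g x\<close> be the norm of \<open>k x y * indicator Q y\<close> in \<open>y\<close>, with the conjugate exponent \<open>p'\<close>. The matrices enter only through
  the submultiplicativity \<open>k x y \<le> k x z * k z y\<close>, which gives \<open>g x \<le> k x z * g z\<close>. Together with Hoelder's
  inequality, the finiteness of the constant of \<open>W\<close> then says that \<open>g\<close> is a scalar weight for which the
  proportion in norm of a part \<open>E\<close> of a cube \<open>D\<close> is at least a multiple of its proportion in measure,

    \<open>|E| * norm of g on D \<le> A * |D| * norm of g on E\<close>,

  with \<open>A\<close> independent of \<open>Q\<close> (\<open>A_const_scaled_finite\<close>).

  The core is a reverse Hoelder inequality for scalar weights \<open>w\<close> with this property (\<open>reverse_hoelder\<close>): for
  some \<open>\<epsilon>0 > 0\<close> depending on \<open>p\<close> and \<open>A\<close>, and \<open>1 \<le> s \<le> 1 + \<epsilon>0\<close>, the norm of \<open>w\<close> on \<open>Q\<close> with the exponent \<open>s * p\<close> is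
  bounded by the norm with exponent \<open>p\<close>, in the normalisation that is sharp for constants. Applied to \<open>g\<close>
  it controls the outer norm. The passage from the inner norm with exponent \<open>p'\<close> to that with the conjugate
  of \<open>s * p\<close> is another use of Hoelder's inequality (\<open>conj_norm_scaled_le\<close>), and the powers of the norm of the
  indicator of \<open>Q\<close> that come from the two steps cancel.

  The reverse Hoelder inequality is reduced to a dyadic one (\<open>dyadic_reverse_hoelder\<close>), for measures of which
  a part of small volume carries only a fraction \<open>\<alpha> < 1\<close> of the mass of a cube. The difficulty is to get
  from norms to such measures, since with a variable exponent the norm is not a power of an integral.
  On a cube of side at most \<open>1\<close> the local log-Hoelder condition makes powers of the norms of subcubes
  nearly independent of the point at which the exponent is taken, and \<open>w powr p\<close> is such a density
  (\<open>small_cube_reverse_hoelder\<close>). On a large cube \<open>Q\<close> the norm of a unit subcube, relative to that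
  of \<open>Q\<close>, can be as small as \<open>1 / |Q|\<close>, whose powers with different exponents are not comparable; there
  the condition at infinity takes over: the norm on a union of unit
  cells is comparable to the sequence norm, with the constant exponent \<open>pinf\<close>, of the norms on the cells
  (\<open>cells_le_norm\<close>, \<open>modl_le_of_cells\<close>). So the dyadic inequality is used once inside each unit cell and
  once for the sequence of the norms on the cells (\<open>large_cube_reverse_hoelder\<close>).\<close>



section \<open>Dyadic cells\<close>

text \<open>Half-open cubes, so that dyadic subcubes of the same size are disjoint.\<close>

definition hcube :: "real ^ 'n \<Rightarrow> real \<Rightarrow> (real ^ 'n) set" where
  "hcube a l = {y. \<forall>i. a $ i \<le> y $ i \<and> y $ i < a $ i + l}"

definition cell_index :: "real ^ 'n \<Rightarrow> real \<Rightarrow> nat \<Rightarrow> real ^ 'n \<Rightarrow> 'n \<Rightarrow> int" where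
  "cell_index a l k x = (\<lambda>i. \<lfloor>(x $ i - a $ i) * 2 ^ k / l\<rfloor>)"

text \<open>The cell of \<open>x\<close> is the dyadic cube of side \<open>l / 2 ^ k\<close> that contains \<open>x\<close>, in the grid spanned by
  \<open>hcube a l\<close>. It is defined as an equivalence class of points of the whole space: the cells of one
  generation then partition the space, and no index set of cubes has to be carried along.\<close>

definition cell :: "real ^ 'n \<Rightarrow> real \<Rightarrow> nat \<Rightarrow> real ^ 'n \<Rightarrow> (real ^ 'n) set" where
  "cell a l k x = {y. cell_index a l k y = cell_index a l k x}"

lemma hcube_sets [measurable]: "hcube a l \<in> sets borel" for a :: "real ^ 'n"
proof -
  have "hcube a l = (\<Inter>i. {y. a $ i \<le> y $ i \<and> y $ i < a $ i + l})"
    by (auto simp: hcube_def)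
  also have "\<dots> \<in> sets borel"
    by (intro sets.finite_INT) auto
  finally show ?thesis .
qed

lemma hcube_sets_lebesgue [measurable, simp]: "hcube a l \<in> sets lebesgue"
  by simp

lemma hcube_cbox: "box a (a + vec l) \<subseteq> hcube a l" "hcube a l \<subseteq> cbox a (a + vec l)"
  by (auto simp: hcube_def mem_box_cart less_imp_le)

lemma emeasure_cube:
  fixes a :: "real ^ 'n"
  assumes "0 \<le> l"
  shows "emeasure lebesgue (cbox a (a + vec l)) = ennreal (l ^ CARD('n))"
    "emeasure lebesgue (box a (a + vec l)) = ennreal (l ^ CARD('n))"
proof -
  have "(\<Prod>b\<in>Basis. (a + vec l - a) \<bullet> b) = (\<Prod>b\<in>(Basis :: (real ^ 'n) set). l)"
    by (rule prod.cong) (auto simp: Basis_vec_def inner_axis)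
  also have "\<dots> = l ^ CARD('n)" by simp
  finally have *: "(\<Prod>b\<in>Basis. (a + vec l - a) \<bullet> b) = l ^ CARD('n)" .
  have b: "\<And>b. b \<in> Basis \<Longrightarrow> a \<bullet> b \<le> (a + vec l) \<bullet> b"
    using assms by (auto simp: Basis_vec_def inner_axis inner_add_left)
  show "emeasure lebesgue (cbox a (a + vec l)) = ennreal (l ^ CARD('n))"
    using emeasure_lborel_cbox[OF b] * by simp
  show "emeasure lebesgue (box a (a + vec l)) = ennreal (l ^ CARD('n))"
    using emeasure_lborel_box[OF b] * by simp
qed

lemma emeasure_hcube:
  fixes a :: "real ^ 'n"
  assumes "0 \<le> l"
  shows "emeasure lebesgue (hcube a l) = ennreal (l ^ CARD('n))"
proof (rule antisym)
  show "emeasure lebesgue (hcube a l) \<le> ennreal (l ^ CARD('n))"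
    unfolding emeasure_cube(1)[OF assms, of a, symmetric] by (rule emeasure_mono[OF hcube_cbox(2)]) simp
  show "ennreal (l ^ CARD('n)) \<le> emeasure lebesgue (hcube a l)"
    unfolding emeasure_cube(2)[OF assms, of a, symmetric] by (rule emeasure_mono[OF hcube_cbox(1)]) simp
qed

lemma measure_hcube:
  fixes a :: "real ^ 'n"
  assumes "0 \<le> l"
  shows "measure lebesgue (hcube a l) = l ^ CARD('n)"
  using emeasure_hcube[OF assms, of a] assms unfolding measure_def by simp

text \<open>Integrals over the closed cubes of the definition of the matrix class are integrals over half-open
  cubes.\<close>

lemma AE_cube_iff_hcube:
  fixes a :: "real ^ 'n"
  assumes "0 \<le> l"
  shows "AE x in lebesgue. x \<in> cbox a (a + vec l) \<longleftrightarrow> x \<in> hcube a l"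
proof -
  have "emeasure lebesgue (cbox a (a + vec l) - hcube a l) = 0"
    using emeasure_hcube[OF assms, of a] emeasure_cube(1)[OF assms, of a]
      emeasure_Diff[of lebesgue "hcube a l" "cbox a (a + vec l)"] hcube_cbox(2)[of a l]
    by (simp del: emeasure_completion)
  then have "AE x in lebesgue. x \<notin> cbox a (a + vec l) - hcube a l"
    by (intro AE_not_in null_setsI) auto
  then show ?thesis
    by eventually_elim (use hcube_cbox(2)[of a l] in auto)
qed

lemma cell_eq_hcube:
  fixes a :: "real ^ 'n"
  assumes "0 < l"
  shows "cell a l k x = hcube (\<chi> i. a $ i + l / 2 ^ k * real_of_int (cell_index a l k x i)) (l / 2 ^ k)"
proof -
  have "(\<lfloor>(y $ i - a $ i) * 2 ^ k / l\<rfloor> = z) \<longleftrightarrow>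
    a $ i + l / 2 ^ k * real_of_int z \<le> y $ i \<and> y $ i < a $ i + l / 2 ^ k * real_of_int z + l / 2 ^ k"
    for y :: "real ^ 'n" and i z
    using assms by (simp add: floor_eq_iff field_simps)
  then show ?thesis
    by (auto simp: cell_def hcube_def cell_index_def fun_eq_iff)
qed

lemma cell_0: assumes "0 < l" shows "cell a l 0 a = hcube a l"
  by (subst cell_eq_hcube[OF assms]) (simp add: hcube_def cell_index_def)

lemma cell_sets [measurable, simp]: "0 < l \<Longrightarrow> cell a l k x \<in> sets lebesgue"
  by (simp add: cell_eq_hcube)

lemma emeasure_cell:
  fixes a :: "real ^ 'n"
  assumes "0 < l"
  shows "emeasure lebesgue (cell a l k x) = ennreal ((l / 2 ^ k) ^ CARD('n))"
  unfolding cell_eq_hcube[OF assms] by (rule emeasure_hcube) (use assms in simp)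

lemma self_in_cell [simp]: "x \<in> cell a l k x"
  by (simp add: cell_def)

lemma cell_eq: "y \<in> cell a l k x \<Longrightarrow> cell a l k y = cell a l k x"
  by (auto simp: cell_def)

lemma cell_index_coarser:
  assumes "k \<le> m"
  shows "cell_index a l k x = (\<lambda>i. cell_index a l m x i div 2 ^ (m - k))"
proof
  fix i
  have "(x $ i - a $ i) * 2 ^ k / l = ((x $ i - a $ i) * 2 ^ m / l) / real_of_int (2 ^ (m - k))"
  proof -
    have "(2::real) ^ m = 2 ^ k * 2 ^ (m - k)" using assms by (simp flip: power_add)
    then show ?thesis by simp
  qed
  then show "cell_index a l k x i = cell_index a l m x i div 2 ^ (m - k)"
    unfolding cell_index_def by (metis floor_divide_real_eq_div zero_le_numeral zero_le_power)
qed

lemma cell_mono: "k \<le> m \<Longrightarrow> cell a l m x \<subseteq> cell a l k x"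
  by (auto simp: cell_def cell_index_coarser)

lemma cell_subset: "y \<in> cell a l k x \<Longrightarrow> k \<le> m \<Longrightarrow> cell a l m y \<subseteq> cell a l k x"
  using cell_mono cell_eq by metis

lemma norm_less_of_hcube:
  fixes x y :: "real ^ 'n" and l :: real
  assumes "x \<in> hcube a l" "y \<in> hcube a l"
  shows "norm (x - y) \<le> CARD('n) * l"
proof -
  have "norm (x - y) \<le> (\<Sum>i\<in>UNIV. \<bar>(x - y) $ i\<bar>)" by (rule norm_le_l1_cart)
  also have "\<dots> \<le> (\<Sum>i\<in>(UNIV::'n set). l)"
  proof (rule sum_mono)
    fix i :: 'n
    have "a $ i \<le> x $ i \<and> x $ i < a $ i + l" "a $ i \<le> y $ i \<and> y $ i < a $ i + l"
      using assms unfolding hcube_def by blast+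
    then show "\<bar>(x - y) $ i\<bar> \<le> l" by (simp add: abs_if)
  qed
  finally show ?thesis by simp
qed

lemma norm_less_of_cell:
  fixes x y :: "real ^ 'n"
  assumes "0 < l" "y \<in> cell a l k x"
  shows "norm (x - y) \<le> CARD('n) * (l / 2 ^ k)"
  using assms(2) self_in_cell[of x a l k] norm_less_of_hcube[of x _ "l / 2 ^ k" y]
  unfolding cell_eq_hcube[OF assms(1)] by blast

lemma cell_in_open:
  fixes x :: "real ^ 'n"
  assumes "0 < l" "open T" "x \<in> T"
  obtains k where "cell a l k x \<subseteq> T"
proof -
  obtain e where e: "0 < e" "ball x e \<subseteq> T" using assms openE by blast
  have "(\<lambda>k. CARD('n) * (l / 2 ^ k)) \<longlonglongrightarrow> 0"
    using tendsto_mult_right_zero[OF LIMSEQ_power_zero[of "1/2::real"], of "CARD('n) * l"]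
    by (simp add: power_divide)
  then obtain k where k: "CARD('n) * (l / 2 ^ k) < e"
    using order_tendstoD(2)[of _ 0 sequentially e] e(1) eventually_happens'[of sequentially] by fastforce
  have "cell a l k x \<subseteq> ball x e"
    using norm_less_of_cell[OF assms(1)] k by (fastforce simp: dist_norm)
  then show ?thesis using e that by blast
qed

definition cell_union :: "real ^ 'n \<Rightarrow> real \<Rightarrow> nat \<Rightarrow> (real ^ 'n) set \<Rightarrow> bool" where
  "cell_union a l k S \<longleftrightarrow> (\<forall>y\<in>S. cell a l k y \<subseteq> S)"

lemma cell_union_cell: "k \<le> m \<Longrightarrow> cell_union a l m (cell a l k x)"
  by (simp add: cell_union_def cell_subset)

lemma cell_union_finer: "k \<le> m \<Longrightarrow> cell_union a l k S \<Longrightarrow> cell_union a l m S"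
  using cell_mono unfolding cell_union_def by blast

lemma cell_union_Diff:
  "cell_union a l k S \<Longrightarrow> cell_union a l k T \<Longrightarrow> cell_union a l k (S - T)"
  unfolding cell_union_def cell_def by (fastforce)

lemma cell_index_measurable:
  assumes "0 < l"
  shows "cell_index a l k \<in> measurable lebesgue (count_space UNIV)"
proof -
  have "cell_index a l k -` {z} \<in> sets lebesgue" for z
  proof (cases "\<exists>x. cell_index a l k x = z")
    case True
    then obtain x where "cell_index a l k x = z" by blast
    then have "cell_index a l k -` {z} = cell a l k x" by (auto simp: cell_def)
    then show ?thesis using assms by simp
  qed (auto simp: vimage_def)
  then show ?thesis
    by (subst measurable_count_space_eq_countable) auto
qed

text \<open>A function that is constant on cells factors through the index map, which has countable range.\<close>

lemma cell_step_measurable: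
  assumes "0 < l" and step: "\<And>x y. y \<in> cell a l k x \<Longrightarrow> f y = f x"
  shows "f \<in> borel_measurable lebesgue"
proof -
  define g where "g z = f (SOME x. cell_index a l k x = z)" for z
  have "f x = g (cell_index a l k x)" for x
    unfolding g_def
    by (rule sym, rule step) (auto simp: cell_def intro: someI)
  then have "f = g \<circ> cell_index a l k" by auto
  then show ?thesis
    using measurable_comp[OF cell_index_measurable[OF assms(1)], of g borel] by simp
qed

lemma cell_union_sets:
  assumes "0 < l" "cell_union a l k S"
  shows "S \<in> sets lebesgue"
proof -
  have "(\<lambda>x. indicator S x :: real) \<in> borel_measurable lebesgue"
  proof (rule cell_step_measurable[OF assms(1)])
    fix x y assume "y \<in> cell a l k x"
    moreover then have "x \<in> cell a l k y" by (auto simp: cell_def)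
    ultimately show "indicator S y = (indicator S x :: real)"
      using assms(2) unfolding cell_union_def indicator_def by auto
  qed
  then have "(\<lambda>x. indicator S x :: real) -` {1} \<inter> space lebesgue \<in> sets lebesgue"
    by (rule measurable_sets) simp
  moreover have "(\<lambda>x. indicator S x :: real) -` {1} = S" by (auto simp: indicator_def)
  ultimately show ?thesis by simp
qed

lemma emeasure_cell_union:
  fixes a :: "real ^ 'n"
  assumes l: "0 < l" and S: "cell_union a l k S" and M: "sets M = sets lebesgue"
  shows "emeasure M S = (\<integral>\<^sup>+z. emeasure M (cell_index a l k -` {z} \<inter> S) \<partial>count_space UNIV)"
proof -
  let ?X = "\<lambda>z. cell_index a l k -` {z} \<inter> S"
  have "S \<in> sets lebesgue" using cell_union_sets l S by blast
  then have sets: "?X z \<in> sets M" for z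
    using measurable_sets[OF cell_index_measurable[OF l], of "{z}" a k] M by auto
  have "S = (\<Union>z\<in>UNIV. ?X z)" by auto
  then have "emeasure M S = emeasure M (\<Union>z\<in>UNIV. ?X z)" by simp
  also have "\<dots> = (\<integral>\<^sup>+z. emeasure M (?X z) \<partial>count_space UNIV)"
    by (rule emeasure_UN_countable) (use sets in \<open>auto simp: disjoint_family_on_def\<close>)
  finally show ?thesis .
qed

text \<open>Since the cells of one generation form a countable partition, an inequality between integrals over a
  union of cells may be checked on each cell. This replaces all sums over families of cubes.\<close>

lemma nn_integral_cellwise_mono:
  fixes a :: "real ^ 'n"
  assumes l: "0 < l" and S: "cell_union a l k S"
    and M: "sets M = sets lebesgue" "sets N = sets lebesgue"
    and F: "F \<in> borel_measurable lebesgue" "G \<in> borel_measurable lebesgue"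
    and le: "\<And>y. y \<in> S \<Longrightarrow>
      (\<integral>\<^sup>+x\<in>cell a l k y. F x \<partial>M) \<le> (\<integral>\<^sup>+x\<in>cell a l k y. G x \<partial>N)"
  shows "(\<integral>\<^sup>+x\<in>S. F x \<partial>M) \<le> (\<integral>\<^sup>+x\<in>S. G x \<partial>N)"
proof -
  have S': "S \<in> sets lebesgue" using cell_union_sets l S by blast
  have FM: "F \<in> borel_measurable M" "G \<in> borel_measurable N"
    using F M by (simp_all cong: measurable_cong_sets)
  have d: "emeasure (density M F) A = (\<integral>\<^sup>+x\<in>A. F x \<partial>M)" "emeasure (density N G) A = (\<integral>\<^sup>+x\<in>A. G x \<partial>N)"
    if "A \<in> sets lebesgue" for A
    using that FM M by (auto intro!: emeasure_density)
  have "(\<integral>\<^sup>+x\<in>S. F x \<partial>M) = emeasure (density M F) S" using S' d by simp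
  also have "\<dots> = (\<integral>\<^sup>+z. emeasure (density M F) (cell_index a l k -` {z} \<inter> S) \<partial>count_space UNIV)"
    by (rule emeasure_cell_union) (use l S M in auto)
  also have "\<dots> \<le> (\<integral>\<^sup>+z. emeasure (density N G) (cell_index a l k -` {z} \<inter> S) \<partial>count_space UNIV)"
  proof (rule nn_integral_mono)
    fix z
    show "emeasure (density M F) (cell_index a l k -` {z} \<inter> S) \<le> emeasure (density N G) (cell_index a l k -` {z} \<inter> S)"
    proof (cases "cell_index a l k -` {z} \<inter> S = {}")
      case False
      then obtain y where y: "y \<in> S" "cell_index a l k y = z" by auto
      then have "cell_index a l k -` {z} = cell a l k y" by (auto simp: cell_def)
      moreover have "cell a l k y \<subseteq> S" using S y by (auto simp: cell_union_def)
      ultimately have "cell_index a l k -` {z} \<inter> S = cell a l k y" by auto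
      then show ?thesis using le[OF y(1)] d l by simp
    qed simp
  qed
  also have "\<dots> = emeasure (density N G) S"
    by (rule emeasure_cell_union[symmetric]) (use l S M in auto)
  also have "\<dots> = (\<integral>\<^sup>+x\<in>S. G x \<partial>N)" using S' d by simp
  finally show ?thesis .
qed

lemma emeasure_cellwise_mono:
  fixes a :: "real ^ 'n"
  assumes l: "0 < l" and S: "cell_union a l k S"
    and M: "sets M = sets lebesgue" "sets N = sets lebesgue"
    and le: "\<And>y. y \<in> S \<Longrightarrow> emeasure M (cell a l k y) \<le> c * emeasure N (cell a l k y)"
  shows "emeasure M S \<le> c * emeasure N S"
proof -
  have S': "S \<in> sets lebesgue" using cell_union_sets l S by blast
  have "(\<integral>\<^sup>+x\<in>S. 1 \<partial>M) \<le> (\<integral>\<^sup>+x\<in>S. c \<partial>N)"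
    by (rule nn_integral_cellwise_mono[OF l S M])
      (use le M l in \<open>auto simp: nn_integral_cmult_indicator\<close>)
  then show ?thesis using S' M by (simp add: nn_integral_cmult_indicator)
qed


section \<open>A dyadic reverse Hoelder inequality\<close>

text \<open>The denominator is the volume of a cell of generation \<open>k\<close>.\<close>

definition cell_avg :: "(real ^ 'n) measure \<Rightarrow> real ^ 'n \<Rightarrow> real \<Rightarrow> nat \<Rightarrow> real ^ 'n \<Rightarrow> real" where
  "cell_avg \<nu> a l k x = measure \<nu> (cell a l k x) / (l / 2 ^ k) ^ CARD('n)"

definition max_avg ::
  "(real ^ 'n) measure \<Rightarrow> real ^ 'n \<Rightarrow> real \<Rightarrow> nat \<Rightarrow> nat \<Rightarrow> real ^ 'n \<Rightarrow> real" where
  "max_avg \<nu> a l k K x = Max ((\<lambda>j. cell_avg \<nu> a l j x) ` {k..K})"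

lemma cell_avg_nonneg: "0 \<le> l \<Longrightarrow> 0 \<le> cell_avg \<nu> a l k x"
  by (simp add: cell_avg_def)

lemma cell_avg_cong: "y \<in> cell a l k x \<Longrightarrow> j \<le> k \<Longrightarrow> cell_avg \<nu> a l j y = cell_avg \<nu> a l j x"
  using cell_mono[of j k a l x] cell_eq[of y a l j x] by (auto simp: cell_avg_def)

lemma cell_avg_measurable [measurable]:
  "0 < l \<Longrightarrow> cell_avg \<nu> a l k \<in> borel_measurable lebesgue"
  by (rule cell_step_measurable) (auto intro: cell_avg_cong)

lemma max_avg_measurable [measurable]:
  assumes "0 < l" shows "max_avg \<nu> a l k K \<in> borel_measurable lebesgue"
proof -
  have "max_avg \<nu> a l k K y = max_avg \<nu> a l k K x" if "y \<in> cell a l K x" for x y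
    unfolding max_avg_def
    by (rule arg_cong[where f = Max], rule image_cong) (use that cell_avg_cong in auto)
  then show ?thesis using cell_step_measurable[OF assms] by blast
qed

lemma max_avg_nonneg: "0 \<le> l \<Longrightarrow> k \<le> K \<Longrightarrow> 0 \<le> max_avg \<nu> a l k K x"
  unfolding max_avg_def by (subst Max_ge_iff) (auto intro!: bexI[of _ k] simp: cell_avg_nonneg)

lemma cell_avg_le_max_avg: "k \<le> j \<Longrightarrow> j \<le> K \<Longrightarrow> cell_avg \<nu> a l j x \<le> max_avg \<nu> a l k K x"
  unfolding max_avg_def by (rule Max_ge) auto

lemma max_avg_le: "k \<le> K \<Longrightarrow> (\<And>j. k \<le> j \<Longrightarrow> j \<le> K \<Longrightarrow> cell_avg \<nu> a l j x \<le> c) \<Longrightarrow> max_avg \<nu> a l k K x \<le> c"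
  unfolding max_avg_def by (subst Max_le_iff) auto

lemma cell_avg_child:
  fixes a :: "real ^ 'n"
  assumes "0 < l" "sets \<nu> = sets lebesgue" "emeasure \<nu> (cell a l k x) < \<infinity>"
  shows "cell_avg \<nu> a l (Suc k) x \<le> 2 ^ CARD('n) * cell_avg \<nu> a l k x"
proof -
  have "measure \<nu> (cell a l (Suc k) x) \<le> measure \<nu> (cell a l k x)"
    by (rule measure_mono_fmeasurable) (use assms cell_mono[of k "Suc k" a l x] in \<open>auto simp: fmeasurable_def\<close>)
  then have "cell_avg \<nu> a l (Suc k) x \<le> measure \<nu> (cell a l k x) / (l / 2 ^ Suc k) ^ CARD('n)"
    unfolding cell_avg_def using assms by (intro divide_right_mono) auto
  also have "(l / 2 ^ Suc k) ^ CARD('n) = (l / 2 ^ k) ^ CARD('n) / 2 ^ CARD('n)"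
    by (simp add: field_simps power_mult_distrib power_divide)
  finally show ?thesis by (simp add: cell_avg_def mult.commute)
qed

text \<open>The dyadic reverse Hoelder inequality, for the averages of \<open>\<nu>\<close> down to a finite generation \<open>K\<close> and
  with constants independent of \<open>K\<close>. It goes by induction on the number of remaining generations. Let
  \<open>t\<close> be the average over the current cell \<open>D\<close>, and stop at the first descendants with average above
  \<open>2 * t\<close>. Off the stopped cells the maximal average is at most \<open>2 * t\<close>. The stopped cells fill at most half
  of the volume of \<open>D\<close>, so by hypothesis they carry at most the fraction \<open>\<alpha>\<close> of its mass; the average over
  a stopped cell is at most \<open>2 ^ n * (2 * t)\<close>, because its parent was not stopped, and the induction
  hypothesis applies there. The hypothesis \<open>bound\<close> is exactly what closes the induction.\<close>

lemma dyadic_reverse_hoelder: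
  fixes a :: "real ^ 'n"
  assumes l: "0 < l" and \<nu>: "sets \<nu> = sets lebesgue"
    and fin: "emeasure \<nu> (cell a l 0 x0) < \<infinity>"
    and \<epsilon>: "0 \<le> \<epsilon>" and \<alpha>: "0 \<le> \<alpha>" and C: "0 \<le> C"
    and bound: "2 powr \<epsilon> + C * (2 * 2 ^ CARD('n)) powr \<epsilon> * \<alpha> \<le> C"
    and ainf: "\<And>k x E. k \<le> K \<Longrightarrow> x \<in> cell a l 0 x0 \<Longrightarrow> E \<subseteq> cell a l k x \<Longrightarrow> cell_union a l K E \<Longrightarrow>
      2 * emeasure lebesgue E \<le> emeasure lebesgue (cell a l k x) \<Longrightarrow>
      emeasure \<nu> E \<le> ennreal \<alpha> * emeasure \<nu> (cell a l k x)"
    and "k \<le> K" "x \<in> cell a l 0 x0"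
  shows "(\<integral>\<^sup>+y\<in>cell a l k x. ennreal (max_avg \<nu> a l k K y powr \<epsilon>) \<partial>\<nu>)
    \<le> ennreal (C * cell_avg \<nu> a l k x powr \<epsilon>) * emeasure \<nu> (cell a l k x)"
  using \<open>k \<le> K\<close> \<open>x \<in> cell a l 0 x0\<close>
proof (induction "K - k" arbitrary: k x rule: less_induct)
  case less
  let ?c = "\<lambda>j. cell a l j" and ?av = "\<lambda>j. cell_avg \<nu> a l j"
  define D where "D = ?c k x"
  define t where "t = ?av k x"
  have meas_f: "f \<in> borel_measurable \<nu>" if "f \<in> borel_measurable lebesgue" for f :: "real ^ 'n \<Rightarrow> real"
    using that \<nu> by (simp cong: measurable_cong_sets)
  have c_sets [simp]: "?c j y \<in> sets \<nu>" for j y using \<nu> l by simp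
  have DQ: "D \<subseteq> ?c 0 x0" unfolding D_def using cell_subset[OF less.prems(2)] by simp
  have c_fin: "emeasure \<nu> (?c j y) < \<infinity>" if "y \<in> ?c 0 x0" for j y
    using emeasure_mono[of "?c j y" "?c 0 x0" \<nu>] cell_subset[OF that, of j] fin by simp
  have c_eq: "emeasure \<nu> (?c j y) = ennreal (?av j y) * emeasure lebesgue (?c j y)"
    if "y \<in> ?c 0 x0" for j y
  proof -
    have "emeasure \<nu> (?c j y) = ennreal (measure \<nu> (?c j y))"
      using c_fin[OF that, of j] by (simp add: emeasure_eq_ennreal_measure less_top)
    also have "measure \<nu> (?c j y) = ?av j y * (l / 2 ^ j) ^ CARD('n)"
      using l by (simp add: cell_avg_def)
    finally show ?thesis using l emeasure_cell[OF l, of a j y] cell_avg_nonneg[of l \<nu> a j y]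
      by (simp add: ennreal_mult del: emeasure_completion)
  qed
  have t0: "0 \<le> t" unfolding t_def using l by (simp add: cell_avg_nonneg)
  have Dfin: "emeasure \<nu> D < \<infinity>" unfolding D_def using c_fin less.prems by blast
  show ?case
  proof (cases "t = 0")
    case True
    then have "emeasure \<nu> D = 0" unfolding D_def t_def using c_eq[OF less.prems(2), of k] by simp
    then have "D \<in> null_sets \<nu>" unfolding D_def by auto
    then have "(\<integral>\<^sup>+y\<in>D. ennreal (max_avg \<nu> a l k K y powr \<epsilon>) \<partial>\<nu>) = 0"
      by (rule nn_integral_null_set)
    then show ?thesis unfolding D_def by simp
  next
    case False
    then have t: "0 < t" using t0 by simp
    define S where "S j = {y \<in> D. 2 * t < ?av j y \<and> (\<forall>i\<in>{k..<j}. ?av i y \<le> 2 * t)}" for j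
    define U where "U = (\<Union>j\<in>{k<..K}. S j)"
    define F where "F y = ennreal (max_avg \<nu> a l k K y powr \<epsilon>)" for y
    have F_meas: "F \<in> borel_measurable lebesgue"
      unfolding F_def using l by measurable
    have F_meas_\<nu>: "F \<in> borel_measurable \<nu>" using F_meas \<nu> by (simp cong: measurable_cong_sets)
    have av_D: "?av k y = t" if "y \<in> D" for y
      using that cell_avg_cong[of y a l k x k \<nu>] unfolding D_def t_def by simp
    have cu: "cell_union a l j (S j)" if "k < j" for j
      unfolding cell_union_def
    proof (intro ballI subsetI)
      fix y z assume y: "y \<in> S j" and z: "z \<in> ?c j y"
      have "?c j y \<subseteq> D" using y that cell_subset[of y a l k x j] by (auto simp: S_def D_def)
      moreover have "?av i z = ?av i y" if "i \<le> j" for i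
        using cell_avg_cong[OF z that] .
      ultimately show "z \<in> S j" using y z by (auto simp: S_def)
    qed
    have S_sets: "S j \<in> sets \<nu>" "S j \<in> sets lebesgue" if "k < j" for j
      using cell_union_sets[OF l cu[OF that]] \<nu> by auto
    have D_sets: "D \<in> sets \<nu>" unfolding D_def by simp
    have disj: "disjoint_family_on S {k<..K}"
      unfolding disjoint_family_on_def
    proof (intro ballI impI)
      fix m n assume *: "m \<in> {k<..K}" "n \<in> {k<..K}" "m \<noteq> n"
      then have "m < n \<or> n < m" by arith
      then show "S m \<inter> S n = {}" using * by (auto simp: S_def not_less[symmetric])
    qed
    have U_sets: "U \<in> sets \<nu>" "U \<in> sets lebesgue" unfolding U_def using S_sets by auto
    have UD: "U \<subseteq> D" by (auto simp: U_def S_def)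
    have sumU: "(\<Sum>j\<in>{k<..K}. emeasure \<nu> (S j)) = emeasure \<nu> U"
      unfolding U_def by (rule sum_emeasure) (use S_sets disj in auto)
    have sumUl: "(\<Sum>j\<in>{k<..K}. emeasure lebesgue (S j)) = emeasure lebesgue U"
      unfolding U_def by (rule sum_emeasure) (use S_sets disj in auto)
    have D_Suc: "?av j y \<le> 2 ^ CARD('n) * (2 * t)" if j: "k < j" and y: "y \<in> S j" for j y
    proof -
      obtain i where i: "j = Suc i" "k \<le> i" using j by (cases j) auto
      then have "?av i y \<le> 2 * t" using y by (auto simp: S_def)
      moreover have "?av (Suc i) y \<le> 2 ^ CARD('n) * ?av i y"
        by (rule cell_avg_child[OF l \<nu>]) (use c_fin y DQ in \<open>auto simp: S_def\<close>)
      ultimately show ?thesis unfolding i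
        by (meson mult_left_mono order_trans zero_le_numeral zero_le_power)
    qed
    \<comment> \<open>the stopped cells carry at most half of the volume\<close>
    have "emeasure lebesgue (S j) \<le> ennreal (1 / (2 * t)) * emeasure \<nu> (S j)" if "k < j" for j
    proof (rule emeasure_cellwise_mono[OF l cu[OF that] refl \<nu>])
      fix y assume y: "y \<in> S j"
      then have "y \<in> ?c 0 x0" using DQ by (auto simp: S_def)
      have "1 \<le> 1 / (2 * t) * ?av j y" using y t by (simp add: S_def field_simps)
      then have "emeasure lebesgue (?c j y) \<le> ennreal (1 / (2 * t) * ?av j y) * emeasure lebesgue (?c j y)"
        using mult_right_mono[of 1 "ennreal (1 / (2 * t) * ?av j y)"] by (simp del: emeasure_completion)
      also have "\<dots> = ennreal (1 / (2 * t)) * emeasure \<nu> (?c j y)"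
        unfolding c_eq[OF \<open>y \<in> ?c 0 x0\<close>]
        using t by (subst ennreal_mult') (simp_all add: mult.assoc del: emeasure_completion)
      finally show "emeasure lebesgue (?c j y) \<le> ennreal (1 / (2 * t)) * emeasure \<nu> (?c j y)" .
    qed
    then have "emeasure lebesgue U \<le> ennreal (1 / (2 * t)) * emeasure \<nu> U"
      unfolding sumU[symmetric] sumUl[symmetric] sum_distrib_left by (intro sum_mono) auto
    also have "\<dots> \<le> ennreal (1 / (2 * t)) * emeasure \<nu> D"
      using emeasure_mono[OF UD D_sets] by (rule mult_left_mono) simp
    also have "emeasure \<nu> D = ennreal t * emeasure lebesgue D"
      unfolding D_def t_def by (rule c_eq[OF less.prems(2)])
    also have "ennreal (1 / (2 * t)) * (ennreal t * emeasure lebesgue D) = ennreal (1 / 2) * emeasure lebesgue D"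
      unfolding mult.assoc[symmetric] using t by (simp add: ennreal_mult[symmetric])
    finally have "2 * emeasure lebesgue U \<le> 2 * (ennreal (1 / 2) * emeasure lebesgue D)"
      by (rule mult_left_mono) simp
    also have "\<dots> = emeasure lebesgue D"
    proof -
      have "(2::ennreal) * ennreal (1 / 2) = 1"
        by (metis ennreal_1 ennreal_mult' ennreal_numeral mult_2 field_sum_of_halves zero_le_numeral)
      then show ?thesis unfolding mult.assoc[symmetric] by simp
    qed
    finally have half: "2 * emeasure lebesgue U \<le> emeasure lebesgue D" .
    have "cell_union a l K U"
      unfolding U_def cell_union_def
    proof (intro ballI)
      fix y assume "y \<in> (\<Union>j\<in>{k<..K}. S j)"
      then obtain j where j: "j \<in> {k<..K}" "y \<in> S j" by blast
      then have "?c K y \<subseteq> S j" using cell_union_finer[OF _ cu, of j K] by (auto simp: cell_union_def)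
      then show "?c K y \<subseteq> (\<Union>j\<in>{k<..K}. S j)" using j by blast
    qed
    then have \<nu>U: "emeasure \<nu> U \<le> ennreal \<alpha> * emeasure \<nu> D"
      using ainf[OF less.prems, of U] UD half unfolding D_def by blast
    \<comment> \<open>on a stopped cell the earlier averages do not contribute to the maximal function\<close>
    have int_S: "(\<integral>\<^sup>+y\<in>S j. F y \<partial>\<nu>) \<le> ennreal (C * (2 ^ CARD('n) * (2 * t)) powr \<epsilon>) * emeasure \<nu> (S j)"
      if j: "j \<in> {k<..K}" for j
    proof -
      have kj: "k < j" "j \<le> K" using j by auto
      have "(\<integral>\<^sup>+y\<in>S j. F y \<partial>\<nu>) \<le> (\<integral>\<^sup>+y\<in>S j. ennreal (C * (2 ^ CARD('n) * (2 * t)) powr \<epsilon>) \<partial>\<nu>)"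
      proof (rule nn_integral_cellwise_mono[OF l cu[OF kj(1)] \<nu> \<nu> F_meas])
        fix y assume y: "y \<in> S j"
        then have yQ: "y \<in> ?c 0 x0" using DQ by (auto simp: S_def)
        have "max_avg \<nu> a l k K z \<le> max_avg \<nu> a l j K z" if z: "z \<in> ?c j y" for z
        proof (rule max_avg_le)
          fix i assume i: "k \<le> i" "i \<le> K"
          show "?av i z \<le> max_avg \<nu> a l j K z"
          proof (cases "j \<le> i")
            case False
            have zS: "z \<in> S j" using cu[OF kj(1)] y z by (auto simp: cell_union_def)
            then have "?av i z \<le> 2 * t" "2 * t < ?av j z" using False i by (auto simp: S_def)
            then show ?thesis using cell_avg_le_max_avg[of j j K \<nu> a l z] kj by simp
          next
            case True
            then show ?thesis using i(2) by (rule cell_avg_le_max_avg)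
          qed
        qed (use kj in simp)
        then have "(\<integral>\<^sup>+z\<in>?c j y. F z \<partial>\<nu>) \<le> (\<integral>\<^sup>+z\<in>?c j y. ennreal (max_avg \<nu> a l j K z powr \<epsilon>) \<partial>\<nu>)"
          unfolding F_def using l kj \<epsilon>
          by (intro nn_integral_mono) (auto simp: indicator_def max_avg_nonneg intro!: ennreal_leI powr_mono2)
        also have "\<dots> \<le> ennreal (C * ?av j y powr \<epsilon>) * emeasure \<nu> (?c j y)"
          by (rule less.hyps) (use kj yQ in auto)
        also have "\<dots> \<le> ennreal (C * (2 ^ CARD('n) * (2 * t)) powr \<epsilon>) * emeasure \<nu> (?c j y)"
          using D_Suc[OF kj(1) y] C \<epsilon> l
          by (intro mult_right_mono ennreal_leI mult_left_mono powr_mono2) (auto simp: cell_avg_nonneg)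
        finally show "(\<integral>\<^sup>+z\<in>?c j y. F z \<partial>\<nu>) \<le> (\<integral>\<^sup>+z\<in>?c j y. ennreal (C * (2 ^ CARD('n) * (2 * t)) powr \<epsilon>) \<partial>\<nu>)"
          by (simp add: nn_integral_cmult_indicator)
      qed simp
      then show ?thesis using S_sets[OF kj(1)] by (simp add: nn_integral_cmult_indicator)
    qed
    have int_rest: "(\<integral>\<^sup>+y\<in>D - U. F y \<partial>\<nu>) \<le> ennreal ((2 * t) powr \<epsilon>) * emeasure \<nu> D"
    proof -
      have "max_avg \<nu> a l k K y \<le> 2 * t" if y: "y \<in> D - U" for y
      proof (rule ccontr)
        assume "\<not> max_avg \<nu> a l k K y \<le> 2 * t"
        then obtain j where "k \<le> j" "j \<le> K" "\<not> ?av j y \<le> 2 * t"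
          using max_avg_le[OF less.prems(1), of \<nu> a l y "2 * t"] by blast
        then have ex: "\<exists>j. k \<le> j \<and> j \<le> K \<and> \<not> ?av j y \<le> 2 * t" by blast
        define m where "m = (LEAST j. k \<le> j \<and> j \<le> K \<and> \<not> ?av j y \<le> 2 * t)"
        have m: "k \<le> m" "m \<le> K" "2 * t < ?av m y"
          using LeastI_ex[OF ex] unfolding m_def[symmetric] by auto
        have m': "?av i y \<le> 2 * t" if "i \<in> {k..<m}" for i
          using not_less_Least[of i "\<lambda>j. k \<le> j \<and> j \<le> K \<and> \<not> ?av j y \<le> 2 * t"] that m
          unfolding m_def[symmetric] by auto
        have "m \<noteq> k" using m av_D[of y] y t by auto
        then have "y \<in> U" using m m' y unfolding U_def S_def by (auto intro!: bexI[of _ m])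
        then show False using y by simp
      qed
      then have "(\<integral>\<^sup>+y\<in>D - U. F y \<partial>\<nu>) \<le> (\<integral>\<^sup>+y\<in>D. ennreal ((2 * t) powr \<epsilon>) \<partial>\<nu>)"
        unfolding F_def using l less.prems \<epsilon>
        by (intro nn_integral_mono) (auto simp: indicator_def max_avg_nonneg intro!: ennreal_leI powr_mono2)
      then show ?thesis using D_sets by (simp add: nn_integral_cmult_indicator)
    qed
    define \<mu> where "\<mu> = density \<nu> F"
    have \<mu>: "emeasure \<mu> A = (\<integral>\<^sup>+y\<in>A. F y \<partial>\<nu>)" if "A \<in> sets \<nu>" for A
      unfolding \<mu>_def using F_meas_\<nu> that by (rule emeasure_density)
    have \<mu>_sets: "sets \<mu> = sets \<nu>" by (simp add: \<mu>_def)
    have "emeasure \<mu> D = emeasure \<mu> ((D - U) \<union> U)"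
      using UD by (simp add: Un_absorb2)
    also have "\<dots> \<le> emeasure \<mu> (D - U) + emeasure \<mu> U"
      by (rule emeasure_subadditive) (use \<mu>_sets D_sets U_sets in auto)
    also have "emeasure \<mu> U \<le> (\<Sum>j\<in>{k<..K}. emeasure \<mu> (S j))"
      unfolding U_def by (rule emeasure_subadditive_finite) (use \<mu>_sets S_sets in auto)
    also have "\<dots> \<le> (\<Sum>j\<in>{k<..K}. ennreal (C * (2 ^ CARD('n) * (2 * t)) powr \<epsilon>) * emeasure \<nu> (S j))"
      using int_S \<mu> S_sets by (intro sum_mono) auto
    also have "\<dots> = ennreal (C * (2 ^ CARD('n) * (2 * t)) powr \<epsilon>) * emeasure \<nu> U"
      by (simp only: sum_distrib_left[symmetric] sumU)
    also have "\<dots> \<le> ennreal (C * (2 ^ CARD('n) * (2 * t)) powr \<epsilon>) * (ennreal \<alpha> * emeasure \<nu> D)"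
      using \<nu>U by (rule mult_left_mono) simp
    also have "emeasure \<mu> (D - U) \<le> ennreal ((2 * t) powr \<epsilon>) * emeasure \<nu> D"
      using int_rest \<mu> D_sets U_sets by simp
    finally have "emeasure \<mu> D \<le> ennreal ((2 * t) powr \<epsilon>) * emeasure \<nu> D +
        ennreal (C * (2 ^ CARD('n) * (2 * t)) powr \<epsilon>) * (ennreal \<alpha> * emeasure \<nu> D)"
      by (simp add: add_mono)
    also have "\<dots> = ennreal ((2 * t) powr \<epsilon> + C * (2 ^ CARD('n) * (2 * t)) powr \<epsilon> * \<alpha>) * emeasure \<nu> D"
      using C \<alpha> t by (simp add: ennreal_mult distrib_right mult.assoc)
    also have "\<dots> \<le> ennreal (C * t powr \<epsilon>) * emeasure \<nu> D"
    proof (intro mult_right_mono ennreal_leI)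
      have "(2 * t) powr \<epsilon> + C * (2 ^ CARD('n) * (2 * t)) powr \<epsilon> * \<alpha>
        = (2 powr \<epsilon> + C * (2 * 2 ^ CARD('n)) powr \<epsilon> * \<alpha>) * t powr \<epsilon>"
        using t by (simp add: powr_mult algebra_simps)
      also have "\<dots> \<le> C * t powr \<epsilon>" using bound by (intro mult_right_mono) auto
      finally show "(2 * t) powr \<epsilon> + C * (2 ^ CARD('n) * (2 * t)) powr \<epsilon> * \<alpha> \<le> C * t powr \<epsilon>" .
    qed simp
    finally show ?thesis using \<mu>[OF D_sets] unfolding F_def D_def t_def by simp
  qed
qed

text \<open>For \<open>\<epsilon>\<close> tending to \<open>0\<close> the inequality tends to \<open>1 + C * \<alpha> \<le> C\<close>, which holds for large \<open>C\<close> as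
  \<open>\<alpha> < 1\<close>. In the proof \<open>\<epsilon>0\<close> is such that \<open>b powr \<epsilon>0 * m\<close> is at most the midpoint of \<open>m\<close> and \<open>1\<close>.\<close>

lemma reverse_hoelder_constants:
  fixes \<alpha> :: real
  assumes "0 \<le> \<alpha>" "\<alpha> < 1"
  obtains \<epsilon>0 C where "0 < \<epsilon>0" "\<epsilon>0 \<le> 1" "1 \<le> C"
    "\<And>\<epsilon>. 0 \<le> \<epsilon> \<Longrightarrow> \<epsilon> \<le> \<epsilon>0 \<Longrightarrow> 2 powr \<epsilon> + C * (2 * 2 ^ n) powr \<epsilon> * \<alpha> \<le> C"
proof -
  define b where "b = (2 * 2 ^ n :: real)"
  have b: "1 < b" unfolding b_def using one_le_power[of "2::real" n] by linarith
  define m where "m = max \<alpha> (1 / 2)"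
  have m: "0 < m" "m < 1" "\<alpha> \<le> m" using assms by (auto simp: m_def)
  define \<epsilon>0 where "\<epsilon>0 = min 1 (log b ((1 + m) / (2 * m)))"
  define C where "C = 4 / (1 - m)"
  have gt: "1 < (1 + m) / (2 * m)" using m by (simp add: field_simps)
  then have \<epsilon>0: "0 < \<epsilon>0" unfolding \<epsilon>0_def using b by simp
  have C: "1 \<le> C" unfolding C_def using m by (simp add: field_simps)
  have "2 powr \<epsilon> + C * b powr \<epsilon> * \<alpha> \<le> C" if \<epsilon>: "0 \<le> \<epsilon>" "\<epsilon> \<le> \<epsilon>0" for \<epsilon>
  proof -
    have "b powr \<epsilon> \<le> b powr log b ((1 + m) / (2 * m))"
      using \<epsilon> b by (intro powr_mono) (auto simp: \<epsilon>0_def)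
    also have "\<dots> = (1 + m) / (2 * m)" using b gt by (subst powr_log_cancel) auto
    finally have "b powr \<epsilon> * \<alpha> \<le> (1 + m) / (2 * m) * m"
      using assms gt m by (intro mult_mono) auto
    also have "\<dots> = (1 + m) / 2" using m by simp
    finally have "C * (b powr \<epsilon> * \<alpha>) \<le> C * ((1 + m) / 2)" using C by (intro mult_left_mono) auto
    moreover have "(2::real) powr \<epsilon> \<le> 2 powr 1" using \<epsilon> by (intro powr_mono) (auto simp: \<epsilon>0_def)
    moreover have "2 + C * ((1 + m) / 2) = C" unfolding C_def using m by (simp add: field_simps)
    ultimately show ?thesis by (simp add: mult.assoc)
  qed
  then show ?thesis using that[of \<epsilon>0 C] \<epsilon>0 C unfolding b_def by (simp add: \<epsilon>0_def)
qed

text \<open>One half of the differentiation theorem for dyadic cells. If \<open>u \<ge> q'\<close> on a set \<open>G\<close> of points all of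
  whose averages are at most \<open>q < q'\<close>, take an open \<open>T \<supseteq> G\<close> with nearly the same measure. The union
  \<open>V k\<close> of the cells of generation \<open>k\<close> that lie in \<open>T\<close> and meet \<open>G\<close> satisfies
  \<open>q' * |G \<inter> V k| \<le> \<nu> (V k) \<le> q * |T|\<close>, and \<open>G \<inter> V k\<close> increases to \<open>G\<close>; hence \<open>G\<close> is a null set.\<close>

lemma AE_density_le_averages:
  fixes a :: "real ^ 'n" and u :: "real ^ 'n \<Rightarrow> real"
  assumes l: "0 < l" and u: "u \<in> borel_measurable lebesgue" "\<And>x. 0 \<le> u x"
    and \<nu>: "\<nu> = density lebesgue (\<lambda>x. ennreal (u x))"
    and fin: "emeasure \<nu> (cell a l 0 x0) < \<infinity>"
  shows "AE x in lebesgue. x \<in> cell a l 0 x0 \<longrightarrow>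
    (\<forall>c. (\<forall>k. cell_avg \<nu> a l k x \<le> c) \<longrightarrow> u x \<le> c)"
proof -
  let ?Q = "cell a l 0 x0"
  have \<nu>_sets: "sets \<nu> = sets lebesgue" by (simp add: \<nu>)
  have null: "AE x in lebesgue. x \<in> ?Q \<longrightarrow> (\<forall>k. cell_avg \<nu> a l k x \<le> q) \<longrightarrow> u x < q'"
    if q: "0 \<le> q" "q < q'" for q q' :: real
  proof -
    define G where "G = {x \<in> ?Q. (\<forall>k. cell_avg \<nu> a l k x \<le> q) \<and> q' \<le> u x}"
    have [measurable]: "u \<in> borel_measurable lebesgue" by (rule u)
    have [measurable]: "cell_avg \<nu> a l k \<in> borel_measurable lebesgue" for k
      using l by (rule cell_avg_measurable)
    have [measurable]: "?Q \<in> sets lebesgue" using l by simp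
    have "G = ?Q \<inter> {x \<in> space lebesgue. (\<forall>k. cell_avg \<nu> a l k x \<le> q) \<and> q' \<le> u x}"
      by (auto simp: G_def)
    also have "\<dots> \<in> sets lebesgue" by measurable
    finally have G: "G \<in> sets lebesgue" .
    have "emeasure lebesgue G \<le> emeasure lebesgue ?Q"
      using l by (intro emeasure_mono) (auto simp: G_def)
    then have Gfin: "emeasure lebesgue G < \<infinity>"
      using emeasure_cell[OF l, of a 0 x0] by (simp del: emeasure_completion add: order_le_less_trans)
    have key: "ennreal q' * emeasure lebesgue G \<le> ennreal q * (emeasure lebesgue G + ennreal e)" if e: "0 < e" for e
    proof -
      obtain T where T: "open T" "G \<subseteq> T" "T - G \<in> lmeasurable" "emeasure lebesgue (T - G) < ennreal e"
        using sets_lebesgue_outer_open[OF G e] by blast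
      have T_sets: "T \<in> sets lebesgue" using T by auto
      have "emeasure lebesgue T \<le> emeasure lebesgue G + emeasure lebesgue (T - G)"
        using emeasure_subadditive[of G lebesgue "T - G"] G T T_sets by (simp add: Un_absorb1 del: emeasure_completion)
      also have "\<dots> \<le> emeasure lebesgue G + ennreal e" using T by (intro add_left_mono) simp
      finally have T_le: "emeasure lebesgue T \<le> emeasure lebesgue G + ennreal e" .
      define V where "V k = {x. cell a l k x \<subseteq> T \<and> cell a l k x \<inter> G \<noteq> {}}" for k
      have cV: "cell_union a l k (V k)" for k
        unfolding cell_union_def V_def using cell_eq by blast
      have V_sets: "V k \<in> sets lebesgue" for k using cell_union_sets[OF l cV] .
      define M where "M = density lebesgue (\<lambda>x. ennreal q' * indicator G x)"
      have M: "emeasure M A = ennreal q' * emeasure lebesgue (G \<inter> A)" if "A \<in> sets lebesgue" for A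
      proof -
        have "emeasure M A = (\<integral>\<^sup>+x. ennreal q' * indicator (G \<inter> A) x \<partial>lebesgue)"
          unfolding M_def using G that
          by (subst emeasure_density) (auto intro!: nn_integral_cong simp: indicator_def)
        then show ?thesis using G that by (subst (asm) nn_integral_cmult_indicator) auto
      qed
      have le: "ennreal q' * emeasure lebesgue (G \<inter> V k) \<le> ennreal q * (emeasure lebesgue G + ennreal e)" for k
      proof -
        have "emeasure M (V k) \<le> ennreal q * emeasure lebesgue (V k)"
        proof (rule emeasure_cellwise_mono[OF l cV])
          fix y assume "y \<in> V k"
          then obtain x where x: "x \<in> G" "x \<in> cell a l k y" by (auto simp: V_def)
          have ceq: "cell a l k x = cell a l k y" using cell_eq[OF x(2)] .
          have sub: "cell a l k x \<subseteq> ?Q" using cell_subset[of x a l 0 x0 k] x by (auto simp: G_def)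
          have "emeasure M (cell a l k x) \<le> emeasure \<nu> (cell a l k x)"
            unfolding M_def \<nu> using u G l
            by (subst (1 2) emeasure_density)
              (auto intro!: nn_integral_mono ennreal_leI simp: G_def indicator_def)
          also have "\<dots> = ennreal (measure \<nu> (cell a l k x))"
            using emeasure_mono[OF sub, of \<nu>] fin \<nu>_sets l
            by (intro emeasure_eq_ennreal_measure) auto
          also have "measure \<nu> (cell a l k x) = cell_avg \<nu> a l k x * (l / 2 ^ k) ^ CARD('n)"
            using l by (simp add: cell_avg_def)
          also have "ennreal \<dots> \<le> ennreal (q * (l / 2 ^ k) ^ CARD('n))"
            using x l by (intro ennreal_leI mult_right_mono) (auto simp: G_def)
          also have "\<dots> = ennreal q * emeasure lebesgue (cell a l k x)"
            unfolding emeasure_cell[OF l] using q l by (intro ennreal_mult) auto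
          finally show "emeasure M (cell a l k y) \<le> ennreal q * emeasure lebesgue (cell a l k y)"
            unfolding ceq .
        qed (auto simp: M_def)
        also have "\<dots> \<le> ennreal q * emeasure lebesgue T"
          by (intro mult_left_mono emeasure_mono T_sets) (auto simp: V_def subset_iff)
        also have "\<dots> \<le> ennreal q * (emeasure lebesgue G + ennreal e)"
          using T_le by (intro mult_left_mono) auto
        finally show ?thesis using M[OF V_sets] by simp
      qed
      have mono: "incseq (\<lambda>k. G \<inter> V k)"
        unfolding mono_def V_def using cell_mono self_in_cell by blast
      have UG: "(\<Union>k. G \<inter> V k) = G"
      proof -
        have "\<exists>k. x \<in> V k" if "x \<in> G" for x
        proof -
          have "x \<in> T" using T(2) that by blast
          then obtain k where "cell a l k x \<subseteq> T" by (rule cell_in_open[OF l T(1), where a = a])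
          then show ?thesis unfolding V_def using that self_in_cell by blast
        qed
        then show ?thesis by blast
      qed
      have ran: "range (\<lambda>k. G \<inter> V k) \<subseteq> sets lebesgue" using G V_sets by auto
      have "emeasure lebesgue G = (SUP k. emeasure lebesgue (G \<inter> V k))"
        unfolding SUP_emeasure_incseq[OF ran mono] UG by (rule refl)
      then have "ennreal q' * emeasure lebesgue G = (SUP k. ennreal q' * emeasure lebesgue (G \<inter> V k))"
        by (simp add: SUP_mult_left_ennreal del: emeasure_completion)
      also have "\<dots> \<le> ennreal q * (emeasure lebesgue G + ennreal e)"
        by (rule SUP_least) (rule le)
      finally show ?thesis .
    qed
    obtain m where m: "emeasure lebesgue G = ennreal m" "0 \<le> m"
      using Gfin by (cases "emeasure lebesgue G") (auto simp del: emeasure_completion)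
    have "q' * m \<le> q * (m + e)" if "0 < e" for e
      using key[OF that] m q that by (simp add: ennreal_mult[symmetric] ennreal_plus[symmetric] del: ennreal_plus emeasure_completion)
    then have "(q' * m - q * m) \<le> q * e" if "0 < e" for e using that by (force simp: algebra_simps)
    then have "q' * m - q * m \<le> 0"
    proof -
      assume *: "\<And>e. 0 < e \<Longrightarrow> q' * m - q * m \<le> q * e"
      show ?thesis
      proof (rule field_le_epsilon)
        fix e :: real assume "0 < e"
        then have "q' * m - q * m \<le> q * (e / (q + 1))" using q by (intro *) auto
        also have "\<dots> \<le> e" using q \<open>0 < e\<close> by (simp add: field_simps)
        finally show "q' * m - q * m \<le> 0 + e" by simp
      qed
    qed
    then have "(q' - q) * m \<le> 0" by (simp add: algebra_simps)
    then have "m = 0" using q m(2) by (auto simp: mult_le_0_iff)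
    then have "G \<in> null_sets lebesgue" using m G by (simp add: null_sets_def del: emeasure_completion)
    from AE_not_in[OF this] show ?thesis
      by eventually_elim (auto simp: G_def not_less)
  qed
  have "AE x in lebesgue. \<forall>q\<in>\<rat> \<inter> {0..}. \<forall>q'\<in>\<rat>. q < q' \<longrightarrow>
      x \<in> ?Q \<longrightarrow> (\<forall>k. cell_avg \<nu> a l k x \<le> q) \<longrightarrow> u x < q'"
  proof -
    have 1: "AE x in lebesgue. \<forall>q'\<in>\<rat>. q < q' \<longrightarrow>
      x \<in> ?Q \<longrightarrow> (\<forall>k. cell_avg \<nu> a l k x \<le> q) \<longrightarrow> u x < q'" if "q \<in> \<rat> \<inter> {0..}" for q
    proof (rule AE_ball_countable[THEN iffD2, OF countable_rat], intro ballI)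
      fix q' :: real
      show "AE x in lebesgue. q < q' \<longrightarrow> x \<in> ?Q \<longrightarrow> (\<forall>k. cell_avg \<nu> a l k x \<le> q) \<longrightarrow> u x < q'"
        using null[of q q'] that by (cases "q < q'") auto
    qed
    have cq: "countable (\<rat> \<inter> {0 :: real..})"
      by (rule countable_subset[OF Int_lower1 countable_rat])
    show ?thesis
      by (rule AE_ball_countable[OF cq, THEN iffD2], rule ballI, rule 1)
  qed
  then show ?thesis
  proof eventually_elim
    case (elim x)
    show ?case
    proof (intro impI allI)
      fix c assume x: "x \<in> ?Q" and c: "\<forall>k. cell_avg \<nu> a l k x \<le> c"
      show "u x \<le> c"
      proof (rule ccontr)
        assume "\<not> u x \<le> c"
        then obtain q' where q': "q' \<in> \<rat>" "c < q'" "q' < u x" using Rats_dense_in_real[of c "u x"] by auto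
        then obtain q where q: "q \<in> \<rat>" "c < q" "q < q'" using Rats_dense_in_real by blast
        have "0 \<le> c" using c cell_avg_nonneg[of l \<nu> a 0 x] l by (meson less_imp_le order_trans)
        then have "q \<in> \<rat> \<inter> {0..}" using q by auto
        moreover have "\<forall>k. cell_avg \<nu> a l k x \<le> q" using c q by (meson less_imp_le order_trans)
        ultimately have "u x < q'" using bspec[OF bspec[OF elim], of q q'] q(3) q'(1) x by simp
        then show False using q'(3) by simp
      qed
    qed
  qed
qed

text \<open>Let \<open>K\<close> tend to infinity: by monotone convergence the bound holds for the full dyadic maximal function,
  which dominates \<open>u\<close> almost everywhere.\<close>

lemma dyadic_reverse_hoelder_density:
  fixes a :: "real ^ 'n" and u :: "real ^ 'n \<Rightarrow> real"
  assumes l: "0 < l" and u: "u \<in> borel_measurable lebesgue" "\<And>x. 0 \<le> u x"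
    and \<nu>: "\<nu> = density lebesgue (\<lambda>x. ennreal (u x))"
    and fin: "emeasure \<nu> (cell a l 0 x0) < \<infinity>"
    and \<epsilon>: "0 < \<epsilon>" and \<alpha>: "0 \<le> \<alpha>" and C: "0 \<le> C"
    and bound: "2 powr \<epsilon> + C * (2 * 2 ^ CARD('n)) powr \<epsilon> * \<alpha> \<le> C"
    and ainf: "\<And>k x E. x \<in> cell a l 0 x0 \<Longrightarrow> E \<subseteq> cell a l k x \<Longrightarrow> E \<in> sets lebesgue \<Longrightarrow>
      2 * emeasure lebesgue E \<le> emeasure lebesgue (cell a l k x) \<Longrightarrow>
      emeasure \<nu> E \<le> ennreal \<alpha> * emeasure \<nu> (cell a l k x)"
  shows "(\<integral>\<^sup>+y\<in>cell a l 0 x0. ennreal (u y powr (1 + \<epsilon>)) \<partial>lebesgue)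
    \<le> ennreal (C * cell_avg \<nu> a l 0 x0 powr \<epsilon>) * emeasure \<nu> (cell a l 0 x0)"
proof -
  let ?Q = "cell a l 0 x0"
  let ?M = "\<lambda>K y. ennreal (max_avg \<nu> a l 0 K y powr \<epsilon>)"
  have \<nu>_sets: "sets \<nu> = sets lebesgue" by (simp add: \<nu>)
  have [measurable]: "u \<in> borel_measurable lebesgue" "?Q \<in> sets lebesgue" using u l by auto
  have M_meas[measurable]: "max_avg \<nu> a l 0 K \<in> borel_measurable lebesgue" for K
    using l by (rule max_avg_measurable)
  have "AE y in lebesgue. y \<in> ?Q \<longrightarrow> ennreal (u y powr \<epsilon>) \<le> (SUP K. ?M K y)"
    using AE_density_le_averages[OF l u \<nu> fin]
  proof eventually_elim
    case (elim y)
    show ?case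
    proof (cases "(SUP K. ?M K y)")
      case (real r)
      have "max_avg \<nu> a l 0 K y powr \<epsilon> \<le> r" for K
        using SUP_upper[of K UNIV "\<lambda>K. ?M K y"] real by (simp add: ennreal_le_iff)
      then have "cell_avg \<nu> a l k y \<le> r powr (1 / \<epsilon>)" for k
      proof -
        have "cell_avg \<nu> a l k y \<le> max_avg \<nu> a l 0 k y" by (rule cell_avg_le_max_avg) auto
        also have "\<dots> = (max_avg \<nu> a l 0 k y powr \<epsilon>) powr (1 / \<epsilon>)"
          using \<epsilon> l by (simp add: powr_powr max_avg_nonneg)
        also have "\<dots> \<le> r powr (1 / \<epsilon>)"
          using \<epsilon> \<open>max_avg \<nu> a l 0 k y powr \<epsilon> \<le> r\<close> by (intro powr_mono2) auto
        finally show ?thesis .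
      qed
      then have "y \<in> ?Q \<longrightarrow> u y \<le> r powr (1 / \<epsilon>)" using elim by blast
      moreover have "u y powr \<epsilon> \<le> r" if "u y \<le> r powr (1 / \<epsilon>)"
        using powr_mono2[OF _ u(2) that, of \<epsilon>] \<epsilon> real by (simp add: powr_powr)
      ultimately show ?thesis using real by (auto simp: ennreal_le_iff)
    next
      case top
      then show ?thesis by (simp only: top_greatest simp_thms)
    qed
  qed
  then have "(\<integral>\<^sup>+y\<in>?Q. ennreal (u y powr (1 + \<epsilon>)) \<partial>lebesgue)
    \<le> (\<integral>\<^sup>+y. ennreal (u y) * (SUP K. ?M K y * indicator ?Q y) \<partial>lebesgue)"
  proof (intro nn_integral_mono_AE, eventually_elim)
    case (elim y)
    have "ennreal (u y powr (1 + \<epsilon>)) = ennreal (u y) * ennreal (u y powr \<epsilon>)"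
      using u(2)[of y] \<epsilon> by (cases "u y = 0") (auto simp: powr_add ennreal_mult)
    then show ?case using elim by (auto simp: indicator_def intro!: mult_left_mono)
  qed
  also have "\<dots> = (\<integral>\<^sup>+y. (SUP K. ?M K y * indicator ?Q y) \<partial>\<nu>)"
    unfolding \<nu> by (subst nn_integral_density) (auto simp: \<nu>[symmetric])
  also have "\<dots> = (SUP K. (\<integral>\<^sup>+y\<in>?Q. ?M K y \<partial>\<nu>))"
  proof (rule nn_integral_monotone_convergence_SUP)
    show "incseq (\<lambda>K y. ?M K y * indicator ?Q y)"
    proof (intro monoI le_funI mult_right_mono ennreal_leI powr_mono2)
      fix K K' :: nat and y assume "K \<le> K'"
      then show "max_avg \<nu> a l 0 K y \<le> max_avg \<nu> a l 0 K' y"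
        by (intro max_avg_le cell_avg_le_max_avg) auto
    qed (use \<epsilon> l in \<open>auto simp: max_avg_nonneg\<close>)
    show "(\<lambda>y. ?M K y * indicator ?Q y) \<in> borel_measurable \<nu>" for K
      unfolding measurable_cong_sets[OF \<nu>_sets refl] by measurable
  qed
  also have "\<dots> \<le> ennreal (C * cell_avg \<nu> a l 0 x0 powr \<epsilon>) * emeasure \<nu> ?Q"
  proof (rule SUP_least)
    fix K
    show "(\<integral>\<^sup>+y\<in>?Q. ?M K y \<partial>\<nu>) \<le> ennreal (C * cell_avg \<nu> a l 0 x0 powr \<epsilon>) * emeasure \<nu> ?Q"
    proof (rule dyadic_reverse_hoelder[OF l \<nu>_sets fin less_imp_le[OF \<epsilon>] \<alpha> C bound])
      fix k x E
      assume "k \<le> K" "x \<in> ?Q" "E \<subseteq> cell a l k x" "cell_union a l K E"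
        "2 * emeasure lebesgue E \<le> emeasure lebesgue (cell a l k x)"
      then show "emeasure \<nu> E \<le> ennreal \<alpha> * emeasure \<nu> (cell a l k x)"
        using ainf[of x E k] cell_union_sets[OF l, of a K E] by simp
    qed simp_all
  qed
  finally show ?thesis .
qed


section \<open>Modulars and norms with a bounded exponent\<close>

text \<open>For a finite exponent and a real-valued \<open>f\<close>, \<open>modl p S f\<close> is the modular of \<open>f * indicator S\<close>, and
  \<open>vnorm p S f\<close> is its norm, as a real number. The latter is meaningful only if the modular is
  finite: the infimum of the empty set of reals is unspecified.\<close>

definition modl :: "(real ^ 'n \<Rightarrow> real) \<Rightarrow> (real ^ 'n) set \<Rightarrow> (real ^ 'n \<Rightarrow> real) \<Rightarrow> ennreal" where
  "modl p S f = (\<integral>\<^sup>+x\<in>S. ennreal (f x powr p x) \<partial>lebesgue)"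

definition vnorm :: "(real ^ 'n \<Rightarrow> real) \<Rightarrow> (real ^ 'n) set \<Rightarrow> (real ^ 'n \<Rightarrow> real) \<Rightarrow> real" where
  "vnorm p S f = Inf {c. 0 < c \<and> modl p S (\<lambda>x. f x / c) \<le> 1}"

definition pos_weight :: "(real ^ 'n \<Rightarrow> real) \<Rightarrow> bool" where
  "pos_weight w \<longleftrightarrow> w \<in> borel_measurable lebesgue \<and> (\<forall>x. 0 < w x)"

lemma pos_weightD: "pos_weight w \<Longrightarrow> w \<in> borel_measurable lebesgue" "pos_weight w \<Longrightarrow> 0 < w x"
  "pos_weight w \<Longrightarrow> 0 \<le> w x"
  by (auto simp: pos_weight_def less_imp_le)

lemma pos_weight_divide: "pos_weight w \<Longrightarrow> 0 < c \<Longrightarrow> pos_weight (\<lambda>x. w x / c)"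
  by (auto simp: pos_weight_def)

lemma modl_set_mono: "S \<subseteq> T \<Longrightarrow> modl p S f \<le> modl p T f"
  unfolding modl_def by (intro nn_integral_mono) (auto simp: indicator_def)

lemma vnorm_le: "0 < c \<Longrightarrow> modl p S (\<lambda>x. f x / c) \<le> 1 \<Longrightarrow> vnorm p S f \<le> c"
  unfolding vnorm_def by (rule cInf_lower) (auto intro!: bdd_belowI[of _ 0])

locale bounded_exponent =
  fixes p :: "real ^ 'n \<Rightarrow> real" and P :: real
  assumes p_meas [measurable]: "p \<in> borel_measurable lebesgue"
    and p_ge_1: "1 \<le> p x" and p_le_P: "p x \<le> P"
begin

lemma p_nonneg: "0 \<le> p x" using p_ge_1[of x] by simp

lemma P_ge_1: "1 \<le> P" using p_ge_1 p_le_P order_trans by blast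

lemma modl_scale_up:
  assumes w: "pos_weight w" and "S \<in> sets lebesgue" "1 \<le> m"
  shows "modl p S (\<lambda>x. m * w x) \<le> ennreal (m powr P) * modl p S w"
proof -
  have [measurable]: "w \<in> borel_measurable lebesgue" "S \<in> sets lebesgue" using assms by (auto dest: pos_weightD)
  have "modl p S (\<lambda>x. m * w x) \<le> (\<integral>\<^sup>+x. ennreal (m powr P) * (ennreal (w x powr p x) * indicator S x) \<partial>lebesgue)"
    unfolding modl_def
  proof (rule nn_integral_mono)
    fix x
    have "(m * w x) powr p x = m powr p x * w x powr p x"
      using assms pos_weightD[OF w] by (simp add: powr_mult)
    also have "\<dots> \<le> m powr P * w x powr p x"
      using assms p_le_P by (intro mult_right_mono powr_mono) auto
    finally have "ennreal ((m * w x) powr p x) \<le> ennreal (m powr P) * ennreal (w x powr p x)"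
      by (simp add: ennreal_mult[symmetric] ennreal_leI)
    then show "ennreal ((m * w x) powr p x) * indicator S x \<le> ennreal (m powr P) * (ennreal (w x powr p x) * indicator S x)"
      unfolding mult.assoc[symmetric] by (rule mult_right_mono) simp
  qed
  also have "\<dots> = ennreal (m powr P) * modl p S w"
    unfolding modl_def by (rule nn_integral_cmult) measurable
  finally show ?thesis .
qed

lemma modl_scale_down:
  assumes w: "pos_weight w" and "S \<in> sets lebesgue" "0 < m" "m \<le> 1"
  shows "modl p S (\<lambda>x. m * w x) \<le> ennreal m * modl p S w"
proof -
  have [measurable]: "w \<in> borel_measurable lebesgue" "S \<in> sets lebesgue" using assms by (auto dest: pos_weightD)
  have "modl p S (\<lambda>x. m * w x) \<le> (\<integral>\<^sup>+x. ennreal m * (ennreal (w x powr p x) * indicator S x) \<partial>lebesgue)"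
    unfolding modl_def
  proof (rule nn_integral_mono)
    fix x
    have "(m * w x) powr p x = m powr p x * w x powr p x"
      using assms pos_weightD[OF w] by (simp add: powr_mult)
    also have "\<dots> \<le> m powr 1 * w x powr p x"
      using assms p_ge_1 by (intro mult_right_mono powr_mono') auto
    finally have "ennreal ((m * w x) powr p x) \<le> ennreal m * ennreal (w x powr p x)"
      using assms by (simp add: ennreal_mult[symmetric] ennreal_leI)
    then show "ennreal ((m * w x) powr p x) * indicator S x \<le> ennreal m * (ennreal (w x powr p x) * indicator S x)"
      unfolding mult.assoc[symmetric] by (rule mult_right_mono) simp
  qed
  also have "\<dots> = ennreal m * modl p S w"
    unfolding modl_def by (rule nn_integral_cmult) measurable
  finally show ?thesis .
qed

lemma modl_mono:
  assumes "\<And>x. x \<in> S \<Longrightarrow> 0 \<le> f x \<and> f x \<le> g x"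
  shows "modl p S f \<le> modl p S g"
  unfolding modl_def using assms p_nonneg
  by (intro nn_integral_mono) (auto simp: indicator_def intro!: ennreal_leI powr_mono2)

text \<open>A bound on the modular other than \<open>1\<close> costs only a factor in the norm.\<close>

lemma modl_divide_le_one:
  assumes w: "pos_weight w" and S: "S \<in> sets lebesgue"
    and c: "0 < c" and le: "modl p S (\<lambda>x. w x / c) \<le> ennreal m" and m: "1 \<le> m"
  shows "modl p S (\<lambda>x. w x / (m * c)) \<le> 1"
proof -
  have "modl p S (\<lambda>x. (1 / m) * (w x / c)) \<le> ennreal (1 / m) * modl p S (\<lambda>x. w x / c)"
    using pos_weight_divide[OF w c] S m by (intro modl_scale_down) auto
  also have "\<dots> \<le> ennreal (1 / m) * ennreal m" using le by (rule mult_left_mono) simp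
  also have "\<dots> = 1" using m by (simp add: ennreal_mult[symmetric])
  finally show ?thesis by simp
qed

context
  fixes w :: "real ^ 'n \<Rightarrow> real" and S :: "(real ^ 'n) set"
  assumes w: "pos_weight w" and S: "S \<in> sets lebesgue" and fin: "modl p S w < \<infinity>"
begin

lemma vnorm_set_nonempty: "{c. 0 < c \<and> modl p S (\<lambda>x. w x / c) \<le> 1} \<noteq> {}"
proof -
  obtain r where r: "modl p S w = ennreal r" "0 \<le> r" using fin by (cases "modl p S w") auto
  have "modl p S (\<lambda>x. w x / (max 1 r * 1)) \<le> 1"
    by (rule modl_divide_le_one[OF w S]) (use r in \<open>auto intro: ennreal_leI\<close>)
  then show ?thesis by (auto intro!: exI[of _ "max 1 r"])
qed

lemma vnorm_nonneg: "0 \<le> vnorm p S w"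
  unfolding vnorm_def using vnorm_set_nonempty by (intro cInf_greatest) auto

lemma modl_le_one_of_less:
  assumes "vnorm p S w < c"
  shows "modl p S (\<lambda>x. w x / c) \<le> 1"
proof -
  obtain c' where c': "0 < c'" "modl p S (\<lambda>x. w x / c') \<le> 1" "c' < c"
    using cInf_lessD[OF vnorm_set_nonempty] assms unfolding vnorm_def by blast
  have "modl p S (\<lambda>x. w x / c) \<le> modl p S (\<lambda>x. w x / c')"
    using c' pos_weightD[OF w] by (intro modl_mono) (auto intro!: divide_left_mono)
  then show ?thesis using c' by simp
qed

text \<open>The infimum that defines the norm is attained: as \<open>p \<le> P\<close>, the modular changes at most by the factor
  \<open>(1 + e) powr P\<close> when the divisor changes by the factor \<open>1 + e\<close>.\<close>

lemma modl_le_one: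
  assumes "vnorm p S w \<le> c" "0 < c"
  shows "modl p S (\<lambda>x. w x / c) \<le> 1"
proof -
  have le: "modl p S (\<lambda>x. w x / c) \<le> ennreal ((1 + e) powr P)" if e: "0 < e" for e
  proof -
    have "modl p S (\<lambda>x. w x / (c * (1 + e))) \<le> 1"
      using assms e by (intro modl_le_one_of_less) (auto intro: order_le_less_trans)
    moreover have "modl p S (\<lambda>x. (1 + e) * (w x / (c * (1 + e)))) \<le>
      ennreal ((1 + e) powr P) * modl p S (\<lambda>x. w x / (c * (1 + e)))"
      using assms e by (intro modl_scale_up pos_weight_divide w S) auto
    ultimately have "modl p S (\<lambda>x. (1 + e) * (w x / (c * (1 + e)))) \<le> ennreal ((1 + e) powr P) * 1"
      using mult_left_mono[of _ 1 "ennreal ((1 + e) powr P)"] by (meson order_trans zero_le)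
    moreover have "d * (y / (c * d)) = y / c" if "0 < d" for d y :: real using that by simp
    then have "(\<lambda>x. (1 + e) * (w x / (c * (1 + e)))) = (\<lambda>x. w x / c)" using e by auto
    ultimately show ?thesis by simp
  qed
  have lim: "((\<lambda>e. ennreal ((1 + e) powr P)) \<longlongrightarrow> ennreal ((1 + 0) powr P)) (at_right 0)"
    by (intro tendsto_ennrealI tendsto_powr tendsto_intros) auto
  have "modl p S (\<lambda>x. w x / c) \<le> ennreal ((1 + 0) powr P)"
    by (rule tendsto_lowerbound[OF lim]) (use le in \<open>auto simp: eventually_at_right_less eventually_at_filter\<close>)
  then show ?thesis by simp
qed

text \<open>By the same scaling, the modular cannot be less than \<open>1\<close> at the norm. This equality is what turns
  norms into masses below.\<close>

lemma modl_vnorm: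
  assumes pos: "0 < vnorm p S w"
  shows "modl p S (\<lambda>x. w x / vnorm p S w) = 1"
proof (rule antisym)
  let ?v = "vnorm p S w"
  show "modl p S (\<lambda>x. w x / ?v) \<le> 1" using pos by (intro modl_le_one) auto
  have le: "ennreal ((1 - e) powr P) \<le> modl p S (\<lambda>x. w x / ?v)" if e: "0 < e" "e < 1" for e
  proof -
    have "(1 - e) * ?v < ?v" using pos e by (simp add: field_simps)
    then have "\<not> modl p S (\<lambda>x. w x / ((1 - e) * ?v)) \<le> 1"
      using vnorm_le[of "(1 - e) * ?v" p S w] pos e by auto
    then have "1 \<le> modl p S (\<lambda>x. w x / ((1 - e) * ?v))" by (simp only: not_le less_imp_le)
    then have "1 \<le> modl p S (\<lambda>x. (1 / (1 - e)) * (w x / ?v))" by simp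
    also have "\<dots> \<le> ennreal ((1 / (1 - e)) powr P) * modl p S (\<lambda>x. w x / ?v)"
      using pos e by (intro modl_scale_up pos_weight_divide w S) auto
    finally have "ennreal ((1 - e) powr P) * 1 \<le> ennreal ((1 - e) powr P) * (ennreal ((1 / (1 - e)) powr P) * modl p S (\<lambda>x. w x / ?v))"
      by (intro mult_left_mono) auto
    also have "\<dots> = ennreal ((1 - e) powr P * (1 / (1 - e)) powr P) * modl p S (\<lambda>x. w x / ?v)"
      by (simp add: ennreal_mult mult.assoc)
    also have "(1 - e) powr P * (1 / (1 - e)) powr P = 1"
      using e by (simp add: powr_mult[symmetric])
    finally show ?thesis by simp
  qed
  have lim: "((\<lambda>e. ennreal ((1 - e) powr P)) \<longlongrightarrow> ennreal ((1 - 0) powr P)) (at_right 0)"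
    by (intro tendsto_ennrealI tendsto_powr tendsto_intros) auto
  have "ennreal ((1 - 0) powr P) \<le> modl p S (\<lambda>x. w x / ?v)"
    by (rule tendsto_upperbound[OF lim])
      (use le eventually_at_right[of 0 "1::real"] in \<open>auto simp: eventually_at_right_field intro!: exI[of _ "1::real"]\<close>)
  then show "1 \<le> modl p S (\<lambda>x. w x / ?v)" by simp
qed

lemma vnorm_pos:
  assumes "0 < emeasure lebesgue S"
  shows "0 < vnorm p S w"
proof (rule ccontr)
  have [measurable]: "w \<in> borel_measurable lebesgue" "S \<in> sets lebesgue" using w S by (auto dest: pos_weightD)
  assume "\<not> 0 < vnorm p S w"
  then have 0: "vnorm p S w \<le> 0" by simp
  have le: "modl p S w \<le> ennreal c" if c: "0 < c" "c < 1" for c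
  proof -
    have "modl p S (\<lambda>x. c * (w x / c)) \<le> ennreal c * modl p S (\<lambda>x. w x / c)"
      using c by (intro modl_scale_down pos_weight_divide w S) auto
    also have "\<dots> \<le> ennreal c * 1"
      using 0 c by (intro mult_left_mono modl_le_one) auto
    finally show ?thesis using c by simp
  qed
  have lim: "((\<lambda>c. ennreal c) \<longlongrightarrow> ennreal 0) (at_right 0)"
    by (intro tendsto_ennrealI tendsto_intros)
  have "modl p S w \<le> ennreal 0"
    by (rule tendsto_lowerbound[OF lim])
      (use le in \<open>auto simp: eventually_at_right_field intro!: exI[of _ "1::real"]\<close>)
  then have "modl p S w = 0" by simp
  then have "AE x in lebesgue. ennreal (w x powr p x) * indicator S x = 0"
    unfolding modl_def by (subst (asm) nn_integral_0_iff_AE) auto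
  then have "AE x in lebesgue. x \<notin> S"
    by eventually_elim (use pos_weightD(2)[OF w] in \<open>auto simp: indicator_def less_le split: if_splits\<close>)
  then have "emeasure lebesgue S = 0"
    using AE_iff_null_sets[OF S] by (simp add: null_sets_def del: emeasure_completion)
  then show False using assms by simp
qed

lemma vnorm_mono:
  assumes "T \<subseteq> S" "T \<in> sets lebesgue"
  shows "vnorm p T w \<le> vnorm p S w"
proof (rule field_le_epsilon)
  fix e :: real assume e: "0 < e"
  have "modl p T (\<lambda>x. w x / (vnorm p S w + e)) \<le> modl p S (\<lambda>x. w x / (vnorm p S w + e))"
    using assms by (intro modl_set_mono)
  also have "\<dots> \<le> 1" using e vnorm_nonneg by (intro modl_le_one) auto
  finally show "vnorm p T w \<le> vnorm p S w + e"
    using e vnorm_nonneg by (intro vnorm_le) auto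
qed

lemma modl_divide_finite: "0 < c \<Longrightarrow> modl p S (\<lambda>x. w x / c) < \<infinity>"
proof -
  assume c: "0 < c"
  have "modl p S (\<lambda>x. w x / c) \<le> modl p S (\<lambda>x. max 1 (1 / c) * w x)"
    using c pos_weightD(3)[OF w] mult_right_mono[of "1 / c" "max 1 (1 / c)"] by (intro modl_mono) auto
  also have "\<dots> \<le> ennreal (max 1 (1 / c) powr P) * modl p S w"
    by (intro modl_scale_up w S) auto
  also have "\<dots> < \<infinity>" using fin by (simp add: ennreal_mult_less_top)
  finally show ?thesis .
qed

end

lemma vnorm_divide:
  assumes w: "pos_weight w" and S: "S \<in> sets lebesgue" and fin: "modl p S w < \<infinity>" and c: "0 < c"
  shows "vnorm p S (\<lambda>x. w x / c) = vnorm p S w / c"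
proof -
  have le: "vnorm p S (\<lambda>x. u x / d) \<le> vnorm p S u / d"
    if u: "pos_weight u" "modl p S u < \<infinity>" and d: "0 < d" for u and d :: real
  proof (rule field_le_epsilon)
    fix e :: real assume e: "0 < e"
    have v: "0 \<le> vnorm p S u" by (rule vnorm_nonneg[OF u(1) S u(2)])
    have *: "d * (vnorm p S u / d + e) = vnorm p S u + d * e" using d by (simp add: field_simps)
    have "modl p S (\<lambda>x. u x / (vnorm p S u + d * e)) \<le> 1"
      using v d e by (intro modl_le_one[OF u(1) S u(2)]) (auto intro: add_nonneg_pos)
    then have "modl p S (\<lambda>x. u x / d / (vnorm p S u / d + e)) \<le> 1"
      unfolding divide_divide_eq_left * .
    then show "vnorm p S (\<lambda>x. u x / d) \<le> vnorm p S u / d + e"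
      using v d e by (intro vnorm_le) (auto intro: add_nonneg_pos)
  qed
  have "vnorm p S (\<lambda>x. w x / c / (1 / c)) \<le> vnorm p S (\<lambda>x. w x / c) / (1 / c)"
    using c by (intro le pos_weight_divide w modl_divide_finite[OF w S fin]) auto
  then have "vnorm p S w \<le> vnorm p S (\<lambda>x. w x / c) * c" using c by simp
  then show ?thesis using le[OF w fin c] c by (simp add: field_simps)
qed

end


section \<open>Reverse Hoelder inequalities on small cubes\<close>

text \<open>The property of a weight on which the reverse Hoelder inequality rests, required of the cubes inside
  \<open>Q\<close>: a part of a cube that is large in measure is large in norm. For a constant exponent it is a
  quantitative \<open>A_\<infinity>\<close> condition on \<open>w powr p\<close>.\<close>

definition cube_ainf :: "(real ^ 'n \<Rightarrow> real) \<Rightarrow> real \<Rightarrow> (real ^ 'n) set \<Rightarrow> (real ^ 'n \<Rightarrow> real) \<Rightarrow> bool" where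
  "cube_ainf p A Q w \<longleftrightarrow> (\<forall>a l E. 0 < l \<longrightarrow> hcube a l \<subseteq> Q \<longrightarrow> E \<in> sets lebesgue \<longrightarrow> E \<subseteq> hcube a l \<longrightarrow>
     measure lebesgue E * vnorm p (hcube a l) w \<le> A * l ^ CARD('n) * vnorm p E w)"

lemma cube_ainf_subset: "cube_ainf p A Q w \<Longrightarrow> R \<subseteq> Q \<Longrightarrow> cube_ainf p A R w"
  unfolding cube_ainf_def by (meson order_trans)

lemma emeasure_le_of_complement:
  assumes "E \<in> sets M" "D \<in> sets M" "E \<subseteq> D" "emeasure M D < \<infinity>" "1 \<le> H"
    and le: "emeasure M D \<le> ennreal H * emeasure M (D - E)"
  shows "emeasure M E \<le> ennreal (1 - 1 / H) * emeasure M D"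
proof -
  have fin: "emeasure M E < \<infinity>" using emeasure_mono[OF assms(3,2)] assms(4) by simp
  have D: "emeasure M D = ennreal (measure M D)" using assms by (simp add: emeasure_eq_ennreal_measure less_top)
  have E: "emeasure M E = ennreal (measure M E)" using fin by (simp add: emeasure_eq_ennreal_measure less_top)
  have DE: "emeasure M (D - E) = ennreal (measure M D - measure M E)"
    using assms fin by (subst emeasure_Diff) (auto simp: D E ennreal_minus)
  have mono: "measure M E \<le> measure M D"
    using assms by (intro measure_mono_fmeasurable) (auto simp: fmeasurable_def)
  have "measure M D \<le> H * (measure M D - measure M E)"
    using le mono assms(5) unfolding D DE by (simp add: ennreal_mult[symmetric] ennreal_le_iff)
  then have "measure M E \<le> (1 - 1 / H) * measure M D" using assms(5) by (simp add: field_simps)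
  then show ?thesis unfolding D E using assms(5) by (simp add: ennreal_mult[symmetric] ennreal_leI)
qed

text \<open>How a small number \<open>v\<close> can be given a different exponent: the price is a power of \<open>1 / v\<close>, which
  log-Hoelder continuity will bound.\<close>

lemma powr_between:
  fixes v M :: real
  assumes "0 < v" "v \<le> 1" "(1 / v) powr \<bar>s - t\<bar> \<le> M"
  shows "v powr s \<le> M * v powr t"
proof -
  have "v powr s = v powr t * v powr (s - t)" using assms by (simp add: powr_add[symmetric])
  also have "v powr (s - t) \<le> v powr (- \<bar>s - t\<bar>)" using assms by (intro powr_mono') auto
  also have "\<dots> = (1 / v) powr \<bar>s - t\<bar>" using assms by (simp add: powr_minus_divide powr_divide)
  also have "\<dots> \<le> M" by (rule assms)
  finally show ?thesis using assms by (simp add: mult.commute mult_left_mono)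
qed

lemma measure_complement_half:
  fixes b :: "real ^ 'n"
  assumes m: "0 \<le> m" and E: "E \<in> sets lebesgue" "E \<subseteq> hcube b m"
    and half: "2 * emeasure lebesgue E \<le> emeasure lebesgue (hcube b m)"
  shows "m ^ CARD('n) / 2 \<le> measure lebesgue (hcube b m - E)"
proof -
  have fmD: "hcube b m \<in> fmeasurable lebesgue"
    using emeasure_hcube[OF m, of b] by (simp add: fmeasurable_def del: emeasure_completion)
  have fmE: "E \<in> fmeasurable lebesgue" using fmeasurableI2[OF fmD E(2) E(1)] .
  have "emeasure lebesgue E = ennreal (measure lebesgue E)"
    using fmE by (simp add: emeasure_eq_measure2 del: emeasure_completion)
  then have "2 * ennreal (measure lebesgue E) \<le> ennreal (m ^ CARD('n))"
    using half unfolding emeasure_hcube[OF m] by simp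
  then have "2 * measure lebesgue E \<le> m ^ CARD('n)"
    using m by (simp add: ennreal_numeral[symmetric] ennreal_mult[symmetric] del: ennreal_numeral)
  then show ?thesis using measurable_measure_Diff[OF fmD E] measure_hcube[OF m, of b] by simp
qed

text \<open>Local log-Hoelder continuity in the form in which it acts: on a cube of side \<open>l\<close> the oscillation of
  \<open>p\<close> is at most a multiple of \<open>1 / ln (1 / l)\<close>, so \<open>l\<close> raised to the oscillation is bounded below.\<close>

locale locally_log_holder = bounded_exponent p P
  for p :: "real ^ 'n \<Rightarrow> real" and P :: real +
  fixes L :: real
  assumes L: "\<And>a l x y. 0 < l \<Longrightarrow> l \<le> 1 \<Longrightarrow> x \<in> hcube a l \<Longrightarrow> y \<in> hcube a l \<Longrightarrow>
    (1 / l) powr \<bar>p x - p y\<bar> \<le> L"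
begin

lemma L_ge_1: "1 \<le> L"
  using L[of 1 0 0 0] by (simp add: hcube_def)

lemma p_diff_le: "\<bar>p x - p y\<bar> \<le> P"
  using p_ge_1[of x] p_ge_1[of y] p_le_P[of x] p_le_P[of y] by simp

text \<open>Normalise \<open>w\<close> to norm \<open>1\<close> on the cube, so that \<open>u = w powr p\<close> has mass \<open>1\<close>. It has to be shown that a set
  \<open>E\<close> filling at most half of a dyadic subcube \<open>D\<close> leaves a fixed fraction of the mass of \<open>D\<close> to \<open>D - E\<close>. For
  norms instead of masses this is the hypothesis on \<open>w\<close>. Let \<open>v \<le> 1\<close> be the norm of \<open>w\<close> on \<open>D\<close>; the
  hypothesis also gives \<open>v \<ge> |D| / A\<close>. So \<open>v powr p y\<close> is, up to a constant, independent of \<open>y \<in> D\<close>, and the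
  mass \<open>u\<close> and the modular of \<open>w / v\<close> differ on \<open>D\<close> by a nearly constant factor.\<close>

lemma small_cube_reverse_hoelder:
  fixes A :: real
  assumes A: "1 \<le> A"
  obtains \<epsilon>0 C where "0 < \<epsilon>0" "\<epsilon>0 \<le> 1" "1 \<le> C"
    "\<And>a l w s. 0 < l \<Longrightarrow> l \<le> 1 \<Longrightarrow> pos_weight w \<Longrightarrow> modl p (hcube a l) w < \<infinity> \<Longrightarrow>
      cube_ainf p A (hcube a l) w \<Longrightarrow> 1 \<le> s \<Longrightarrow> s \<le> 1 + \<epsilon>0 \<Longrightarrow>
      modl (\<lambda>x. s * p x) (hcube a l) (\<lambda>x. w x / vnorm p (hcube a l) w)
        \<le> ennreal (C * (1 / l ^ CARD('n)) powr (s - 1))"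
proof -
  let ?n = "CARD('n)"
  define M where "M = A powr P * L ^ ?n"
  have M: "1 \<le> M" unfolding M_def using A L_ge_1 P_ge_1
    by (metis ge_one_powr_ge_zero mult_ge1_I mult.commute one_le_power order_trans zero_le_one mult_mono' mult.right_neutral)
  define H where "H = M ^ 2 * (2 * A) powr P"
  have "1 \<le> (2 * A) powr P" using A P_ge_1 by (intro ge_one_powr_ge_zero) auto
  then have H: "1 \<le> H" unfolding H_def using M mult_mono[of 1 "M ^ 2" 1 "(2 * A) powr P"] by (simp add: one_le_power)
  obtain \<epsilon>0 C where C: "0 < \<epsilon>0" "\<epsilon>0 \<le> 1" "1 \<le> C"
    "\<And>\<epsilon>. 0 \<le> \<epsilon> \<Longrightarrow> \<epsilon> \<le> \<epsilon>0 \<Longrightarrow> 2 powr \<epsilon> + C * (2 * 2 ^ ?n) powr \<epsilon> * (1 - 1 / H) \<le> C"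
    using reverse_hoelder_constants[of "1 - 1 / H" ?n] H by (auto simp: field_simps)
  have "modl (\<lambda>x. s * p x) (hcube a l) (\<lambda>x. w x / vnorm p (hcube a l) w)
        \<le> ennreal (C * (1 / l ^ ?n) powr (s - 1))"
    if l: "0 < l" "l \<le> 1" and w: "pos_weight w" and fin: "modl p (hcube a l) w < \<infinity>"
      and ainf: "cube_ainf p A (hcube a l) w" and s: "1 \<le> s" "s \<le> 1 + \<epsilon>0" for a l w s
  proof -
    define Q where "Q = hcube a l"
    define V where "V = vnorm p Q w"
    define w1 where "w1 = (\<lambda>x. w x / V)"
    have Q: "Q \<in> sets lebesgue" unfolding Q_def by simp
    have finQ: "modl p Q w < \<infinity>" using fin by (simp add: Q_def)
    have ln: "0 < l ^ ?n" "l ^ ?n \<le> 1" using l by (auto simp: power_le_one)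
    have V: "0 < V" unfolding V_def
      by (rule vnorm_pos[OF w Q finQ]) (use ln emeasure_hcube[of l a] l in \<open>simp add: Q_def del: emeasure_completion\<close>)
    have w1: "pos_weight w1" unfolding w1_def by (rule pos_weight_divide[OF w V])
    have modl1: "modl p Q w1 = 1"
      using modl_vnorm[OF w Q finQ] V unfolding w1_def V_def by blast
    have finS: "modl p S w < \<infinity>" "modl p S w1 < \<infinity>" if "S \<subseteq> Q" for S
      using modl_set_mono[OF that, of p w] modl_set_mono[OF that, of p w1] finQ modl1 by (auto simp: order_le_less_trans)
    have vn: "vnorm p S w1 = vnorm p S w / V" if "S \<subseteq> Q" "S \<in> sets lebesgue" for S
      unfolding w1_def by (rule vnorm_divide[OF w that(2) finS(1)[OF that(1)] V])
    have ainf1: "measure lebesgue E * vnorm p (hcube b m) w1 \<le> A * m ^ ?n * vnorm p E w1"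
      if "0 < m" "hcube b m \<subseteq> Q" "E \<in> sets lebesgue" "E \<subseteq> hcube b m" for b m E
    proof -
      have "measure lebesgue E * vnorm p (hcube b m) w / V \<le> A * m ^ ?n * vnorm p E w / V"
        using ainf that V unfolding cube_ainf_def Q_def by (intro divide_right_mono) auto
      then show ?thesis using vn[of "hcube b m"] vn[of E] that by auto
    qed
    have vQ: "vnorm p Q w1 = 1" using vn[OF order_refl Q] V by (simp add: V_def)
    define u where "u = (\<lambda>x. w1 x powr p x)"
    have u_meas: "u \<in> borel_measurable lebesgue" unfolding u_def using pos_weightD(1)[OF w1] by measurable
    define \<nu> where "\<nu> = density lebesgue (\<lambda>x. ennreal (u x))"
    have \<nu>: "emeasure \<nu> S = modl p S w1" if "S \<in> sets lebesgue" for S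
      unfolding \<nu>_def modl_def u_def using that u_meas by (subst emeasure_density) (auto simp: u_def)
    have Qc: "cell a l 0 a = Q" unfolding Q_def by (rule cell_0[OF l(1)])
    have key: "emeasure \<nu> E \<le> ennreal (1 - 1 / H) * emeasure \<nu> (cell a l k x)"
      if x: "x \<in> Q" and E: "E \<subseteq> cell a l k x" "E \<in> sets lebesgue"
        and half: "2 * emeasure lebesgue E \<le> emeasure lebesgue (cell a l k x)" for k x E
    proof -
      define m where "m = l / 2 ^ k"
      obtain b where b: "cell a l k x = hcube b m" unfolding m_def using cell_eq_hcube[OF l(1)] by blast
      define D where "D = hcube b m"
      have "(1::real) \<le> 2 ^ k" by simp
      then have m: "0 < m" "m \<le> 1" using l unfolding m_def by (auto simp: field_simps intro: order_trans)
      have mn: "0 < m ^ ?n" "m ^ ?n \<le> 1" using m by (auto simp: power_le_one)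
      have D: "D \<in> sets lebesgue" "D \<subseteq> Q" "E \<subseteq> D"
        unfolding D_def b[symmetric] Qc[symmetric] using cell_subset[of x a l 0 a k] x Qc E cell_sets[OF l(1), of a k x] by auto
      define F where "F = D - E"
      have F: "F \<in> sets lebesgue" "F \<subseteq> D" "F \<subseteq> Q" using D E by (auto simp: F_def)
      have mD: "emeasure lebesgue D = ennreal (m ^ ?n)" "measure lebesgue D = m ^ ?n"
        unfolding D_def using emeasure_hcube[of m b] measure_hcube[of m b] m by simp_all
      have mF: "m ^ ?n / 2 \<le> measure lebesgue F"
        using measure_complement_half[OF less_imp_le[OF m(1)] E(2), of b] half D(3) unfolding b F_def D_def by simp
      define v where "v = vnorm p D w1"
      define f where "f = vnorm p F w1"
      have v_le: "v \<le> 1" unfolding v_def vQ[symmetric]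
        by (rule vnorm_mono[OF w1 Q]) (use D finS in auto)
      have v: "0 < v" unfolding v_def
        by (rule vnorm_pos[OF w1 D(1)]) (use D finS mD mn in \<open>auto simp del: emeasure_completion\<close>)
      have "measure lebesgue F \<noteq> 0" using mF mn by linarith
      then have "emeasure lebesgue F \<noteq> 0" by (auto simp: measure_def simp del: emeasure_completion)
      then have f: "0 < f" unfolding f_def
        by (intro vnorm_pos[OF w1 F(1)]) (use F finS in \<open>auto simp: zero_less_iff_neq_zero simp del: emeasure_completion\<close>)
      have "m ^ ?n / 2 * v \<le> measure lebesgue F * v" using mF v by (intro mult_right_mono) auto
      also have "\<dots> \<le> A * m ^ ?n * f"
        unfolding v_def f_def D_def by (rule ainf1) (use m F D in \<open>auto simp: D_def\<close>)
      finally have "m ^ ?n * v \<le> m ^ ?n * (2 * A * f)" by (simp add: mult_ac)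
      then have vf: "v \<le> 2 * A * f" using mn by simp
      \<comment> \<open>the same condition, for the part \<open>D\<close> of the whole cube, bounds \<open>v\<close> from below\<close>
      have "measure lebesgue D * vnorm p (hcube a l) w1 \<le> A * l ^ ?n * vnorm p D w1"
        by (rule ainf1) (use l D in \<open>auto simp: Q_def\<close>)
      then have "m ^ ?n \<le> A * l ^ ?n * v" using vQ mD by (simp add: Q_def v_def)
      also have "\<dots> \<le> A * 1 * v" using A ln v by (intro mult_right_mono mult_left_mono) auto
      finally have vm: "1 / v \<le> A * (1 / m) ^ ?n" using v mn by (simp add: field_simps power_divide)
      \<comment> \<open>the local log-Hoelder condition freezes the exponent of the norm \<open>v\<close>\<close>
      have freeze: "v powr p y \<le> M * v powr p z" if yz: "y \<in> D" "z \<in> D" for y z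
      proof (rule powr_between[OF v v_le])
        let ?d = "\<bar>p y - p z\<bar>"
        have "(1 / v) powr ?d \<le> (A * (1 / m) ^ ?n) powr ?d"
          using vm v by (intro powr_mono2) auto
        also have "\<dots> = A powr ?d * ((1 / m) powr ?d) ^ ?n"
          using A m by (simp add: powr_mult powr_power powr_realpow[symmetric] powr_powr mult.commute del: power_divide)
        also have "\<dots> \<le> A powr P * L ^ ?n"
          using A L[OF m, of y b z] yz p_diff_le[of y z] L_ge_1
          by (intro mult_mono power_mono powr_mono) (auto simp: D_def)
        finally show "(1 / v) powr ?d \<le> M" by (simp add: M_def)
      qed
      have xD: "x \<in> D" unfolding D_def b[symmetric] by simp
      have w1v: "w1 y powr p y = (w1 y / v) powr p y * v powr p y" for y
        using v pos_weightD(3)[OF w1] by (simp add: powr_mult[symmetric])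
      have wv: "pos_weight (\<lambda>y. w1 y / v)" by (rule pos_weight_divide[OF w1 v])
      note [measurable] = pos_weightD(1)[OF w1] D(1) F(1)
      \<comment> \<open>\<open>up\<close> and \<open>low\<close>: mass and modular are comparable, with the factor \<open>v powr p x\<close>\<close>
      have up: "emeasure \<nu> D \<le> ennreal (M * v powr p x)"
      proof -
        have "modl p D w1 \<le> (\<integral>\<^sup>+y. ennreal (M * v powr p x) * (ennreal ((w1 y / v) powr p y) * indicator D y) \<partial>lebesgue)"
          unfolding modl_def
        proof (rule nn_integral_mono)
          fix y
          have "w1 y powr p y \<le> (M * v powr p x) * (w1 y / v) powr p y" if "y \<in> D"
            unfolding w1v[of y] using freeze[OF that xD] by (subst mult.commute) (intro mult_right_mono, auto)
          then show "ennreal (w1 y powr p y) * indicator D y \<le> ennreal (M * v powr p x) * (ennreal ((w1 y / v) powr p y) * indicator D y)"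
            using M by (auto simp: indicator_def ennreal_mult[symmetric] intro!: ennreal_leI)
        qed
        also have "\<dots> = ennreal (M * v powr p x) * modl p D (\<lambda>y. w1 y / v)"
          unfolding modl_def by (intro nn_integral_cmult) measurable
        also have "modl p D (\<lambda>y. w1 y / v) = 1"
          unfolding v_def by (rule modl_vnorm[OF w1 D(1)]) (use D finS v in \<open>auto simp: v_def\<close>)
        finally show ?thesis using \<nu>[OF D(1)] by simp
      qed
      have low: "ennreal (v powr p x) * modl p F (\<lambda>y. w1 y / v) \<le> ennreal M * emeasure \<nu> F"
      proof -
        have "ennreal (v powr p x) * modl p F (\<lambda>y. w1 y / v)
          = (\<integral>\<^sup>+y. ennreal (v powr p x) * (ennreal ((w1 y / v) powr p y) * indicator F y) \<partial>lebesgue)"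
          unfolding modl_def by (intro nn_integral_cmult[symmetric]) measurable
        also have "\<dots> \<le> (\<integral>\<^sup>+y. ennreal M * (ennreal (w1 y powr p y) * indicator F y) \<partial>lebesgue)"
        proof (rule nn_integral_mono)
          fix y
          have "v powr p x * (w1 y / v) powr p y \<le> M * w1 y powr p y" if "y \<in> F"
          proof -
            have "v powr p x * (w1 y / v) powr p y \<le> M * v powr p y * (w1 y / v) powr p y"
              using freeze[OF xD, of y] that F by (intro mult_right_mono) auto
            then show ?thesis unfolding w1v[of y] by (simp add: mult_ac)
          qed
          then show "ennreal (v powr p x) * (ennreal ((w1 y / v) powr p y) * indicator F y) \<le> ennreal M * (ennreal (w1 y powr p y) * indicator F y)"
            using M by (auto simp: indicator_def ennreal_mult[symmetric] intro!: ennreal_leI)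
        qed
        also have "\<dots> = ennreal M * modl p F w1"
          unfolding modl_def by (intro nn_integral_cmult) measurable
        finally show ?thesis using \<nu>[OF F(1)] by simp
      qed
      have one: "1 \<le> ennreal ((2 * A) powr P) * modl p F (\<lambda>y. w1 y / v)"
      proof -
        have "1 = modl p F (\<lambda>y. w1 y / f)"
          unfolding f_def by (rule modl_vnorm[OF w1 F(1), symmetric]) (use F finS f in \<open>auto simp: f_def\<close>)
        also have "\<dots> \<le> modl p F (\<lambda>y. (2 * A) * (w1 y / v))"
        proof (rule modl_mono)
          fix y
          have "1 / f \<le> 2 * A / v" using vf f v by (simp add: field_simps)
          then have "w1 y * (1 / f) \<le> w1 y * (2 * A / v)" using pos_weightD(3)[OF w1] by (rule mult_left_mono)
          then show "0 \<le> w1 y / f \<and> w1 y / f \<le> (2 * A) * (w1 y / v)"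
            using f pos_weightD(3)[OF w1, of y] by (simp add: mult_ac)
        qed
        also have "\<dots> \<le> ennreal ((2 * A) powr P) * modl p F (\<lambda>y. w1 y / v)"
          using A by (intro modl_scale_up wv F) auto
        finally show ?thesis .
      qed
      have "emeasure \<nu> D \<le> ennreal (M * v powr p x) * 1" using up by simp
      also have "\<dots> \<le> ennreal (M * v powr p x) * (ennreal ((2 * A) powr P) * modl p F (\<lambda>y. w1 y / v))"
        using one by (rule mult_left_mono) simp
      also have "\<dots> = ennreal (M * (2 * A) powr P) * (ennreal (v powr p x) * modl p F (\<lambda>y. w1 y / v))"
        using M by (simp add: ennreal_mult mult_ac)
      also have "\<dots> \<le> ennreal (M * (2 * A) powr P) * (ennreal M * emeasure \<nu> F)"
        using low by (rule mult_left_mono) simp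
      also have "\<dots> = ennreal H * emeasure \<nu> F"
        unfolding H_def using M by (simp add: ennreal_mult mult_ac power2_eq_square)
      finally have "emeasure \<nu> D \<le> ennreal H * emeasure \<nu> (D - E)" by (simp add: F_def)
      moreover have "emeasure \<nu> D < \<infinity>" using \<nu>[OF D(1)] finS(2)[OF D(2)] by simp
      ultimately show ?thesis unfolding b D_def[symmetric]
        using E D H by (intro emeasure_le_of_complement) (auto simp: \<nu>_def)
    qed
    show ?thesis
    proof (cases "s = 1")
      case True
      then show ?thesis using modl1 C(3) l unfolding w1_def V_def Q_def by simp
    next
      case False
      then have s': "0 < s - 1" using s by simp
      have "(\<integral>\<^sup>+y\<in>cell a l 0 a. ennreal (u y powr (1 + (s - 1))) \<partial>lebesgue)
        \<le> ennreal (C * cell_avg \<nu> a l 0 a powr (s - 1)) * emeasure \<nu> (cell a l 0 a)"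
      proof (rule dyadic_reverse_hoelder_density[OF l(1) u_meas _ \<nu>_def _ s', where \<alpha> = "1 - 1 / H"])
        show "0 \<le> u x" for x by (simp add: u_def)
        show "emeasure \<nu> (cell a l 0 a) < \<infinity>" unfolding Qc \<nu>[OF Q] modl1 by simp
        show "0 \<le> 1 - 1 / H" using H by simp
        show "2 powr (s - 1) + C * (2 * 2 ^ ?n) powr (s - 1) * (1 - 1 / H) \<le> C"
          using C(4)[of "s - 1"] s by simp
        show "emeasure \<nu> E \<le> ennreal (1 - 1 / H) * emeasure \<nu> (cell a l k x)"
          if "x \<in> cell a l 0 a" "E \<subseteq> cell a l k x" "E \<in> sets lebesgue"
            "2 * emeasure lebesgue E \<le> emeasure lebesgue (cell a l k x)" for k x E
          by (rule key) (use that Qc in auto)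
      qed (use C in auto)
      also have "emeasure \<nu> (cell a l 0 a) = 1" unfolding Qc \<nu>[OF Q] modl1 ..
      also have "cell_avg \<nu> a l 0 a = 1 / l ^ ?n"
        using \<nu>[OF Q] modl1 Qc by (simp add: cell_avg_def measure_def)
      also have "(\<integral>\<^sup>+y\<in>cell a l 0 a. ennreal (u y powr (1 + (s - 1))) \<partial>lebesgue) =
        modl (\<lambda>x. s * p x) Q w1"
        unfolding modl_def Qc by (simp add: u_def powr_powr mult.commute)
      finally show ?thesis by (simp add: Q_def w1_def V_def)
    qed
  qed
  then show ?thesis using that[of \<epsilon>0 C] C by blast
qed

end


section \<open>Passing from unit cells to large cubes\<close>

text \<open>The error made when an exponent is replaced by its limit at infinity; the power \<open>n + 1\<close> makes it
  integrable.\<close>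

definition decay_wt :: "real ^ 'n \<Rightarrow> real" where
  "decay_wt x = (exp 1 + norm x) powr (- real (CARD('n) + 1))"

text \<open>The three constants are the multiplicative loss when the exponent is replaced, the factor between
  the decaying weight at a point of a unit cell and its integral over the cell, and the total loss of a
  transfer between a large set and its unit cells.\<close>

definition exp_const :: "nat \<Rightarrow> real \<Rightarrow> real" where
  "exp_const n C = exp (real (n + 1) * C)"

definition cell_const :: "nat \<Rightarrow> real" where
  "cell_const n = real (n + 1) ^ (n + 1) * 2 ^ n"

definition transfer_const :: "nat \<Rightarrow> real \<Rightarrow> real" where
  "transfer_const n C = exp_const n C + cell_const n * (2 * 4 ^ n)"

lemma exp_const_nonneg [simp]: "0 \<le> exp_const n C" by (simp add: exp_const_def)

lemma cell_const_nonneg [simp]: "0 \<le> cell_const n" by (simp add: cell_const_def)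

lemma exp_norm_ge: "exp 1 \<le> exp 1 + norm x" "1 < exp 1 + norm x" "0 < exp 1 + norm x"
proof -
  have "(2::real) \<le> exp 1" using exp_ge_add_one_self[of 1] by simp
  then show "1 < exp 1 + norm x" "0 < exp 1 + norm x"
    using norm_ge_zero[of x] by linarith+
qed simp

lemma decay_wt_measurable [measurable]: "decay_wt \<in> borel_measurable lebesgue"
proof -
  have "decay_wt \<in> borel_measurable borel" unfolding decay_wt_def by measurable
  then show ?thesis by (intro measurable_completion) simp
qed

lemma decay_wt_nonneg: "0 \<le> decay_wt x" by (simp add: decay_wt_def)

text \<open>Compare with a step function on the cubes of half-side \<open>2 ^ (k + 1)\<close> about the origin; the integrals of the
  steps form a geometric series.\<close>

lemma decay_wt_integral:
  "(\<integral>\<^sup>+x. ennreal (decay_wt (x :: real ^ 'n)) \<partial>lebesgue) \<le> ennreal (2 * 4 ^ CARD('n))"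
proof -
  let ?n = "CARD('n)"
  define B :: "nat \<Rightarrow> (real ^ 'n) set" where "B k = hcube (- vec (2 ^ (k + 1))) (2 * 2 ^ (k + 1))" for k
  define c where "c k = ennreal ((1 / 2 ^ k) ^ (?n + 1))" for k :: nat
  have "ennreal (decay_wt x) \<le> (\<Sum>k. c k * indicator (B k) x)" for x :: "real ^ 'n"
  proof -
    define y where "y = exp 1 + norm x"
    have y: "1 < y" "norm x < y" unfolding y_def using exp_norm_ge(2)[of x] by auto
    have ex: "\<exists>k. y < 2 ^ k" using real_arch_pow[of 2 y] by auto
    define j where "j = (LEAST k. y < 2 ^ k)"
    have j: "y < 2 ^ j" unfolding j_def using LeastI_ex[OF ex] .
    have "j \<noteq> 0" using j y by (intro notI) simp
    then obtain k where k: "j = Suc k" using not0_implies_Suc by blast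
    have k_le: "2 ^ k \<le> y" using not_less_Least[of k "\<lambda>k. y < 2 ^ k"] k unfolding j_def[symmetric] by simp
    have "x \<in> B k"
      unfolding B_def hcube_def
    proof (intro CollectI allI)
      fix i
      have "\<bar>x $ i\<bar> < 2 ^ (k + 1)" using component_le_norm_cart[of x i] y j k by simp
      then show "(- vec (2 ^ (k + 1))) $ i \<le> x $ i \<and> x $ i < (- vec (2 ^ (k + 1))) $ i + 2 * 2 ^ (k + 1)"
        by (simp add: abs_less_iff)
    qed
    moreover have "decay_wt x \<le> (1 / 2 ^ k) ^ (?n + 1)"
    proof -
      have "decay_wt x = 1 / y ^ (?n + 1)"
        using y unfolding decay_wt_def y_def[symmetric] powr_minus_divide by (subst powr_realpow) auto
      also have "\<dots> \<le> 1 / (2 ^ k) ^ (?n + 1)"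
        using k_le y by (intro divide_left_mono power_mono mult_pos_pos) auto
      finally show ?thesis by (simp add: power_divide)
    qed
    ultimately have "ennreal (decay_wt x) \<le> c k * indicator (B k) x"
      by (simp add: c_def ennreal_leI)
    also have "\<dots> \<le> (\<Sum>k. c k * indicator (B k) x)"
    proof -
      define f where "f k = c k * indicator (B k) x" for k
      have "(\<Sum>i\<in>{k}. f i) \<le> (\<Sum>k. f k)" by (rule sum_le_suminf) auto
      then have "f k \<le> (\<Sum>k. f k)" by simp
      then show ?thesis unfolding f_def .
    qed
    finally show ?thesis .
  qed
  then have "(\<integral>\<^sup>+x. ennreal (decay_wt (x :: real ^ 'n)) \<partial>lebesgue) \<le> (\<integral>\<^sup>+x. (\<Sum>k. c k * indicator (B k) x) \<partial>lebesgue)"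
    by (intro nn_integral_mono)
  also have "\<dots> = (\<Sum>k. (\<integral>\<^sup>+x. c k * indicator (B k) x \<partial>lebesgue))"
    unfolding B_def by (intro nn_integral_suminf) measurable
  also have "\<dots> = (\<Sum>k. ennreal (4 ^ ?n * (1 / 2) ^ k))"
  proof (rule suminf_cong)
    fix k
    have "(\<integral>\<^sup>+x. c k * indicator (B k) x \<partial>lebesgue) = c k * emeasure lebesgue (B k)"
      unfolding B_def by (intro nn_integral_cmult_indicator) simp
    also have "\<dots> = ennreal ((1 / 2 ^ k) ^ (?n + 1) * (2 * 2 ^ (k + 1)) ^ ?n)"
      unfolding B_def c_def by (subst emeasure_hcube, simp, rule ennreal_mult[symmetric]) auto
    also have "(1 / 2 ^ k) ^ (?n + 1) * (2 * 2 ^ (k + 1)) ^ ?n = (1 / 2 ^ k * (4 * 2 ^ k)) ^ ?n * (1 / 2 ^ k :: real)"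
    proof -
      have "(4::real) ^ ?n = 2 ^ ?n * 2 ^ ?n" by (simp flip: power_mult_distrib)
      then show ?thesis unfolding power_mult_distrib power_add by (simp add: power_divide)
    qed
    also have "\<dots> = 4 ^ ?n * (1 / 2) ^ k" by (simp add: power_divide)
    finally show "(\<integral>\<^sup>+x. c k * indicator (B k) x \<partial>lebesgue) = ennreal (4 ^ ?n * (1 / 2) ^ k)" .
  qed
  also have "\<dots> = ennreal (4 ^ ?n * 2)"
  proof (rule suminf_ennreal_eq)
    have "(\<lambda>k. (1 / 2 :: real) ^ k) sums (1 / (1 - 1 / 2))" by (rule geometric_sums) simp
    then have "(\<lambda>k. (1 / 2 :: real) ^ k) sums 2" by simp
    then show "(\<lambda>k. 4 ^ ?n * (1 / 2 :: real) ^ k) sums (4 ^ ?n * 2)" by (rule sums_mult)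
  qed simp
  finally show ?thesis by (simp add: mult.commute)
qed

lemma decay_wt_cell:
  fixes x y :: "real ^ 'n"
  assumes "x \<in> hcube a l" "y \<in> hcube a l" "0 \<le> l" "l \<le> 1"
  shows "decay_wt y \<le> real (CARD('n) + 1) ^ (CARD('n) + 1) * decay_wt x"
proof -
  let ?n = "CARD('n)" and ?x = "exp 1 + norm x" and ?y = "exp 1 + norm y"
  have "norm (x - y) \<le> real ?n * l" using assms by (intro norm_less_of_hcube)
  also have "\<dots> \<le> real ?n * 1" using assms by (intro mult_left_mono) auto
  finally have "norm x \<le> ?n + norm y" using norm_triangle_sub[of x y] by simp
  moreover have "real ?n * 1 \<le> ?n * ?y" using exp_norm_ge(2)[of y] by (intro mult_left_mono) auto
  ultimately have "?x \<le> real (?n + 1) * ?y" by (simp add: algebra_simps)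
  then have "?x powr real (?n + 1) \<le> (real (?n + 1) * ?y) powr real (?n + 1)"
    using exp_norm_ge(3)[of x] by (intro powr_mono2) auto
  also have "\<dots> = real (?n + 1) powr real (?n + 1) * ?y powr real (?n + 1)"
    by (rule powr_mult)
  also have "real (?n + 1) powr real (?n + 1) = real (?n + 1) ^ (?n + 1)" by (rule powr_realpow) simp
  finally have le: "?x powr real (?n + 1) \<le> real (?n + 1) ^ (?n + 1) * ?y powr real (?n + 1)" .
  have pos: "0 < ?x powr real (?n + 1)" "0 < ?y powr real (?n + 1)"
    using exp_norm_ge(3)[of x] exp_norm_ge(3)[of y] by auto
  have "1 / Y \<le> G * (1 / X)" if "X \<le> G * Y" "0 < X" "0 < Y" for X Y G :: real
    using that by (simp add: field_simps)
  from this[OF le pos] show ?thesis unfolding decay_wt_def powr_minus_divide .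
qed

text \<open>Either \<open>t < \<tau>\<close>, and \<open>t powr a \<le> t\<close> is absorbed by the error, or \<open>t \<ge> \<tau>\<close>, and changing the exponent costs at
  most \<open>(1 / \<tau>) powr |a - b|\<close>.\<close>

lemma powr_le_powr_plus:
  fixes t \<tau> K :: real
  assumes t: "0 \<le> t" "t \<le> 1" and \<tau>: "0 < \<tau>" and a: "1 \<le> a" and K: "\<bar>a - b\<bar> * ln (1 / \<tau>) \<le> K"
  shows "t powr a \<le> exp K * t powr b + \<tau>"
proof (cases "t < \<tau>")
  case True
  have "t powr a \<le> t powr 1" using t a by (intro powr_mono') auto
  also have "\<dots> \<le> \<tau>" using True t by simp
  finally have "t powr a \<le> \<tau>" .
  moreover have "0 \<le> exp K * t powr b" by simp
  ultimately show ?thesis by linarith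
next
  case False
  then have t': "0 < t" using \<tau> by simp
  have "(1 / t) powr \<bar>a - b\<bar> \<le> (1 / \<tau>) powr \<bar>a - b\<bar>"
    using t' False \<tau> by (intro powr_mono2) (auto simp: field_simps)
  also have "\<dots> = exp (\<bar>a - b\<bar> * ln (1 / \<tau>))" using \<tau> by (simp add: powr_def)
  also have "\<dots> \<le> exp K" using K by simp
  finally have "t powr a \<le> exp K * t powr b" using powr_between[OF t' t(2)] by blast
  then show ?thesis using \<tau> by simp
qed

lemma exists_unit_generation:
  fixes l :: real
  assumes l: "1 < l"
  obtains K :: nat where "1 / 2 \<le> l / 2 ^ K" "l / 2 ^ K \<le> 1"
proof -
  have ex: "\<exists>k. l < 2 ^ k" using real_arch_pow[of 2 l] by auto
  define j where "j = (LEAST k. l < 2 ^ k)"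
  have j: "l < 2 ^ j" unfolding j_def using LeastI_ex[OF ex] .
  have "j \<noteq> 0" using j l by (intro notI) simp
  then obtain k where k: "j = Suc k" using not0_implies_Suc by blast
  have "2 ^ k \<le> l" using not_less_Least[of k "\<lambda>k. l < 2 ^ k"] k unfolding j_def[symmetric] by simp
  then show ?thesis using j k by (intro that[of j]) (auto simp: field_simps)
qed

text \<open>An exponent with a log-Hoelder limit at infinity. On sets made of unit cells such an exponent can be
  replaced by its limit: if \<open>v x\<close> is the norm of \<open>w\<close> on the unit cell of \<open>x\<close>, the norm of \<open>w\<close> on \<open>S\<close> is
  comparable to the norm of \<open>v\<close> on \<open>S\<close> with the constant exponent \<open>pinf\<close>. The lemmas
  \<open>cells_le_norm\<close> and \<open>modl_le_of_cells\<close> are the two inequalities.\<close>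

locale decaying_exponent = bounded_exponent p P for p :: "real ^ 'n \<Rightarrow> real" and P :: real +
  fixes pinf Cinf :: real
  assumes pinf_ge_1: "1 \<le> pinf" and pinf_le_P: "pinf \<le> P"
    and decay: "\<bar>p x - pinf\<bar> \<le> Cinf / ln (exp 1 + norm x)"
begin

lemma Cinf_nonneg: "0 \<le> Cinf"
proof -
  have "0 \<le> Cinf / ln (exp 1 + norm (0 :: real ^ 'n))" using decay[of 0] abs_ge_zero order_trans by blast
  then show ?thesis by simp
qed

lemma transfer_const_ge_1: "1 \<le> transfer_const CARD('n) Cinf"
proof -
  have "1 \<le> exp_const CARD('n) Cinf" using Cinf_nonneg by (simp add: exp_const_def)
  then show ?thesis unfolding transfer_const_def by (simp add: add_increasing2)
qed

lemma exponent_compare: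
  assumes "0 \<le> t" "t \<le> 1"
  shows "t powr p x \<le> exp_const CARD('n) Cinf * t powr pinf + decay_wt x"
    "t powr pinf \<le> exp_const CARD('n) Cinf * t powr p x + decay_wt x"
proof -
  have d: "0 < decay_wt x" using exp_norm_ge(3)[of x] by (simp add: decay_wt_def)
  have l: "0 < ln (exp 1 + norm x)" using exp_norm_ge(2)[of x] by simp
  have "ln (1 / decay_wt x) = real (CARD('n) + 1) * ln (exp 1 + norm x)"
    using exp_norm_ge(3)[of x] by (simp add: decay_wt_def ln_div ln_powr algebra_simps)
  then have "\<bar>p x - pinf\<bar> * ln (1 / decay_wt x) = real (CARD('n) + 1) * (\<bar>p x - pinf\<bar> * ln (exp 1 + norm x))"
    by simp
  also have "\<dots> \<le> real (CARD('n) + 1) * Cinf"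
    using decay[of x] l by (intro mult_left_mono) (auto simp: field_simps)
  finally have K: "\<bar>p x - pinf\<bar> * ln (1 / decay_wt x) \<le> real (CARD('n) + 1) * Cinf" .
  show "t powr p x \<le> exp_const CARD('n) Cinf * t powr pinf + decay_wt x"
    unfolding exp_const_def by (rule powr_le_powr_plus[OF assms d p_ge_1 K])
  show "t powr pinf \<le> exp_const CARD('n) Cinf * t powr p x + decay_wt x"
    unfolding exp_const_def by (rule powr_le_powr_plus[OF assms d pinf_ge_1]) (use K in \<open>simp add: abs_minus_commute\<close>)
qed

text \<open>A grid whose generation \<open>K\<close> consists of cells of side between \<open>1 / 2\<close> and \<open>1\<close>, so of volume between
  \<open>2 ^ - n\<close> and \<open>1\<close>.\<close>

context
  fixes a :: "real ^ 'n" and l :: real and K :: nat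
  assumes l: "0 < l" and unit: "1 / 2 \<le> l / 2 ^ K" "l / 2 ^ K \<le> 1"
begin

abbreviation "R \<equiv> cell a l K"

lemma unit_cell_measure:
  "emeasure lebesgue (R x) \<le> 1" "1 \<le> 2 ^ CARD('n) * emeasure lebesgue (R x)"
proof -
  have le: "(l / 2 ^ K) ^ CARD('n) \<le> 1" using unit l by (intro power_le_one) auto
  show "emeasure lebesgue (R x) \<le> 1" unfolding emeasure_cell[OF l] using le by (simp add: ennreal_le_1)
  have "(1 / 2 :: real) ^ CARD('n) \<le> (l / 2 ^ K) ^ CARD('n)" using unit by (intro power_mono) auto
  then have "1 \<le> 2 ^ CARD('n) * (l / 2 ^ K) ^ CARD('n)" by (simp add: power_divide field_simps)
  then have "1 \<le> ennreal (2 ^ CARD('n) * (l / 2 ^ K) ^ CARD('n))" by simp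
  also have "\<dots> = 2 ^ CARD('n) * emeasure lebesgue (R x)"
    unfolding emeasure_cell[OF l] using l by (simp add: ennreal_mult ennreal_power[symmetric])
  finally show "1 \<le> 2 ^ CARD('n) * emeasure lebesgue (R x)" .
qed

lemma unit_cell_decay:
  assumes y: "y \<in> R x"
  shows "ennreal (decay_wt y) \<le> (\<integral>\<^sup>+z\<in>R x. ennreal (cell_const CARD('n) * decay_wt z) \<partial>lebesgue)"
proof -
  let ?n = "CARD('n)"
  obtain b where b: "R x = hcube b (l / 2 ^ K)" using cell_eq_hcube[OF l] by blast
  have "ennreal (decay_wt y) * 1 \<le> ennreal (decay_wt y) * (2 ^ ?n * emeasure lebesgue (R x))"
    using unit_cell_measure(2) by (intro mult_left_mono) auto
  also have "\<dots> = ennreal (2 ^ ?n * decay_wt y) * emeasure lebesgue (R x)"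
    using decay_wt_nonneg[of y] by (simp add: ennreal_mult ennreal_power[symmetric] mult_ac)
  also have "\<dots> = (\<integral>\<^sup>+z\<in>R x. ennreal (2 ^ ?n * decay_wt y) \<partial>lebesgue)"
    using l by (simp add: nn_integral_cmult_indicator)
  also have "\<dots> \<le> (\<integral>\<^sup>+z\<in>R x. ennreal (cell_const CARD('n) * decay_wt z) \<partial>lebesgue)"
  proof (rule nn_integral_mono)
    fix z
    have "2 ^ ?n * decay_wt y \<le> cell_const CARD('n) * decay_wt z" if "z \<in> R x"
    proof -
      have "decay_wt y \<le> real (?n + 1) ^ (?n + 1) * decay_wt z"
        using decay_wt_cell[of z b "l / 2 ^ K" y] that y unit l b by auto
      then have "2 ^ ?n * decay_wt y \<le> 2 ^ ?n * (real (?n + 1) ^ (?n + 1) * decay_wt z)" by (intro mult_left_mono) auto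
      then show ?thesis unfolding cell_const_def by (simp only: mult_ac)
    qed
    then show "ennreal (2 ^ ?n * decay_wt y) * indicator (R x) z \<le> ennreal (cell_const CARD('n) * decay_wt z) * indicator (R x) z"
      by (auto simp: indicator_def intro!: ennreal_leI)
  qed
  finally show ?thesis by simp
qed

text \<open>Averaged against a density of mass at most \<open>1\<close>, the error term on a unit cell is bounded by a multiple of
  its own integral, so that the errors of all cells add up to a constant.\<close>

lemma unit_cell_average:
  assumes g: "g \<in> borel_measurable lebesgue" and mass: "(\<integral>\<^sup>+y\<in>R x. g y \<partial>lebesgue) \<le> 1"
  shows "(\<integral>\<^sup>+y\<in>R x. g y * ennreal (decay_wt y) \<partial>lebesgue) \<le> (\<integral>\<^sup>+z\<in>R x. ennreal (cell_const CARD('n) * decay_wt z) \<partial>lebesgue)"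
proof -
  let ?I = "(\<integral>\<^sup>+z\<in>R x. ennreal (cell_const CARD('n) * decay_wt z) \<partial>lebesgue)"
  have "(\<integral>\<^sup>+y\<in>R x. g y * ennreal (decay_wt y) \<partial>lebesgue) \<le> (\<integral>\<^sup>+y. ?I * (g y * indicator (R x) y) \<partial>lebesgue)"
  proof (rule nn_integral_mono)
    fix y
    have "g y * ennreal (decay_wt y) \<le> ?I * g y" if "y \<in> R x"
      using unit_cell_decay[OF that] by (subst mult.commute) (rule mult_right_mono, auto)
    then show "g y * ennreal (decay_wt y) * indicator (R x) y \<le> ?I * (g y * indicator (R x) y)"
      by (auto simp: indicator_def)
  qed
  also have "\<dots> = ?I * (\<integral>\<^sup>+y\<in>R x. g y \<partial>lebesgue)"
  proof -
    have [measurable]: "R x \<in> sets lebesgue" "g \<in> borel_measurable lebesgue" using l g by auto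
    show ?thesis by (rule nn_integral_cmult) measurable
  qed
  also have "\<dots> \<le> ?I * 1" using mass by (rule mult_left_mono) simp
  finally show ?thesis by simp
qed

lemma decay_total:
  fixes S :: "(real ^ 'n) set"
  assumes "S \<in> sets lebesgue"
  shows "(\<integral>\<^sup>+z\<in>S. ennreal (cell_const CARD('n) * decay_wt z) \<partial>lebesgue) \<le> ennreal (cell_const CARD('n) * (2 * 4 ^ CARD('n)))"
proof -
  have "(\<integral>\<^sup>+z\<in>S. ennreal (cell_const CARD('n) * decay_wt z) \<partial>lebesgue) \<le> (\<integral>\<^sup>+z. ennreal (cell_const CARD('n)) * ennreal (decay_wt (z :: real ^ 'n)) \<partial>lebesgue)"
    by (intro nn_integral_mono) (auto simp: indicator_def ennreal_mult decay_wt_nonneg)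
  also have "\<dots> = ennreal (cell_const CARD('n)) * (\<integral>\<^sup>+z. ennreal (decay_wt (z :: real ^ 'n)) \<partial>lebesgue)"
    by (rule nn_integral_cmult) measurable
  also have "\<dots> \<le> ennreal (cell_const CARD('n)) * ennreal (2 * 4 ^ CARD('n))"
    using decay_wt_integral by (rule mult_left_mono) simp
  also have "\<dots> = ennreal (cell_const CARD('n) * (2 * 4 ^ CARD('n)))" by (rule ennreal_mult[symmetric]) auto
  finally show ?thesis .
qed

text \<open>On each cell, where \<open>t = v x / V \<le> 1\<close>, the density \<open>(w / v x) powr p\<close> has mass exactly \<open>1\<close>. Hence
  \<open>t powr pinf\<close> equals its own average against that density; exchanging \<open>pinf\<close> for \<open>p y\<close> under the integral
  turns it into the modular of \<open>w / V\<close> plus the error term.\<close>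

lemma cells_le_norm:
  assumes w: "pos_weight w" and S: "cell_union a l K S" and fin: "modl p S w < \<infinity>"
    and V: "0 < V" "modl p S (\<lambda>x. w x / V) \<le> 1"
  shows "(\<integral>\<^sup>+x\<in>S. ennreal (vnorm p (R x) w powr pinf) \<partial>lebesgue) \<le> ennreal (transfer_const CARD('n) Cinf * V powr pinf)"
proof -
  let ?v = "\<lambda>x. vnorm p (R x) w"
  have S_sets: "S \<in> sets lebesgue" using cell_union_sets[OF l S] .
  have v_meas: "?v \<in> borel_measurable lebesgue"
    by (rule cell_step_measurable[OF l, where a = a and k = K]) (simp add: cell_eq)
  have w_meas: "w \<in> borel_measurable lebesgue" using w pos_weightD by blast
  note [measurable] = S_sets v_meas w_meas
  have RS: "R x \<subseteq> S" if "x \<in> S" for x using S that by (auto simp: cell_union_def)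
  have finR: "modl p (R x) w < \<infinity>" if "x \<in> S" for x
    using modl_set_mono[OF RS[OF that], of p w] fin by simp
  have Rs: "R x \<in> sets lebesgue" for x using l by simp
  have v: "0 < ?v x" "?v x \<le> V" if "x \<in> S" for x
  proof -
    show "0 < ?v x" by (rule vnorm_pos[OF w Rs finR[OF that]])
      (use unit_cell_measure(2)[of x] in \<open>auto simp: zero_less_iff_neq_zero simp del: emeasure_completion\<close>)
    show "?v x \<le> V"
      using modl_set_mono[OF RS[OF that], of p "\<lambda>x. w x / V"] V by (intro vnorm_le) auto
  qed
  define G where "G y = ennreal (exp_const CARD('n) Cinf) * ennreal ((w y / V) powr p y) + ennreal (cell_const CARD('n) * decay_wt y)" for y
  have G_meas: "G \<in> borel_measurable lebesgue" unfolding G_def by measurable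
  have "(\<integral>\<^sup>+x\<in>S. ennreal ((?v x / V) powr pinf) \<partial>lebesgue) \<le> (\<integral>\<^sup>+y\<in>S. G y \<partial>lebesgue)"
  proof (rule nn_integral_cellwise_mono[OF l S refl refl _ G_meas])
    fix x assume x: "x \<in> S"
    define t where "t = ?v x / V"
    have t: "0 < t" "t \<le> 1" using v[OF x] V by (auto simp: t_def)
    define g where "g y = ennreal ((w y / ?v x) powr p y)" for y
    have g_meas: "g \<in> borel_measurable lebesgue" unfolding g_def by measurable
    note [measurable] = g_meas Rs[of x]
    have g1: "(\<integral>\<^sup>+y\<in>R x. g y \<partial>lebesgue) = 1"
      using modl_vnorm[OF w Rs finR[OF x] v(1)[OF x]] unfolding g_def modl_def .
    have "(\<integral>\<^sup>+y\<in>R x. ennreal ((?v y / V) powr pinf) \<partial>lebesgue) = (\<integral>\<^sup>+y\<in>R x. ennreal (t powr pinf) \<partial>lebesgue)"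
      unfolding t_def by (intro nn_integral_cong) (auto simp: indicator_def cell_eq)
    also have "\<dots> = ennreal (t powr pinf) * emeasure lebesgue (R x)"
      using l by (simp add: nn_integral_cmult_indicator)
    also have "\<dots> \<le> ennreal (t powr pinf) * 1" using unit_cell_measure(1) by (rule mult_left_mono) simp
    also have "\<dots> = (\<integral>\<^sup>+y. ennreal (t powr pinf) * (g y * indicator (R x) y) \<partial>lebesgue)"
      using g_meas Rs unfolding g1[symmetric] by (intro nn_integral_cmult[symmetric]) measurable
    also have "\<dots> \<le> (\<integral>\<^sup>+y\<in>R x. ennreal (exp_const CARD('n) Cinf) * ennreal ((w y / V) powr p y) + g y * ennreal (decay_wt y) \<partial>lebesgue)"
    proof (rule nn_integral_mono)
      fix y
      let ?A = "(w y / ?v x) powr p y"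
      have "t powr pinf * ?A \<le> (exp_const CARD('n) Cinf * t powr p y + decay_wt y) * ?A"
        using t exponent_compare(2)[of t y] by (intro mult_right_mono) auto
      also have "\<dots> = exp_const CARD('n) Cinf * (t powr p y * ?A) + ?A * decay_wt y" by (simp add: algebra_simps)
      also have "t powr p y * ?A = (w y / V) powr p y"
        using t v(1)[OF x] V pos_weightD(3)[OF w, of y] unfolding powr_mult[symmetric] t_def by (simp add: powr_mult[symmetric])
      finally have "ennreal (t powr pinf) * g y \<le> ennreal (exp_const CARD('n) Cinf) * ennreal ((w y / V) powr p y) + g y * ennreal (decay_wt y)"
        unfolding g_def by (simp add: ennreal_mult[symmetric] ennreal_plus[symmetric] decay_wt_nonneg ennreal_leI del: ennreal_plus)
      then show "ennreal (t powr pinf) * (g y * indicator (R x) y)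
        \<le> (ennreal (exp_const CARD('n) Cinf) * ennreal ((w y / V) powr p y) + g y * ennreal (decay_wt y)) * indicator (R x) y"
        by (auto simp: indicator_def)
    qed
    also have "\<dots> = (\<integral>\<^sup>+y\<in>R x. ennreal (exp_const CARD('n) Cinf) * ennreal ((w y / V) powr p y) \<partial>lebesgue) + (\<integral>\<^sup>+y\<in>R x. g y * ennreal (decay_wt y) \<partial>lebesgue)"
      by (intro nn_set_integral_add Rs) measurable
    also have "\<dots> \<le> (\<integral>\<^sup>+y\<in>R x. ennreal (exp_const CARD('n) Cinf) * ennreal ((w y / V) powr p y) \<partial>lebesgue) + (\<integral>\<^sup>+y\<in>R x. ennreal (cell_const CARD('n) * decay_wt y) \<partial>lebesgue)"
      using unit_cell_average[OF g_meas] g1 by (intro add_left_mono) simp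
    also have "\<dots> = (\<integral>\<^sup>+y\<in>R x. G y \<partial>lebesgue)"
      unfolding G_def by (intro nn_set_integral_add[symmetric] Rs) measurable
    finally show "(\<integral>\<^sup>+y\<in>R x. ennreal ((?v y / V) powr pinf) \<partial>lebesgue) \<le> (\<integral>\<^sup>+y\<in>R x. G y \<partial>lebesgue)" .
  qed measurable
  also have "\<dots> = (\<integral>\<^sup>+y\<in>S. ennreal (exp_const CARD('n) Cinf) * ennreal ((w y / V) powr p y) \<partial>lebesgue) + (\<integral>\<^sup>+y\<in>S. ennreal (cell_const CARD('n) * decay_wt y) \<partial>lebesgue)"
    unfolding G_def by (intro nn_set_integral_add S_sets) measurable
  also have "(\<integral>\<^sup>+y\<in>S. ennreal (exp_const CARD('n) Cinf) * ennreal ((w y / V) powr p y) \<partial>lebesgue) = ennreal (exp_const CARD('n) Cinf) * modl p S (\<lambda>y. w y / V)"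
    unfolding modl_def mult.assoc by (intro nn_integral_cmult) measurable
  also have "ennreal (exp_const CARD('n) Cinf) * modl p S (\<lambda>y. w y / V) + (\<integral>\<^sup>+y\<in>S. ennreal (cell_const CARD('n) * decay_wt y) \<partial>lebesgue)
    \<le> ennreal (exp_const CARD('n) Cinf) * 1 + ennreal (cell_const CARD('n) * (2 * 4 ^ CARD('n)))"
    using V decay_total[OF S_sets] by (intro add_mono mult_left_mono) auto
  also have "\<dots> = ennreal (transfer_const CARD('n) Cinf)"
    unfolding transfer_const_def mult_1_right by (rule ennreal_plus[symmetric]) auto
  finally have le: "(\<integral>\<^sup>+x\<in>S. ennreal ((?v x / V) powr pinf) \<partial>lebesgue) \<le> ennreal (transfer_const CARD('n) Cinf)" .
  have "(\<integral>\<^sup>+x\<in>S. ennreal (?v x powr pinf) \<partial>lebesgue) = (\<integral>\<^sup>+x. ennreal (V powr pinf) * (ennreal ((?v x / V) powr pinf) * indicator S x) \<partial>lebesgue)"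
  proof (rule nn_integral_cong)
    fix x
    have "?v x powr pinf = V powr pinf * (?v x / V) powr pinf" if "x \<in> S"
      using v[OF that] V by (simp add: powr_mult[symmetric])
    then show "ennreal (?v x powr pinf) * indicator S x = ennreal (V powr pinf) * (ennreal ((?v x / V) powr pinf) * indicator S x)"
      by (auto simp: indicator_def ennreal_mult[symmetric])
  qed
  also have "\<dots> = ennreal (V powr pinf) * (\<integral>\<^sup>+x\<in>S. ennreal ((?v x / V) powr pinf) \<partial>lebesgue)"
    by (rule nn_integral_cmult) measurable
  also have "\<dots> \<le> ennreal (V powr pinf) * ennreal (transfer_const CARD('n) Cinf)" using le by (rule mult_left_mono) simp
  also have "\<dots> = ennreal (transfer_const CARD('n) Cinf * V powr pinf)"
    using transfer_const_ge_1 by (simp add: ennreal_mult[symmetric] mult.commute)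
  finally show ?thesis .
qed

text \<open>The converse comparison, with any upper bounds \<open>c x\<close> for the norms on the cells. This freedom is used with
  bounds for a larger exponent.\<close>

lemma modl_le_of_cells:
  assumes w: "pos_weight w" and S: "cell_union a l K S"
    and c_step: "\<And>x y. y \<in> R x \<Longrightarrow> c y = c x"
    and c: "\<And>x. x \<in> S \<Longrightarrow> 0 < c x" "\<And>x. x \<in> S \<Longrightarrow> modl p (R x) (\<lambda>y. w y / c x) \<le> 1"
    and T: "0 < T" "(\<integral>\<^sup>+x\<in>S. ennreal (2 ^ CARD('n) * c x powr pinf) \<partial>lebesgue) \<le> ennreal (T powr pinf)"
  shows "modl p S (\<lambda>x. w x / T) \<le> ennreal (transfer_const CARD('n) Cinf)"
proof -
  have S_sets: "S \<in> sets lebesgue" using cell_union_sets[OF l S] .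
  have c_meas: "c \<in> borel_measurable lebesgue" using c_step by (rule cell_step_measurable[OF l])
  have w_meas: "w \<in> borel_measurable lebesgue" using w pos_weightD by blast
  note [measurable] = S_sets c_meas w_meas
  have RS: "R x \<subseteq> S" if "x \<in> S" for x using S that by (auto simp: cell_union_def)
  have Rs: "R x \<in> sets lebesgue" for x using l by simp
  \<comment> \<open>the constant \<open>2 ^ n\<close> in the hypothesis on \<open>T\<close> makes a single cell, of volume at least \<open>2 ^ - n\<close>, count fully\<close>
  have cT: "c x \<le> T" if x: "x \<in> S" for x
  proof -
    have "ennreal (c x powr pinf) * 1 \<le> ennreal (c x powr pinf) * (2 ^ CARD('n) * emeasure lebesgue (R x))"
      using unit_cell_measure(2) by (intro mult_left_mono) auto
    also have "\<dots> = ennreal (2 ^ CARD('n) * c x powr pinf) * emeasure lebesgue (R x)"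
      by (simp add: ennreal_mult ennreal_power[symmetric] mult_ac)
    also have "\<dots> = (\<integral>\<^sup>+y\<in>R x. ennreal (2 ^ CARD('n) * c x powr pinf) \<partial>lebesgue)"
      using l by (simp add: nn_integral_cmult_indicator)
    also have "\<dots> \<le> (\<integral>\<^sup>+y\<in>S. ennreal (2 ^ CARD('n) * c y powr pinf) \<partial>lebesgue)"
      using RS[OF x] c_step by (intro nn_integral_mono) (auto simp: indicator_def)
    also have "\<dots> \<le> ennreal (T powr pinf)" by (rule T)
    finally have "c x powr pinf \<le> T powr pinf" by (simp add: ennreal_le_iff)
    then show ?thesis using T(1) pinf_ge_1 c(1)[OF x]
      by (metis less_le_trans linorder_not_le powr_less_mono2 less_imp_le zero_less_one)
  qed
  define G where "G y = ennreal (exp_const CARD('n) Cinf) * ennreal (2 ^ CARD('n) * (c y / T) powr pinf) + ennreal (cell_const CARD('n) * decay_wt y)" for y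
  have G_meas: "G \<in> borel_measurable lebesgue" unfolding G_def by measurable
  have "(\<integral>\<^sup>+y\<in>S. ennreal ((w y / T) powr p y) \<partial>lebesgue) \<le> (\<integral>\<^sup>+y\<in>S. G y \<partial>lebesgue)"
  proof (rule nn_integral_cellwise_mono[OF l S refl refl _ G_meas])
    fix x assume x: "x \<in> S"
    define t where "t = c x / T"
    have t: "0 < t" "t \<le> 1" using c(1)[OF x] cT[OF x] T by (auto simp: t_def)
    define g where "g y = ennreal ((w y / c x) powr p y)" for y
    have g_meas: "g \<in> borel_measurable lebesgue" unfolding g_def by measurable
    note [measurable] = g_meas Rs[of x]
    have g1: "(\<integral>\<^sup>+y\<in>R x. g y \<partial>lebesgue) \<le> 1" using c(2)[OF x] unfolding g_def modl_def .
    have "(\<integral>\<^sup>+y\<in>R x. ennreal ((w y / T) powr p y) \<partial>lebesgue)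
      \<le> (\<integral>\<^sup>+y\<in>R x. ennreal (exp_const CARD('n) Cinf * t powr pinf) * g y + g y * ennreal (decay_wt y) \<partial>lebesgue)"
    proof (rule nn_integral_mono)
      fix y
      let ?A = "(w y / c x) powr p y"
      have "(w y / T) powr p y = t powr p y * ?A"
        using t c(1)[OF x] T pos_weightD(3)[OF w, of y] unfolding t_def by (simp add: powr_mult[symmetric])
      also have "\<dots> \<le> (exp_const CARD('n) Cinf * t powr pinf + decay_wt y) * ?A"
        using t exponent_compare(1)[of t y] by (intro mult_right_mono) auto
      also have "\<dots> = (exp_const CARD('n) Cinf * t powr pinf) * ?A + ?A * decay_wt y" by (simp add: algebra_simps)
      finally have "ennreal ((w y / T) powr p y) \<le> ennreal (exp_const CARD('n) Cinf * t powr pinf) * g y + g y * ennreal (decay_wt y)"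
        unfolding g_def by (simp add: ennreal_mult[symmetric] ennreal_plus[symmetric] decay_wt_nonneg ennreal_leI del: ennreal_plus)
      then show "ennreal ((w y / T) powr p y) * indicator (R x) y
        \<le> (ennreal (exp_const CARD('n) Cinf * t powr pinf) * g y + g y * ennreal (decay_wt y)) * indicator (R x) y"
        by (auto simp: indicator_def)
    qed
    also have "\<dots> = (\<integral>\<^sup>+y\<in>R x. ennreal (exp_const CARD('n) Cinf * t powr pinf) * g y \<partial>lebesgue) + (\<integral>\<^sup>+y\<in>R x. g y * ennreal (decay_wt y) \<partial>lebesgue)"
      by (intro nn_set_integral_add Rs) measurable
    also have "(\<integral>\<^sup>+y\<in>R x. ennreal (exp_const CARD('n) Cinf * t powr pinf) * g y \<partial>lebesgue) = ennreal (exp_const CARD('n) Cinf * t powr pinf) * (\<integral>\<^sup>+y\<in>R x. g y \<partial>lebesgue)"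
      unfolding mult.assoc using g_meas Rs by (intro nn_integral_cmult) measurable
    also have "\<dots> + (\<integral>\<^sup>+y\<in>R x. g y * ennreal (decay_wt y) \<partial>lebesgue)
      \<le> ennreal (exp_const CARD('n) Cinf * t powr pinf) * (2 ^ CARD('n) * emeasure lebesgue (R x)) + (\<integral>\<^sup>+y\<in>R x. ennreal (cell_const CARD('n) * decay_wt y) \<partial>lebesgue)"
      using unit_cell_average[OF g_meas g1] order_trans[OF g1 unit_cell_measure(2)]
      by (intro add_mono mult_left_mono) (auto simp del: emeasure_completion)
    also have "ennreal (exp_const CARD('n) Cinf * t powr pinf) * (2 ^ CARD('n) * emeasure lebesgue (R x))
      = ennreal (exp_const CARD('n) Cinf) * ennreal (2 ^ CARD('n) * t powr pinf) * emeasure lebesgue (R x)"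
      by (simp add: ennreal_mult ennreal_power[symmetric] mult_ac)
    also have "\<dots> = (\<integral>\<^sup>+y\<in>R x. ennreal (exp_const CARD('n) Cinf) * ennreal (2 ^ CARD('n) * t powr pinf) \<partial>lebesgue)"
      using l by (subst nn_integral_cmult_indicator) auto
    also have "\<dots> = (\<integral>\<^sup>+y\<in>R x. ennreal (exp_const CARD('n) Cinf) * ennreal (2 ^ CARD('n) * (c y / T) powr pinf) \<partial>lebesgue)"
      unfolding t_def using c_step by (intro nn_integral_cong) (auto simp: indicator_def)
    also have "\<dots> + (\<integral>\<^sup>+y\<in>R x. ennreal (cell_const CARD('n) * decay_wt y) \<partial>lebesgue) = (\<integral>\<^sup>+y\<in>R x. G y \<partial>lebesgue)"
      unfolding G_def by (intro nn_set_integral_add[symmetric] Rs) measurable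
    finally show "(\<integral>\<^sup>+y\<in>R x. ennreal ((w y / T) powr p y) \<partial>lebesgue) \<le> (\<integral>\<^sup>+y\<in>R x. G y \<partial>lebesgue)" .
  qed measurable
  also have "\<dots> = (\<integral>\<^sup>+y\<in>S. ennreal (exp_const CARD('n) Cinf) * ennreal (2 ^ CARD('n) * (c y / T) powr pinf) \<partial>lebesgue) + (\<integral>\<^sup>+y\<in>S. ennreal (cell_const CARD('n) * decay_wt y) \<partial>lebesgue)"
    unfolding G_def by (intro nn_set_integral_add S_sets) measurable
  also have "\<dots> \<le> ennreal (exp_const CARD('n) Cinf) * 1 + ennreal (cell_const CARD('n) * (2 * 4 ^ CARD('n)))"
  proof (intro add_mono decay_total[OF S_sets])
    have "(\<integral>\<^sup>+y\<in>S. ennreal (exp_const CARD('n) Cinf) * ennreal (2 ^ CARD('n) * (c y / T) powr pinf) \<partial>lebesgue)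
      = (\<integral>\<^sup>+y. ennreal (exp_const CARD('n) Cinf / T powr pinf) * (ennreal (2 ^ CARD('n) * c y powr pinf) * indicator S y) \<partial>lebesgue)"
    proof (rule nn_integral_cong)
      fix y
      have "exp_const CARD('n) Cinf * (2 ^ CARD('n) * (c y / T) powr pinf) = exp_const CARD('n) Cinf / T powr pinf * (2 ^ CARD('n) * c y powr pinf)" if "y \<in> S"
        using c(1)[OF that] T by (simp add: powr_divide)
      then show "ennreal (exp_const CARD('n) Cinf) * ennreal (2 ^ CARD('n) * (c y / T) powr pinf) * indicator S y
        = ennreal (exp_const CARD('n) Cinf / T powr pinf) * (ennreal (2 ^ CARD('n) * c y powr pinf) * indicator S y)"
        by (auto simp: indicator_def ennreal_mult[symmetric])
    qed
    also have "\<dots> = ennreal (exp_const CARD('n) Cinf / T powr pinf) * (\<integral>\<^sup>+y\<in>S. ennreal (2 ^ CARD('n) * c y powr pinf) \<partial>lebesgue)"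
      by (rule nn_integral_cmult) measurable
    also have "\<dots> \<le> ennreal (exp_const CARD('n) Cinf / T powr pinf) * ennreal (T powr pinf)" using T(2) by (rule mult_left_mono) simp
    also have "\<dots> = ennreal (exp_const CARD('n) Cinf) * 1" using T(1) by (simp add: ennreal_mult[symmetric])
    finally show "(\<integral>\<^sup>+y\<in>S. ennreal (exp_const CARD('n) Cinf) * ennreal (2 ^ CARD('n) * (c y / T) powr pinf) \<partial>lebesgue) \<le> ennreal (exp_const CARD('n) Cinf) * 1" .
  qed
  also have "\<dots> = ennreal (transfer_const CARD('n) Cinf)"
    unfolding transfer_const_def mult_1_right by (rule ennreal_plus[symmetric]) auto
  finally show ?thesis unfolding modl_def .
qed

end

end


section \<open>Reverse Hoelder inequalities on all cubes\<close>

locale log_holder_exponent = locally_log_holder p P L + decaying_exponent p P pinf Cinf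
  for p :: "real ^ 'n \<Rightarrow> real" and P L pinf Cinf :: real
begin

text \<open>The constant is the same for all \<open>s \<le> 2\<close>, which makes the transfer constants uniform in \<open>s\<close>.\<close>

lemma scaled_exponent:
  assumes s: "1 \<le> s" "s \<le> 2"
  shows "decaying_exponent (\<lambda>x. s * p x) (s * P) (s * pinf) (2 * Cinf)"
proof
  show "(\<lambda>x. s * p x) \<in> borel_measurable lebesgue" by measurable
  fix x
  show "1 \<le> s * p x" using mult_mono[of 1 s 1 "p x"] s p_ge_1[of x] by simp
  show "s * p x \<le> s * P" using s p_le_P[of x] by simp
  show "1 \<le> s * pinf" using mult_mono[of 1 s 1 pinf] s pinf_ge_1 by simp
  show "s * pinf \<le> s * P" using s pinf_le_P by simp
  have l: "0 < ln (exp 1 + norm x)" using exp_norm_ge(2)[of x] by simp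
  have "\<bar>s * p x - s * pinf\<bar> = s * \<bar>p x - pinf\<bar>" using s by (simp add: abs_mult flip: right_diff_distrib)
  also have "\<dots> \<le> 2 * (Cinf / ln (exp 1 + norm x))" using s decay[of x] by (intro mult_mono) auto
  finally show "\<bar>s * p x - s * pinf\<bar> \<le> 2 * Cinf / ln (exp 1 + norm x)" by simp
qed

text \<open>On a cube of side greater than \<open>1\<close>, use the norms \<open>v x\<close> of \<open>w\<close> on unit cells. By the transfer lemmas the
  measure \<open>\<nu>\<close> with density \<open>v powr pinf\<close> inherits the condition on \<open>w\<close>, for unions of unit cells and now with
  masses; so the dyadic inequality, stopped at the unit cells, bounds the integral of \<open>v powr (s * pinf)\<close>. On each unit
  cell the norm with exponent \<open>s * p\<close> is at most a multiple of \<open>v x\<close>, by the inequality for small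
  cubes, and the transfer for the exponent \<open>s * p\<close> leads back to \<open>w\<close>.\<close>

lemma large_cube_reverse_hoelder:
  fixes A :: real
  assumes A: "1 \<le> A"
  obtains \<epsilon>0 C where "0 < \<epsilon>0" "\<epsilon>0 \<le> 1" "1 \<le> C"
    "\<And>a l w s. 1 < l \<Longrightarrow> pos_weight w \<Longrightarrow> modl p (hcube a l) w < \<infinity> \<Longrightarrow>
      cube_ainf p A (hcube a l) w \<Longrightarrow> 1 \<le> s \<Longrightarrow> s \<le> 1 + \<epsilon>0 \<Longrightarrow>
      modl (\<lambda>x. s * p x) (hcube a l)
        (\<lambda>x. w x / (C * ((1 / l ^ CARD('n)) powr ((1 - 1 / s) / pinf) * vnorm p (hcube a l) w))) \<le> 1"
proof -
  let ?n = "CARD('n)"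
  obtain \<epsilon>s Cs where small: "0 < \<epsilon>s" "\<epsilon>s \<le> 1" "1 \<le> Cs"
    "\<And>a l w s. 0 < l \<Longrightarrow> l \<le> 1 \<Longrightarrow> pos_weight w \<Longrightarrow> modl p (hcube a l) w < \<infinity> \<Longrightarrow>
      cube_ainf p A (hcube a l) w \<Longrightarrow> 1 \<le> s \<Longrightarrow> s \<le> 1 + \<epsilon>s \<Longrightarrow>
      modl (\<lambda>x. s * p x) (hcube a l) (\<lambda>x. w x / vnorm p (hcube a l) w)
        \<le> ennreal (Cs * (1 / l ^ ?n) powr (s - 1))"
    using small_cube_reverse_hoelder[OF A] by blast
  define T1 where "T1 = transfer_const ?n Cinf"
  define T2 where "T2 = transfer_const ?n (2 * Cinf)"
  have T1: "1 \<le> T1" unfolding T1_def by (rule transfer_const_ge_1)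
  define H where "H = T1 * ((2 * A * T1) powr P * 2 ^ ?n)"
  have AT: "1 \<le> 2 * A * T1" using A T1 mult_mono[of 1 "2 * A" 1 T1] by simp
  have H: "1 \<le> H" unfolding H_def
    using T1 ge_one_powr_ge_zero[OF AT, of P] P_ge_1 by (intro mult_ge1_I) auto
  obtain \<epsilon>d Cd where Cd: "0 < \<epsilon>d" "\<epsilon>d \<le> 1" "1 \<le> Cd"
    "\<And>\<epsilon>. 0 \<le> \<epsilon> \<Longrightarrow> \<epsilon> \<le> \<epsilon>d \<Longrightarrow> 2 powr \<epsilon> + Cd * (2 * 2 ^ ?n) powr \<epsilon> * (1 - 1 / H) \<le> Cd"
    using reverse_hoelder_constants[of "1 - 1 / H" ?n] H by (auto simp: field_simps)
  define C4 where "C4 = Cs * 2 ^ ?n"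
  have C4: "1 \<le> C4" unfolding C4_def using small(3) by (intro mult_ge1_I) auto
  define C3 where "C3 = 2 ^ ?n * (Cd * T1 ^ 2)"
  have C3: "1 \<le> C3" unfolding C3_def using Cd(3) T1 by (intro mult_ge1_I) auto
  have T2: "1 \<le> T2"
  proof -
    interpret t: decaying_exponent "\<lambda>x. 1 * p x" "1 * P" "1 * pinf" "2 * Cinf" by (rule scaled_exponent) auto
    show ?thesis unfolding T2_def by (rule t.transfer_const_ge_1)
  qed
  have "modl (\<lambda>x. s * p x) (hcube a l)
        (\<lambda>x. w x / (T2 * (C3 * C4) * ((1 / l ^ ?n) powr ((1 - 1 / s) / pinf) * vnorm p (hcube a l) w))) \<le> 1"
    if l1: "1 < l" and w: "pos_weight w" and fin: "modl p (hcube a l) w < \<infinity>"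
      and ainf: "cube_ainf p A (hcube a l) w" and s: "1 \<le> s" "s \<le> 1 + min \<epsilon>s \<epsilon>d" for a l w s
  proof -
    define Q where "Q = hcube a l"
    define V where "V = vnorm p Q w"
    have l: "0 < l" using l1 by simp
    have Qc: "cell a l 0 a = Q" unfolding Q_def by (rule cell_0[OF l])
    have Q: "Q \<in> sets lebesgue" "modl p Q w < \<infinity>" unfolding Q_def using fin by auto
    obtain K :: nat where unit: "1 / 2 \<le> l / 2 ^ K" "l / 2 ^ K \<le> 1"
      using exists_unit_generation[OF l1] by blast
    let ?R = "cell a l K"
    have Rs: "?R x \<in> sets lebesgue" for x using l by simp
    have QK: "cell_union a l K Q" unfolding Qc[symmetric] by (rule cell_union_cell) simp
    have RQ: "?R x \<subseteq> Q" if "x \<in> Q" for x using QK that by (auto simp: cell_union_def)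
    have finS: "modl p S w < \<infinity>" if "S \<subseteq> Q" for S
      using modl_set_mono[OF that, of p w] Q(2) by simp
    have m_pos: "0 < emeasure lebesgue (cell a l k x)" for k x
      unfolding emeasure_cell[OF l] using l by simp
    have V: "0 < V" unfolding V_def
      by (rule vnorm_pos[OF w Q]) (use m_pos[of 0 a] in \<open>simp add: Qc del: emeasure_completion\<close>)
    define v where "v x = vnorm p (?R x) w" for x
    have v_step: "v y = v x" if "y \<in> ?R x" for x y unfolding v_def using cell_eq[OF that] by simp
    have v_meas: "v \<in> borel_measurable lebesgue" using v_step by (rule cell_step_measurable[OF l])
    have w_meas: "w \<in> borel_measurable lebesgue" using w pos_weightD by blast
    note [measurable] = v_meas w_meas Q(1)
    have v_pos: "0 < v x" if "x \<in> Q" for x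
      unfolding v_def by (rule vnorm_pos[OF w Rs finS[OF RQ[OF that]] m_pos])
    have v_modl: "modl p (?R x) (\<lambda>y. w y / v x) = 1" if "x \<in> Q" for x
      using modl_vnorm[OF w Rs finS[OF RQ[OF that]]] v_pos[OF that] unfolding v_def by blast
    define \<nu> where "\<nu> = density lebesgue (\<lambda>x. ennreal (v x powr pinf))"
    have \<nu>: "emeasure \<nu> S = (\<integral>\<^sup>+x\<in>S. ennreal (v x powr pinf) \<partial>lebesgue)" if "S \<in> sets lebesgue" for S
      unfolding \<nu>_def using that by (intro emeasure_density) auto
    have \<nu>_sets: "sets \<nu> = sets lebesgue" by (simp add: \<nu>_def)
    have \<nu>_R: "emeasure \<nu> (?R x) = ennreal (v x powr pinf * (l / 2 ^ K) ^ ?n)" for x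
    proof -
      have "emeasure \<nu> (?R x) = (\<integral>\<^sup>+y\<in>?R x. ennreal (v x powr pinf) \<partial>lebesgue)"
        unfolding \<nu>[OF Rs] using v_step by (intro nn_integral_cong) (auto simp: indicator_def)
      also have "\<dots> = ennreal (v x powr pinf) * emeasure lebesgue (?R x)" using Rs by (rule nn_integral_cmult_indicator)
      finally show ?thesis unfolding emeasure_cell[OF l] using l by (simp add: ennreal_mult)
    qed
    \<comment> \<open>the masses \<open>\<nu> S\<close> and the norms over \<open>S\<close> are comparable\<close>
    have \<nu>_le: "emeasure \<nu> S \<le> ennreal (T1 * vnorm p S w powr pinf)"
      if "S \<subseteq> Q" "cell_union a l K S" "0 < vnorm p S w" for S
    proof -
      have "modl p S (\<lambda>x. w x / vnorm p S w) \<le> 1"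
        using modl_vnorm[OF w cell_union_sets[OF l that(2)] finS[OF that(1)] that(3)] by simp
      then show ?thesis
        using cells_le_norm[OF l unit w that(2) finS[OF that(1)] that(3)] \<nu>[OF cell_union_sets[OF l that(2)]]
        unfolding T1_def v_def by simp
    qed
    have fin\<nu>: "emeasure \<nu> Q < \<infinity>"
      using \<nu>_le[OF order_refl QK] V by (auto simp: V_def intro: order_le_less_trans)
    have norm_le: "vnorm p S w \<le> T1 * T"
      if "S \<subseteq> Q" "cell_union a l K S" "0 < T" "2 ^ ?n * emeasure \<nu> S \<le> ennreal (T powr pinf)" for S T
    proof -
      have S: "S \<in> sets lebesgue" using cell_union_sets[OF l that(2)] .
      note [measurable] = S
      have "(\<integral>\<^sup>+x\<in>S. ennreal (2 ^ ?n * v x powr pinf) \<partial>lebesgue) = 2 ^ ?n * (\<integral>\<^sup>+x\<in>S. ennreal (v x powr pinf) \<partial>lebesgue)"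
        by (subst nn_integral_cmult[symmetric]) (auto simp: ennreal_mult ennreal_power[symmetric] mult.assoc)
      also have "\<dots> \<le> ennreal (T powr pinf)" using that(4) \<nu>[OF S] by simp
      finally have "modl p S (\<lambda>x. w x / T) \<le> ennreal T1"
        unfolding T1_def using that v_pos v_modl v_step
        by (intro modl_le_of_cells[OF l unit w that(2), where c = v]) auto
      then have "modl p S (\<lambda>x. w x / (T1 * T)) \<le> 1"
        by (intro modl_divide_le_one w S that T1)
      then show ?thesis using that T1 by (intro vnorm_le) auto
    qed
    have key: "emeasure \<nu> E \<le> ennreal (1 - 1 / H) * emeasure \<nu> (cell a l k x)"
      if k: "k \<le> K" and x: "x \<in> cell a l 0 a" and E: "E \<subseteq> cell a l k x" "cell_union a l K E"
        and half: "2 * emeasure lebesgue E \<le> emeasure lebesgue (cell a l k x)" for k x E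
    proof -
      define m where "m = l / 2 ^ k"
      have m: "0 < m" using l by (simp add: m_def)
      obtain b where b: "cell a l k x = hcube b m" unfolding m_def using cell_eq_hcube[OF l] by blast
      define D where "D = hcube b m"
      define F where "F = D - E"
      have DK: "cell_union a l K D" unfolding D_def b[symmetric] using k by (rule cell_union_cell)
      have D: "D \<in> sets lebesgue" "D \<subseteq> Q" "E \<subseteq> D" "E \<in> sets lebesgue"
        unfolding D_def b[symmetric] Qc[symmetric]
        using cell_subset[OF x, of k] E cell_union_sets[OF l E(2)] l by auto
      have FK: "cell_union a l K F" unfolding F_def using DK E(2) by (rule cell_union_Diff)
      have F: "F \<in> sets lebesgue" "F \<subseteq> D" "F \<subseteq> Q" using D by (auto simp: F_def)
      have mF: "m ^ ?n / 2 \<le> measure lebesgue F"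
        using measure_complement_half[OF less_imp_le[OF m] D(4), of b] half D(3) unfolding b F_def D_def by simp
      have mn: "0 < m ^ ?n" using m by simp
      have "measure lebesgue F \<noteq> 0" using mF mn by linarith
      then have F0: "emeasure lebesgue F \<noteq> 0" by (auto simp: measure_def simp del: emeasure_completion)
      then have f: "0 < vnorm p F w"
        by (intro vnorm_pos[OF w F(1)]) (use F finS in \<open>auto simp: zero_less_iff_neq_zero simp del: emeasure_completion\<close>)
      have vD: "0 < vnorm p D w"
        by (rule vnorm_pos[OF w D(1) finS[OF D(2)]]) (use m_pos[of k x] in \<open>simp add: D_def b del: emeasure_completion\<close>)
      have "m ^ ?n / 2 * vnorm p D w \<le> measure lebesgue F * vnorm p D w"
        using mF vD by (intro mult_right_mono) auto
      also have "\<dots> \<le> A * m ^ ?n * vnorm p F w"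
        using ainf m D F unfolding cube_ainf_def D_def Q_def by blast
      finally have "m ^ ?n * vnorm p D w \<le> m ^ ?n * (2 * A * vnorm p F w)" by (simp add: mult_ac)
      then have vf: "vnorm p D w \<le> 2 * A * vnorm p F w" using mn by simp
      \<comment> \<open>the mass of \<open>F\<close> is positive, as the number \<open>T\<close> built from it below has to be\<close>
      obtain y where y: "y \<in> F" using F0 by (cases "F = {}") auto
      have "emeasure \<nu> (?R y) \<noteq> 0" unfolding \<nu>_R using v_pos[of y] y F l by auto
      moreover have "emeasure \<nu> (?R y) \<le> emeasure \<nu> F"
        using FK y F \<nu>_sets by (intro emeasure_mono) (auto simp: cell_union_def)
      ultimately have \<nu>F0: "emeasure \<nu> F \<noteq> 0" by auto
      have \<nu>fin: "emeasure \<nu> S < \<infinity>" if "S \<subseteq> Q" for S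
        using emeasure_mono[OF that, of \<nu>] fin\<nu> \<nu>_sets Q by simp
      obtain r where r: "emeasure \<nu> F = ennreal r" "0 \<le> r" using \<nu>fin[OF F(3)] by (cases "emeasure \<nu> F") auto
      have r0: "0 < r" using \<nu>F0 r by (cases "r = 0") auto
      define T where "T = (2 ^ ?n * r) powr (1 / pinf)"
      have T: "0 < T" "T powr pinf = 2 ^ ?n * r" using r0 pinf_ge_1 by (auto simp: T_def powr_powr)
      have "vnorm p F w \<le> T1 * T"
        by (rule norm_le[OF F(3) FK T(1)]) (use T r in \<open>simp add: ennreal_mult ennreal_power[symmetric]\<close>)
      then have "2 * A * vnorm p F w \<le> 2 * A * (T1 * T)" using A by (intro mult_left_mono) auto
      then have "vnorm p D w \<le> (2 * A * T1) * T" using vf by simp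
      then have "vnorm p D w powr pinf \<le> ((2 * A * T1) * T) powr pinf"
        using vD pinf_ge_1 by (intro powr_mono2) auto
      also have "\<dots> = (2 * A * T1) powr pinf * (2 ^ ?n * r)" using T AT by (simp add: powr_mult)
      also have "\<dots> \<le> (2 * A * T1) powr P * (2 ^ ?n * r)"
        using AT pinf_le_P r by (intro mult_right_mono powr_mono) auto
      finally have "T1 * vnorm p D w powr pinf \<le> H * r"
        unfolding H_def using T1 mult_left_mono[of "vnorm p D w powr pinf" _ T1] by (simp add: mult_ac)
      then have "emeasure \<nu> D \<le> ennreal (H * r)"
        using \<nu>_le[OF D(2) DK vD] by (meson ennreal_leI order_trans)
      then have "emeasure \<nu> D \<le> ennreal H * emeasure \<nu> (D - E)"
        unfolding F_def[symmetric] r using H r by (simp add: ennreal_mult)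
      then show ?thesis unfolding b D_def[symmetric]
        using D H \<nu>fin[OF D(2)] \<nu>_sets by (intro emeasure_le_of_complement) auto
    qed
    have avg_K: "cell_avg \<nu> a l K y = v y powr pinf" for y
      using \<nu>_R[of y] l by (simp add: cell_avg_def measure_def)
    obtain N0 where N0: "emeasure \<nu> Q = ennreal N0" "0 \<le> N0" using fin\<nu> by (cases "emeasure \<nu> Q") auto
    have N0_le: "N0 \<le> T1 * V powr pinf"
      using \<nu>_le[OF order_refl QK] V N0 T1 unfolding V_def by (simp add: ennreal_le_iff)
    have avg_0: "cell_avg \<nu> a l 0 a = N0 / l ^ ?n"
      using N0 Qc by (simp add: cell_avg_def measure_def)
    have s2: "s \<le> 2" using s small(2) by simp
    have "(\<integral>\<^sup>+y\<in>Q. ennreal (v y powr (s * pinf)) \<partial>lebesgue)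
      = (\<integral>\<^sup>+y\<in>Q. ennreal ((v y powr pinf) powr (s - 1)) \<partial>\<nu>)"
    proof -
      have "(\<integral>\<^sup>+y\<in>Q. ennreal ((v y powr pinf) powr (s - 1)) \<partial>\<nu>)
        = (\<integral>\<^sup>+y. ennreal (v y powr pinf) * (ennreal ((v y powr pinf) powr (s - 1)) * indicator Q y) \<partial>lebesgue)"
        unfolding \<nu>_def by (rule nn_integral_density) measurable
      also have "\<dots> = (\<integral>\<^sup>+y\<in>Q. ennreal (v y powr (s * pinf)) \<partial>lebesgue)"
        by (intro nn_integral_cong)
          (auto simp: indicator_def powr_powr ennreal_mult[symmetric] powr_add[symmetric] algebra_simps)
      finally show ?thesis by simp
    qed
    also have "\<dots> \<le> (\<integral>\<^sup>+y\<in>cell a l 0 a. ennreal (max_avg \<nu> a l 0 K y powr (s - 1)) \<partial>\<nu>)"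
      unfolding Qc
    proof (rule nn_integral_mono)
      fix y
      have "v y powr pinf \<le> max_avg \<nu> a l 0 K y"
        using cell_avg_le_max_avg[of 0 K K \<nu> a l y] unfolding avg_K by simp
      then have "(v y powr pinf) powr (s - 1) \<le> max_avg \<nu> a l 0 K y powr (s - 1)"
        using s by (intro powr_mono2) auto
      then show "ennreal ((v y powr pinf) powr (s - 1)) * indicator Q y
        \<le> ennreal (max_avg \<nu> a l 0 K y powr (s - 1)) * indicator Q y"
        by (intro mult_right_mono ennreal_leI) auto
    qed
    also have "\<dots> \<le> ennreal (Cd * cell_avg \<nu> a l 0 a powr (s - 1)) * emeasure \<nu> (cell a l 0 a)"
    proof (rule dyadic_reverse_hoelder[OF l \<nu>_sets, where ?x0.0 = a and \<alpha> = "1 - 1 / H"])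
      show "emeasure \<nu> (cell a l 0 a) < \<infinity>" unfolding Qc by (rule fin\<nu>)
      show "0 \<le> 1 - 1 / H" using H by simp
      show "2 powr (s - 1) + Cd * (2 * 2 ^ ?n) powr (s - 1) * (1 - 1 / H) \<le> Cd"
        using Cd(4)[of "s - 1"] s by simp
      show "emeasure \<nu> E \<le> ennreal (1 - 1 / H) * emeasure \<nu> (cell a l k x)"
        if "k \<le> K" "x \<in> cell a l 0 a" "E \<subseteq> cell a l k x" "cell_union a l K E"
          "2 * emeasure lebesgue E \<le> emeasure lebesgue (cell a l k x)" for k x E
        using that by (rule key)
    qed (use s Cd in auto)
    also have "\<dots> = ennreal (Cd * (N0 / l ^ ?n) powr (s - 1) * N0)"
      unfolding avg_0 Qc N0 using N0 Cd by (simp add: ennreal_mult[symmetric])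
    also have "\<dots> \<le> ennreal (Cd * T1 ^ 2 * ((1 / l ^ ?n) powr (s - 1) * V powr (s * pinf)))"
    proof (rule ennreal_leI)
      let ?X = "T1 * V powr pinf"
      have "(N0 / l ^ ?n) powr (s - 1) * N0 \<le> (?X / l ^ ?n) powr (s - 1) * ?X"
        using N0 N0_le l s T1 by (intro mult_mono powr_mono2 divide_right_mono) auto
      also have "\<dots> = (1 / l ^ ?n) powr (s - 1) * (?X powr (s - 1) * ?X powr 1)"
        using T1 V l by (simp add: powr_divide)
      also have "?X powr (s - 1) * ?X powr 1 = ?X powr s" by (subst powr_add[symmetric]) simp
      also have "\<dots> = T1 powr s * V powr (s * pinf)"
        using T1 by (simp add: powr_mult powr_powr mult.commute)
      also have "T1 powr s \<le> T1 powr 2" using s2 T1 by (intro powr_mono) auto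
      also have "T1 powr 2 = T1 ^ 2" using T1 by (simp add: powr_numeral)
      finally have "(N0 / l ^ ?n) powr (s - 1) * N0 \<le> (1 / l ^ ?n) powr (s - 1) * (T1 ^ 2 * V powr (s * pinf))"
        by (simp add: mult_left_mono mult_right_mono)
      then have "Cd * ((N0 / l ^ ?n) powr (s - 1) * N0) \<le> Cd * ((1 / l ^ ?n) powr (s - 1) * (T1 ^ 2 * V powr (s * pinf)))"
        using Cd by (intro mult_left_mono) auto
      then show "Cd * (N0 / l ^ ?n) powr (s - 1) * N0 \<le> Cd * T1 ^ 2 * ((1 / l ^ ?n) powr (s - 1) * V powr (s * pinf))"
        by (simp only: mult_ac)
    qed
    finally have v_int: "(\<integral>\<^sup>+y\<in>Q. ennreal (v y powr (s * pinf)) \<partial>lebesgue)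
      \<le> ennreal (Cd * T1 ^ 2 * ((1 / l ^ ?n) powr (s - 1) * V powr (s * pinf)))" .
    interpret sp: decaying_exponent "\<lambda>x. s * p x" "s * P" "s * pinf" "2 * Cinf"
      using s(1) s2 by (rule scaled_exponent)
    have v_sp: "modl (\<lambda>x. s * p x) (?R x) (\<lambda>y. w y / (C4 * v x)) \<le> 1" if x: "x \<in> Q" for x
    proof (rule sp.modl_divide_le_one[OF w Rs v_pos[OF x] _ C4])
      obtain b where b: "?R x = hcube b (l / 2 ^ K)" using cell_eq_hcube[OF l] by blast
      have "modl (\<lambda>x. s * p x) (hcube b (l / 2 ^ K)) (\<lambda>y. w y / vnorm p (hcube b (l / 2 ^ K)) w)
        \<le> ennreal (Cs * (1 / (l / 2 ^ K) ^ ?n) powr (s - 1))"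
      proof (rule small(4)[OF _ unit(2) w])
        show "modl p (hcube b (l / 2 ^ K)) w < \<infinity>" using finS[OF RQ[OF x]] b by simp
        show "cube_ainf p A (hcube b (l / 2 ^ K)) w"
          using cube_ainf_subset[OF ainf] RQ[OF x] b by (simp add: Q_def)
      qed (use s l in auto)
      also have "\<dots> \<le> ennreal C4"
        unfolding C4_def
      proof (intro ennreal_leI mult_left_mono)
        have "(1 / 2 :: real) ^ ?n \<le> (l / 2 ^ K) ^ ?n" using unit by (intro power_mono) auto
        then have *: "1 / (l / 2 ^ K) ^ ?n \<le> 2 ^ ?n" using l by (simp add: power_divide field_simps)
        have "1 / (l / 2 ^ K) ^ ?n \<ge> 1" using unit l by (simp add: power_le_one)
        then have "(1 / (l / 2 ^ K) ^ ?n) powr (s - 1) \<le> (1 / (l / 2 ^ K) ^ ?n) powr 1"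
          using s2 by (intro powr_mono) auto
        also have "\<dots> \<le> 2 ^ ?n" using * l by simp
        finally show "(1 / (l / 2 ^ K) ^ ?n) powr (s - 1) \<le> 2 ^ ?n" .
      qed (use small in auto)
      finally show "modl (\<lambda>x. s * p x) (?R x) (\<lambda>y. w y / v x) \<le> ennreal C4" unfolding v_def b .
    qed
    define T where "T = C3 * C4 * ((1 / l ^ ?n) powr ((1 - 1 / s) / pinf) * V)"
    have T: "0 < T" unfolding T_def using C3 C4 V l by simp
    have "modl (\<lambda>x. s * p x) Q (\<lambda>x. w x / T) \<le> ennreal T2"
      unfolding T2_def
    proof (rule sp.modl_le_of_cells[OF l unit w QK _ _ v_sp T])
      show "C4 * v y = C4 * v x" if "y \<in> ?R x" for x y using v_step[OF that] by simp
      show "0 < C4 * v x" if "x \<in> Q" for x using v_pos[OF that] C4 by simp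
      have "(\<integral>\<^sup>+x\<in>Q. ennreal (2 ^ ?n * (C4 * v x) powr (s * pinf)) \<partial>lebesgue)
        = (\<integral>\<^sup>+x. ennreal (2 ^ ?n * C4 powr (s * pinf)) * (ennreal (v x powr (s * pinf)) * indicator Q x) \<partial>lebesgue)"
      proof (rule nn_integral_cong)
        fix x
        have "2 ^ ?n * (C4 * v x) powr (s * pinf) = 2 ^ ?n * C4 powr (s * pinf) * v x powr (s * pinf)"
          by (simp add: powr_mult)
        then show "ennreal (2 ^ ?n * (C4 * v x) powr (s * pinf)) * indicator Q x
          = ennreal (2 ^ ?n * C4 powr (s * pinf)) * (ennreal (v x powr (s * pinf)) * indicator Q x)"
          by (simp add: ennreal_mult mult.assoc)
      qed
      also have "\<dots> = ennreal (2 ^ ?n * C4 powr (s * pinf)) * (\<integral>\<^sup>+x\<in>Q. ennreal (v x powr (s * pinf)) \<partial>lebesgue)"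
        by (rule nn_integral_cmult) measurable
      also have "\<dots> \<le> ennreal (2 ^ ?n * C4 powr (s * pinf)) * ennreal (Cd * T1 ^ 2 * ((1 / l ^ ?n) powr (s - 1) * V powr (s * pinf)))"
        using v_int by (rule mult_left_mono) simp
      also have "\<dots> = ennreal (C3 * (C4 powr (s * pinf) * ((1 / l ^ ?n) powr (s - 1) * V powr (s * pinf))))"
        unfolding C3_def using Cd T1 by (subst ennreal_mult[symmetric]) (auto simp: mult_ac)
      also have "\<dots> \<le> ennreal (T powr (s * pinf))"
      proof (rule ennreal_leI)
        have sp1: "1 \<le> s * pinf" by (rule sp.pinf_ge_1)
        have "(1 - 1 / s) / pinf * (s * pinf) = s - 1" using s pinf_ge_1 by (simp add: field_simps)
        then have "T powr (s * pinf) = C3 powr (s * pinf) * (C4 powr (s * pinf) * ((1 / l ^ ?n) powr (s - 1) * V powr (s * pinf)))"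
          unfolding T_def by (simp add: powr_mult powr_powr mult.assoc)
        moreover have "C3 powr 1 \<le> C3 powr (s * pinf)" using C3 sp1 by (intro powr_mono) auto
        ultimately show "C3 * (C4 powr (s * pinf) * ((1 / l ^ ?n) powr (s - 1) * V powr (s * pinf))) \<le> T powr (s * pinf)"
          using C3 by (auto intro!: mult_right_mono)
      qed
      finally show "(\<integral>\<^sup>+x\<in>Q. ennreal (2 ^ ?n * (C4 * v x) powr (s * pinf)) \<partial>lebesgue) \<le> ennreal (T powr (s * pinf))" .
    qed
    then have "modl (\<lambda>x. s * p x) Q (\<lambda>x. w x / (T2 * T)) \<le> 1"
      by (intro sp.modl_divide_le_one[OF w Q(1) T _ T2])
    then show ?thesis unfolding T_def V_def Q_def by (simp only: mult.assoc)
  qed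
  moreover have "1 \<le> T2 * (C3 * C4)" using T2 C3 C4 by (intro mult_ge1_I) auto
  ultimately show ?thesis using that[of "min \<epsilon>s \<epsilon>d" "T2 * (C3 * C4)"] small(1,2) Cd(1) by auto
qed

text \<open>The reverse Hoelder inequality in a form that does not distinguish small and large cubes: if \<open>b\<close> is the
  norm of the indicator function with exponent \<open>p\<close>, its norm with exponent \<open>s * p\<close> is \<open>b powr (1 / s)\<close>, so the
  factor \<open>b powr (1 - 1 / s)\<close> is the one with which constants give equality up to \<open>C\<close>. Small cubes have
  \<open>b powr p y\<close> comparable to the volume for every \<open>y\<close> in the cube; large cubes have \<open>b powr pinf\<close> comparable to it.\<close>

lemma reverse_hoelder:
  fixes A :: real
  assumes A: "1 \<le> A"
  obtains \<epsilon>0 C where "0 < \<epsilon>0" "\<epsilon>0 \<le> 1" "1 \<le> C"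
    "\<And>a l w s. 0 < l \<Longrightarrow> pos_weight w \<Longrightarrow> modl p (hcube a l) w < \<infinity> \<Longrightarrow>
      cube_ainf p A (hcube a l) w \<Longrightarrow> 1 \<le> s \<Longrightarrow> s \<le> 1 + \<epsilon>0 \<Longrightarrow>
      modl (\<lambda>x. s * p x) (hcube a l)
        (\<lambda>x. vnorm p (hcube a l) (\<lambda>_. 1) powr (1 - 1 / s) * w x / (C * vnorm p (hcube a l) w)) \<le> 1"
proof -
  let ?n = "CARD('n)"
  obtain \<epsilon>s Cs where small: "0 < \<epsilon>s" "\<epsilon>s \<le> 1" "1 \<le> Cs"
    "\<And>a l w s. 0 < l \<Longrightarrow> l \<le> 1 \<Longrightarrow> pos_weight w \<Longrightarrow> modl p (hcube a l) w < \<infinity> \<Longrightarrow>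
      cube_ainf p A (hcube a l) w \<Longrightarrow> 1 \<le> s \<Longrightarrow> s \<le> 1 + \<epsilon>s \<Longrightarrow>
      modl (\<lambda>x. s * p x) (hcube a l) (\<lambda>x. w x / vnorm p (hcube a l) w)
        \<le> ennreal (Cs * (1 / l ^ ?n) powr (s - 1))"
    using small_cube_reverse_hoelder[OF A] by blast
  obtain \<epsilon>l Cl where large: "0 < \<epsilon>l" "\<epsilon>l \<le> 1" "1 \<le> Cl"
    "\<And>a l w s. 1 < l \<Longrightarrow> pos_weight w \<Longrightarrow> modl p (hcube a l) w < \<infinity> \<Longrightarrow>
      cube_ainf p A (hcube a l) w \<Longrightarrow> 1 \<le> s \<Longrightarrow> s \<le> 1 + \<epsilon>l \<Longrightarrow>
      modl (\<lambda>x. s * p x) (hcube a l)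
        (\<lambda>x. w x / (Cl * ((1 / l ^ ?n) powr ((1 - 1 / s) / pinf) * vnorm p (hcube a l) w))) \<le> 1"
    using large_cube_reverse_hoelder[OF A] by blast
  define T1 where "T1 = transfer_const ?n Cinf"
  have T1: "1 \<le> T1" unfolding T1_def by (rule transfer_const_ge_1)
  define M where "M = L ^ ?n"
  have M: "1 \<le> M" unfolding M_def using L_ge_1 by simp
  define C where "C = max (Cs * M) (Cl * (T1 * 2 ^ ?n))"
  have CsM: "1 \<le> Cs * M" using small M by (intro mult_ge1_I) auto
  then have C1: "1 \<le> C" by (auto simp: C_def)
  have one: "pos_weight (\<lambda>_::real ^ 'n. 1)" by (simp add: pos_weight_def)
  have "modl (\<lambda>x. s * p x) (hcube a l)
        (\<lambda>x. vnorm p (hcube a l) (\<lambda>_. 1) powr (1 - 1 / s) * w x / (C * vnorm p (hcube a l) w)) \<le> 1"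
    if l: "0 < l" and w: "pos_weight w" and fin: "modl p (hcube a l) w < \<infinity>"
      and ainf: "cube_ainf p A (hcube a l) w" and s: "1 \<le> s" "s \<le> 1 + min \<epsilon>s \<epsilon>l" for a l w s
  proof -
    define Q where "Q = hcube a l"
    define V where "V = vnorm p Q w"
    define b where "b = vnorm p Q (\<lambda>_. 1)"
    have Q: "Q \<in> sets lebesgue" "modl p Q w < \<infinity>" unfolding Q_def using fin by auto
    note [measurable] = Q(1) pos_weightD(1)[OF w]
    have ln: "0 < l ^ ?n" using l by simp
    have mQ: "emeasure lebesgue Q = ennreal (l ^ ?n)" unfolding Q_def using l by (intro emeasure_hcube) simp
    have Q_pos: "0 < emeasure lebesgue Q" unfolding mQ using ln by simp
    have modl_one: "modl p Q (\<lambda>_. 1) = ennreal (l ^ ?n)" unfolding modl_def using mQ Q by simp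
    have fin1: "modl p Q (\<lambda>_. 1) < \<infinity>" unfolding modl_one by simp
    have V: "0 < V" unfolding V_def by (rule vnorm_pos[OF w Q Q_pos])
    have b: "0 < b" unfolding b_def by (rule vnorm_pos[OF one Q(1) fin1 Q_pos])
    have s2: "s \<le> 2" using s small(2) by simp
    interpret sp: decaying_exponent "\<lambda>x. s * p x" "s * P" "s * pinf" "2 * Cinf"
      using s(1) s2 by (rule scaled_exponent)
    have s1: "0 \<le> 1 - 1 / s" "1 - 1 / s \<le> 1" using s by (auto simp: field_simps)
    show ?thesis
    proof (cases "l \<le> 1")
      case True
      have l1: "l ^ ?n \<le> 1" using l True by (simp add: power_le_one)
      have b1: "b \<le> 1" unfolding b_def using l1 modl_one by (intro vnorm_le) (auto simp: ennreal_le_1)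
      have modl_b: "modl p Q (\<lambda>_. 1 / b) = 1"
        using modl_vnorm[OF one Q(1) fin1] b unfolding b_def by blast
      \<comment> \<open>as for the norms of the weight, the exponent of \<open>b\<close> is frozen by a lower bound for \<open>b\<close>\<close>
      have bl: "1 / b \<le> (1 / l) ^ ?n"
      proof -
        have "ennreal (1 / b * l ^ ?n) = (\<integral>\<^sup>+x\<in>Q. ennreal (1 / b) \<partial>lebesgue)"
          using b ln unfolding nn_integral_cmult_indicator[OF Q(1)] mQ by (intro ennreal_mult) auto
        also have "\<dots> \<le> modl p Q (\<lambda>_. 1 / b)"
          unfolding modl_def
        proof (rule nn_integral_mono)
          fix x
          have "(1 / b) powr 1 \<le> (1 / b) powr p x" using b b1 p_ge_1[of x] by (intro powr_mono) auto
          then show "ennreal (1 / b) * indicator Q x \<le> ennreal ((1 / b) powr p x) * indicator Q x"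
            using b by (intro mult_right_mono ennreal_leI) auto
        qed
        finally have "1 / b * l ^ ?n \<le> 1" unfolding modl_b by (simp add: ennreal_le_1)
        then show ?thesis using b ln by (simp add: field_simps power_divide)
      qed
      have freeze: "b powr p y \<le> M * b powr p z" if "y \<in> Q" "z \<in> Q" for y z
      proof (rule powr_between[OF b b1])
        let ?d = "\<bar>p y - p z\<bar>"
        have "(1 / b) powr ?d \<le> ((1 / l) ^ ?n) powr ?d" using bl b by (intro powr_mono2) auto
        also have "\<dots> = ((1 / l) powr ?d) ^ ?n"
          using l by (simp add: powr_power powr_realpow[symmetric] powr_powr mult.commute del: power_divide)
        also have "\<dots> \<le> M" unfolding M_def using L[OF l True, of y a z] that by (intro power_mono) (auto simp: Q_def)
        finally show "(1 / b) powr ?d \<le> M" .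
      qed
      have b_le: "b powr p y \<le> M * l ^ ?n" if y: "y \<in> Q" for y
      proof -
        have "modl p Q (\<lambda>_. 1 / b) \<le> (\<integral>\<^sup>+x\<in>Q. ennreal (M / b powr p y) \<partial>lebesgue)"
          unfolding modl_def
        proof (rule nn_integral_mono)
          fix x
          have "(1 / b) powr p x \<le> M / b powr p y" if "x \<in> Q"
            using freeze[OF y that] b by (simp add: powr_divide field_simps)
          then show "ennreal ((1 / b) powr p x) * indicator Q x \<le> ennreal (M / b powr p y) * indicator Q x"
            by (auto simp: indicator_def intro!: ennreal_leI)
        qed
        also have "\<dots> = ennreal (M / b powr p y * l ^ ?n)"
          using M b ln unfolding nn_integral_cmult_indicator[OF Q(1)] mQ by (intro ennreal_mult[symmetric]) auto
        finally have "1 \<le> M / b powr p y * l ^ ?n" unfolding modl_b by simp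
        then show ?thesis using b by (simp add: field_simps)
      qed
      have "modl (\<lambda>x. s * p x) Q (\<lambda>x. b powr (1 - 1 / s) * w x / V)
        \<le> (\<integral>\<^sup>+x. ennreal ((M * l ^ ?n) powr (s - 1)) * (ennreal ((w x / V) powr (s * p x)) * indicator Q x) \<partial>lebesgue)"
        unfolding modl_def
      proof (rule nn_integral_mono)
        fix x
        have "(b powr (1 - 1 / s) * w x / V) powr (s * p x) \<le> (M * l ^ ?n) powr (s - 1) * (w x / V) powr (s * p x)"
          if "x \<in> Q"
        proof -
          have "(1 - 1 / s) * (s * p x) = p x * (s - 1)" using s by (simp add: field_simps)
          then have "(b powr (1 - 1 / s) * (w x / V)) powr (s * p x) = (b powr p x) powr (s - 1) * (w x / V) powr (s * p x)"
            by (simp only: powr_mult powr_powr)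
          also have "\<dots> \<le> (M * l ^ ?n) powr (s - 1) * (w x / V) powr (s * p x)"
            using b_le[OF that] s by (intro mult_right_mono powr_mono2) auto
          finally show ?thesis by (simp only: times_divide_eq_right)
        qed
        then show "ennreal ((b powr (1 - 1 / s) * w x / V) powr (s * p x)) * indicator Q x
          \<le> ennreal ((M * l ^ ?n) powr (s - 1)) * (ennreal ((w x / V) powr (s * p x)) * indicator Q x)"
          by (auto simp: indicator_def ennreal_mult[symmetric] intro!: ennreal_leI)
      qed
      also have "\<dots> = ennreal ((M * l ^ ?n) powr (s - 1)) * modl (\<lambda>x. s * p x) Q (\<lambda>x. w x / V)"
        unfolding modl_def by (rule nn_integral_cmult) measurable
      also have "\<dots> \<le> ennreal ((M * l ^ ?n) powr (s - 1)) * ennreal (Cs * (1 / l ^ ?n) powr (s - 1))"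
        unfolding Q_def V_def using l True w fin ainf s by (intro mult_left_mono small(4)) auto
      also have "\<dots> = ennreal (Cs * M powr (s - 1))"
      proof -
        have "(M * l ^ ?n) powr (s - 1) * (Cs * (1 / l ^ ?n) powr (s - 1)) = Cs * ((M * l ^ ?n) * (1 / l ^ ?n)) powr (s - 1)"
          by (simp only: powr_mult mult_ac)
        also have "(M * l ^ ?n) * (1 / l ^ ?n) = M" using l by simp
        finally show ?thesis using small(3) by (subst ennreal_mult[symmetric]) auto
      qed
      also have "\<dots> \<le> ennreal (Cs * M)"
        using powr_mono[of "s - 1" 1 M] M s2 small(3) by (intro ennreal_leI mult_left_mono) auto
      finally have *: "modl (\<lambda>x. s * p x) Q (\<lambda>x. b powr (1 - 1 / s) * w x / V) \<le> ennreal (Cs * M)" .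
      have bw: "pos_weight (\<lambda>x. b powr (1 - 1 / s) * w x)"
        unfolding pos_weight_def using b pos_weightD(2)[OF w] by (auto intro!: borel_measurable_times pos_weightD(1)[OF w])
      have "modl (\<lambda>x. s * p x) Q (\<lambda>x. b powr (1 - 1 / s) * w x / (C * V)) \<le> 1"
        by (rule sp.modl_divide_le_one[OF bw Q(1) V _ C1]) (rule order_trans[OF * ennreal_leI], simp add: C_def)
      then show ?thesis unfolding b_def V_def Q_def .
    next
      case False
      then have l1: "1 < l" by simp
      have Qc: "cell a l 0 a = Q" unfolding Q_def by (rule cell_0[OF l])
      obtain K :: nat where unit: "1 / 2 \<le> l / 2 ^ K" "l / 2 ^ K \<le> 1"
        using exists_unit_generation[OF l1] by blast
      have QK: "cell_union a l K Q" unfolding Qc[symmetric] by (rule cell_union_cell) simp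
      define T where "T = (2 ^ ?n * l ^ ?n) powr (1 / pinf)"
      have T: "0 < T" unfolding T_def using l by simp
      have "modl p Q (\<lambda>x. 1 / T) \<le> ennreal T1"
        unfolding T1_def
      proof (rule modl_le_of_cells[OF l unit one QK, where c = "\<lambda>_. 1"])
        show "modl p (cell a l K x) (\<lambda>y. 1 / 1) \<le> 1" for x
          using unit_cell_measure(1)[OF l unit, of a x] l unfolding modl_def by (simp del: emeasure_completion)
        have "(\<integral>\<^sup>+x\<in>Q. ennreal (2 ^ ?n * 1 powr pinf) \<partial>lebesgue) = ennreal (2 ^ ?n) * ennreal (l ^ ?n)"
          using Q(1) mQ by (subst nn_integral_cmult_indicator) auto
        also have "\<dots> = ennreal (T powr pinf)"
          unfolding T_def using ln pinf_ge_1 by (simp add: powr_powr ennreal_mult)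
        finally show "(\<integral>\<^sup>+x\<in>Q. ennreal (2 ^ ?n * 1 powr pinf) \<partial>lebesgue) \<le> ennreal (T powr pinf)" by simp
      qed (use T in auto)
      then have "modl p Q (\<lambda>x. 1 / (T1 * T)) \<le> 1"
        by (intro modl_divide_le_one[OF one Q(1) T _ T1])
      then have "b \<le> T1 * T" unfolding b_def using T T1 by (intro vnorm_le) auto
      also have "T = (2 ^ ?n) powr (1 / pinf) * (l ^ ?n) powr (1 / pinf)" unfolding T_def by (rule powr_mult)
      also have "(2 ^ ?n) powr (1 / pinf) \<le> (2 ^ ?n :: real) powr 1"
        using pinf_ge_1 by (intro powr_mono) auto
      finally have "b \<le> (T1 * 2 ^ ?n) * (l ^ ?n) powr (1 / pinf)"
        using T1 by (simp add: mult_left_mono mult_right_mono mult.assoc)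
      then have "b powr (1 - 1 / s) \<le> ((T1 * 2 ^ ?n) * (l ^ ?n) powr (1 / pinf)) powr (1 - 1 / s)"
        using b s1 by (intro powr_mono2) auto
      also have "\<dots> = (T1 * 2 ^ ?n) powr (1 - 1 / s) * (l ^ ?n) powr ((1 - 1 / s) / pinf)"
        unfolding powr_mult powr_powr by simp
      also have "(T1 * 2 ^ ?n) powr (1 - 1 / s) \<le> (T1 * 2 ^ ?n) powr 1"
      proof (rule powr_mono)
        show "1 \<le> T1 * 2 ^ ?n" using T1 by (intro mult_ge1_I) auto
      qed (use s1 in simp)
      finally have b_le: "b powr (1 - 1 / s) \<le> T1 * 2 ^ ?n * (l ^ ?n) powr ((1 - 1 / s) / pinf)"
        using T1 by (simp add: mult_right_mono)
      define X where "X = (l ^ ?n) powr ((1 - 1 / s) / pinf)"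
      have X: "0 < X" unfolding X_def using l by simp
      have X': "(1 / l ^ ?n) powr ((1 - 1 / s) / pinf) = 1 / X" unfolding X_def using l by (simp add: powr_divide)
      have "modl (\<lambda>x. s * p x) Q (\<lambda>x. b powr (1 - 1 / s) * w x / (C * V))
        \<le> modl (\<lambda>x. s * p x) Q (\<lambda>x. w x / (Cl * (1 / X * V)))"
      proof (rule sp.modl_mono)
        fix x
        have w0: "0 \<le> w x" using pos_weightD(3)[OF w] .
        have "b powr (1 - 1 / s) * w x / (C * V) \<le> T1 * 2 ^ ?n * X * w x / (C * V)"
          using b_le w0 C1 V unfolding X_def by (intro divide_right_mono mult_right_mono) auto
        also have "\<dots> \<le> T1 * 2 ^ ?n * X * w x / ((Cl * (T1 * 2 ^ ?n)) * V)"
          using T1 X w0 V large(3) C1 by (intro divide_left_mono mult_right_mono mult_pos_pos) (auto simp: C_def)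
        also have "\<dots> = w x / (Cl * (1 / X * V))" using T1 X by (simp add: field_simps)
        finally show "0 \<le> b powr (1 - 1 / s) * w x / (C * V) \<and> b powr (1 - 1 / s) * w x / (C * V) \<le> w x / (Cl * (1 / X * V))"
          using w0 C1 V by simp
      qed
      also have "\<dots> \<le> 1"
        using large(4)[OF l1 w fin ainf s(1)] s unfolding X' V_def Q_def by simp
      finally show ?thesis unfolding b_def V_def Q_def .
    qed
  qed
  then show ?thesis using that[of "min \<epsilon>s \<epsilon>l" C] small(1,2) large(1) C1 by auto
qed

end


section \<open>Matrices\<close>

lemma op_norm_nonneg: "0 \<le> op_norm A"
  unfolding op_norm_def by (rule onorm_pos_le) (rule matrix_vector_mul_bounded_linear)

lemma op_norm_mult: "op_norm (A ** B) \<le> op_norm A * op_norm B"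
  unfolding op_norm_def
  using onorm_compose[OF matrix_vector_mul_bounded_linear[of A] matrix_vector_mul_bounded_linear[of B]]
  by (simp add: comp_def matrix_vector_mul_assoc)

lemma op_norm_id: "op_norm (mat 1 :: real ^ 'd ^ 'd) = 1"
proof -
  have "(*v) (mat 1) = (\<lambda>x :: real ^ 'd. x)" by auto
  then show ?thesis unfolding op_norm_def using onorm_id[where 'a = "real ^ 'd"] by simp
qed

lemma op_norm_le_add: "op_norm A \<le> op_norm B + op_norm (A - B)" for A :: "real ^ 'd ^ 'd"
proof -
  have "onorm (\<lambda>x. B *v x + (A - B) *v x) \<le> op_norm B + op_norm (A - B)"
    unfolding op_norm_def by (intro onorm_triangle matrix_vector_mul_bounded_linear)
  moreover have "(\<lambda>x. B *v x + (A - B) *v x) = (*v) A"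
    by (auto simp: matrix_vector_mult_diff_rdistrib)
  ultimately show ?thesis by (simp add: op_norm_def)
qed

lemma op_norm_diff_le: "\<bar>op_norm A - op_norm B\<bar> \<le> (\<Sum>i\<in>UNIV. \<Sum>j\<in>UNIV. \<bar>A $ i $ j - B $ i $ j\<bar>)"
  for A B :: "real ^ 'd ^ 'd"
proof -
  have "op_norm (C - D) \<le> (\<Sum>i\<in>UNIV. \<Sum>j\<in>UNIV. \<bar>C $ i $ j - D $ i $ j\<bar>)" for C D :: "real ^ 'd ^ 'd"
    using onorm_le_matrix_component_sum[of "C - D"] by (simp add: op_norm_def)
  from this[of A B] this[of B A] op_norm_le_add[of A B] op_norm_le_add[of B A] show ?thesis
    by (simp add: abs_minus_commute abs_le_iff)
qed

lemma continuous_op_norm: "continuous_on UNIV (op_norm :: real ^ 'd ^ 'd \<Rightarrow> real)"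
  unfolding continuous_on_def
proof
  fix B :: "real ^ 'd ^ 'd"
  have "((\<lambda>A. \<Sum>i\<in>UNIV. \<Sum>j\<in>UNIV. \<bar>A $ i $ j - B $ i $ j\<bar>) \<longlongrightarrow> (\<Sum>i\<in>UNIV. \<Sum>j\<in>UNIV. \<bar>B $ i $ j - B $ i $ j\<bar>)) (at B)"
    by (intro tendsto_intros)
  then have lim: "((\<lambda>A. \<Sum>i\<in>UNIV. \<Sum>j\<in>UNIV. \<bar>A $ i $ j - B $ i $ j\<bar>) \<longlongrightarrow> 0) (at B)" by simp
  have "((\<lambda>A. op_norm A - op_norm B) \<longlongrightarrow> 0) (at B)"
    by (rule Lim_null_comparison[OF always_eventually[OF allI] lim]) (use op_norm_diff_le in simp)
  then show "(op_norm \<longlongrightarrow> op_norm B) (at B within UNIV)"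
    using LIM_zero_iff by blast
qed

lemma continuous_matrix_mult:
  assumes "continuous_on S f" "continuous_on S g"
  shows "continuous_on S (\<lambda>x. f x ** g x :: real ^ 'd ^ 'd)"
  unfolding matrix_matrix_mult_def by (intro continuous_intros assms)

lemma continuous_det:
  assumes "continuous_on S f"
  shows "continuous_on S (\<lambda>x. det (f x :: real ^ 'd ^ 'd))"
  unfolding det_def by (intro continuous_intros assms)

lemma matrix_inv_invertible:
  assumes "invertible (A :: real ^ 'd ^ 'd)"
  shows "A ** matrix_inv A = mat 1" "matrix_inv A ** A = mat 1"
  using someI_ex[OF assms[unfolded invertible_def]] unfolding matrix_inv_def by auto

text \<open>Cramer's rule makes the inverse a quotient of polynomials in the entries, hence continuous.\<close>

lemma matrix_inv_cramer:
  assumes "det (A :: real ^ 'd ^ 'd) \<noteq> 0"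
  shows "matrix_inv A $ k $ j = det (\<chi> i m. if m = k then axis j 1 $ i else A $ i $ m) / det A"
proof -
  have inv: "invertible A" using assms by (simp add: invertible_det_nz)
  have "A *v (matrix_inv A *v axis j 1) = axis j 1"
    by (simp add: matrix_vector_mul_assoc matrix_inv_invertible[OF inv])
  then have "matrix_inv A *v axis j 1 = (\<chi> k. det (\<chi> i m. if m = k then axis j 1 $ i else A $ i $ m) / det A)"
    using cramer[OF assms] by blast
  then have "(matrix_inv A *v axis j 1) $ k = det (\<chi> i m. if m = k then axis j 1 $ i else A $ i $ m) / det A"
    by simp
  then show ?thesis by (simp add: matrix_vector_mult_basis column_def)
qed

lemma continuous_matrix_inv: "continuous_on {A :: real ^ 'd ^ 'd. det A \<noteq> 0} matrix_inv"
proof -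
  have "continuous_on {A :: real ^ 'd ^ 'd. det A \<noteq> 0}
    (\<lambda>A. \<chi> k j. det (\<chi> i m. if m = k then axis j 1 $ i else A $ i $ m) / det A)"
  proof (intro continuous_intros continuous_det)
    fix k j i m
    show "continuous_on {A :: real ^ 'd ^ 'd. det A \<noteq> 0} (\<lambda>A. if m = k then axis j 1 $ i else A $ i $ m)"
      by (cases "m = k") (auto intro!: continuous_intros)
  qed auto
  moreover have "(\<chi> k j. det (\<chi> i m. if m = k then axis j 1 $ i else A $ i $ m) / det A) = matrix_inv A"
    if "det A \<noteq> 0" for A :: "real ^ 'd ^ 'd"
    using matrix_inv_cramer[OF that] by (simp add: vec_eq_iff)
  ultimately show ?thesis by (rule continuous_on_eq) auto
qed

lemma open_invertible: "open {A :: real ^ 'd ^ 'd. det A \<noteq> 0}"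
proof -
  have "open ((\<lambda>A :: real ^ 'd ^ 'd. det A) -` (- {0}))"
    by (intro open_vimage continuous_det continuous_on_id) auto
  then show ?thesis by (simp add: vimage_def)
qed

text \<open>The choice operator gives all singular matrices the same, arbitrary, inverse, so measurability holds on the whole
  space.\<close>

lemma matrix_inv_measurable [measurable]: "(matrix_inv :: real ^ 'd ^ 'd \<Rightarrow> _) \<in> borel_measurable borel"
proof -
  let ?U = "{A :: real ^ 'd ^ 'd. det A \<noteq> 0}"
  have "(\<lambda>A. if A \<in> ?U then matrix_inv A else (SOME B. False)) \<in> borel_measurable borel"
    by (rule borel_measurable_continuous_on_if)
      (use open_invertible continuous_matrix_inv in \<open>auto intro: continuous_on_const borel_open\<close>)
  moreover have "matrix_inv A = (SOME B. False)" if "A \<notin> ?U" for A :: "real ^ 'd ^ 'd"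
  proof -
    have "\<not> invertible A" using that by (simp add: invertible_det_nz)
    then show ?thesis unfolding matrix_inv_def invertible_def by (intro arg_cong[where f = Eps]) auto
  qed
  then have "(\<lambda>A. if A \<in> ?U then matrix_inv A else (SOME B. False)) = matrix_inv" by auto
  ultimately show ?thesis by simp
qed

lemma op_norm_quotient_measurable:
  fixes A :: "real ^ 'd ^ 'd"
  assumes "W \<in> borel_measurable M"
  shows "(\<lambda>y. op_norm (A ** matrix_inv (W y))) \<in> borel_measurable M"
proof -
  have "(\<lambda>B. op_norm (A ** B)) \<in> borel_measurable borel"
    by (intro borel_measurable_continuous_onI continuous_on_compose2[OF continuous_op_norm] continuous_matrix_mult continuous_intros) auto
  from measurable_compose[OF measurable_compose[OF assms matrix_inv_measurable] this] show ?thesis by simp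
qed

lemma pos_def_invertible:
  assumes "pos_def A"
  shows "invertible A"
proof -
  have "inj ((*v) A)"
  proof (rule injI)
    fix x y assume "A *v x = A *v y"
    then have "A *v (x - y) = 0" by (simp add: matrix_vector_mult_diff_distrib)
    then have "(x - y) \<bullet> (A *v (x - y)) = 0" by simp
    then have "x - y = 0" using assms unfolding pos_def_def by (metis less_irrefl)
    then show "x = y" by simp
  qed
  then show ?thesis using invertible_left_inverse matrix_left_invertible_injective by blast
qed

text \<open>The reason why matrices can be replaced by scalar weights.\<close>

lemma op_norm_quotient_submult:
  fixes A B C :: "real ^ 'd ^ 'd"
  assumes "invertible B"
  shows "op_norm (A ** matrix_inv C) \<le> op_norm (A ** matrix_inv B) * op_norm (B ** matrix_inv C)"
proof -
  have "A ** matrix_inv C = A ** (matrix_inv B ** B) ** matrix_inv C"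
    by (simp add: matrix_inv_invertible[OF assms])
  then have "A ** matrix_inv C = (A ** matrix_inv B) ** (B ** matrix_inv C)"
    by (simp only: matrix_mul_assoc)
  then show ?thesis using op_norm_mult by metis
qed

lemma op_norm_quotient_pos:
  fixes A B :: "real ^ 'd ^ 'd"
  assumes "invertible A" "invertible B"
  shows "0 < op_norm (A ** matrix_inv B)"
proof -
  have "1 \<le> op_norm (A ** matrix_inv B) * op_norm (B ** matrix_inv A)"
    using op_norm_quotient_submult[OF assms(2), of A A] by (simp add: matrix_inv_invertible[OF assms(1)] op_norm_id)
  then have "op_norm (A ** matrix_inv B) \<noteq> 0" by auto
  then show ?thesis using op_norm_nonneg[of "A ** matrix_inv B"] by simp
qed

section \<open>Variable exponent norms with conjugate exponents\<close>

lemma esssup_restrict_empty: "esssup (restrict_space M {}) (f :: 'a \<Rightarrow> ennreal) = 0"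
proof -
  have "esssup (restrict_space M {}) f \<le> 0"
    by (intro esssup_I) (auto intro: AE_I2 simp: measurable_def space_restrict_space)
  then show ?thesis by auto
qed

lemma modular_real_exponent:
  "modular (\<lambda>x. ereal (q x)) f = (\<integral>\<^sup>+x. ennreal_powr (f x) (q x) \<partial>lebesgue)"
proof -
  have "{x. ereal (q x) = \<infinity>} = {}" by auto
  then show ?thesis unfolding modular_def by (simp add: esssup_restrict_empty)
qed

lemma ennreal_powr_mono: "a \<le> b \<Longrightarrow> 0 \<le> r \<Longrightarrow> ennreal_powr a r \<le> ennreal_powr b r"
proof -
  assume *: "a \<le> b" "0 \<le> r"
  show ?thesis
  proof (cases "b = \<infinity>")
    case False
    then have "a \<noteq> \<infinity>" using * by (auto simp: top_unique)
    moreover have "enn2real a \<le> enn2real b" using * False by (intro enn2real_mono) (auto simp: less_top)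
    ultimately show ?thesis using False * by (auto simp: ennreal_powr_def intro!: ennreal_leI powr_mono2)
  qed (auto simp: ennreal_powr_def)
qed

lemma ennreal_powr_ennreal: "0 \<le> a \<Longrightarrow> ennreal_powr (ennreal a) r = ennreal (a powr r)"
  by (simp add: ennreal_powr_def)

lemma modular_mono:
  assumes "f \<in> borel_measurable lebesgue \<or> (\<forall>x. q x \<noteq> \<infinity>)" "\<And>x. f x \<le> g x" "\<And>x. 0 \<le> q x"
  shows "modular q f \<le> modular q g"
  unfolding modular_def
proof (rule add_mono)
  show "(\<integral>\<^sup>+x\<in>- {x. q x = \<infinity>}. ennreal_powr (f x) (real_of_ereal (q x)) \<partial>lebesgue)
    \<le> (\<integral>\<^sup>+x\<in>- {x. q x = \<infinity>}. ennreal_powr (g x) (real_of_ereal (q x)) \<partial>lebesgue)"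
    using assms by (intro nn_integral_mono mult_right_mono ennreal_powr_mono real_of_ereal_pos) auto
  show "esssup (restrict_space lebesgue {x. q x = \<infinity>}) f \<le> esssup (restrict_space lebesgue {x. q x = \<infinity>}) g"
  proof (cases "f \<in> borel_measurable lebesgue")
    case True
    then show ?thesis using assms(2) by (intro esssup_mono measurable_restrict_space1)
  next
    case False
    then have "{x. q x = \<infinity>} = {}" using assms by auto
    then show ?thesis by (simp only: esssup_restrict_empty)
  qed
qed

lemma ennreal_divide_antimono: "0 < c \<Longrightarrow> c \<le> d \<Longrightarrow> a / ennreal d \<le> a / ennreal c"
  by (auto simp: divide_ennreal_def inverse_ennreal intro!: mult_left_mono ennreal_leI le_imp_inverse_le)

lemma modular_le_one_of_Lp_norm_less:
  assumes "f \<in> borel_measurable lebesgue \<or> (\<forall>x. q x \<noteq> \<infinity>)" "\<And>x. 0 \<le> q x"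
    and less: "Lp_norm q f < ennreal c"
  shows "modular q (\<lambda>x. f x / ennreal c) \<le> 1"
proof -
  obtain c' where c': "0 < c'" "modular q (\<lambda>x. f x / ennreal c') \<le> 1" "ennreal c' < ennreal c"
    using less unfolding Lp_norm_def Inf_less_iff by blast
  then have "c' < c" by (simp add: ennreal_less_iff)
  have "modular q (\<lambda>x. f x / ennreal c) \<le> modular q (\<lambda>x. f x / ennreal c')"
  proof (rule modular_mono)
    show "(\<lambda>x. f x / ennreal c) \<in> borel_measurable lebesgue \<or> (\<forall>x. q x \<noteq> \<infinity>)"
      using assms(1) by auto
  qed (use c' \<open>c' < c\<close> assms(2) in \<open>auto intro: ennreal_divide_antimono\<close>)
  then show ?thesis using c' by simp
qed

lemma Lp_norm_leI: "0 < c \<Longrightarrow> modular q (\<lambda>x. f x / ennreal c) \<le> 1 \<Longrightarrow> Lp_norm q f \<le> ennreal c"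
  unfolding Lp_norm_def by (rule Inf_lower) auto

lemma ennreal_cancel_factor:
  assumes "0 < c" "0 < d"
  shows "ennreal c * a / ennreal (c * d) = a / ennreal d"
proof (cases a)
  case (real r)
  then show ?thesis using assms
    by (simp add: divide_ennreal ennreal_mult[symmetric])
next
  case top
  then show ?thesis using assms by (simp add: ennreal_mult_top ennreal_top_divide)
qed

lemma Lp_norm_le_cmult:
  assumes f: "f \<in> borel_measurable lebesgue" and g: "g \<in> borel_measurable lebesgue" and c: "0 < c"
    and le: "\<And>x. f x \<le> ennreal c * g x" and q: "\<And>x. 0 \<le> q x"
  shows "Lp_norm q f \<le> ennreal c * Lp_norm q g"
proof (cases "Lp_norm q g = \<infinity>")
  case True
  then show ?thesis using c by (simp add: ennreal_mult_top)
next
  case False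
  then obtain r where r: "Lp_norm q g = ennreal r" "0 \<le> r" by (cases "Lp_norm q g") auto
  have "Lp_norm q f \<le> ennreal (c * r) + ennreal e" if e: "0 < e" for e
  proof -
    have "Lp_norm q g < ennreal (r + e / c)" using r c e by (simp add: ennreal_less_iff)
    then have 1: "modular q (\<lambda>x. g x / ennreal (r + e / c)) \<le> 1"
      using g q by (intro modular_le_one_of_Lp_norm_less) auto
    have pos: "0 < r + e / c" using r c e by (simp add: add_nonneg_pos)
    have "modular q (\<lambda>x. f x / ennreal (c * (r + e / c))) \<le> modular q (\<lambda>x. g x / ennreal (r + e / c))"
    proof (rule modular_mono)
      fix x
      have "f x / ennreal (c * (r + e / c)) \<le> ennreal c * g x / ennreal (c * (r + e / c))"
        using le by (intro divide_right_mono_ennreal)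
      also have "\<dots> = g x / ennreal (r + e / c)"
        using c pos by (rule ennreal_cancel_factor)
      finally show "f x / ennreal (c * (r + e / c)) \<le> g x / ennreal (r + e / c)" .
    qed (use f q in auto)
    then have "Lp_norm q f \<le> ennreal (c * (r + e / c))" using 1 c pos by (intro Lp_norm_leI) auto
    also have "c * (r + e / c) = c * r + e" using c by (simp add: field_simps)
    finally show ?thesis using c r e by (subst ennreal_plus[symmetric]) auto
  qed
  then have "Lp_norm q f \<le> ennreal (c * r)" by (rule ennreal_le_epsilon)
  then show ?thesis using r c by (simp add: ennreal_mult)
qed

lemma conj_exponent_real:
  assumes "1 \<le> p x"
  shows "conj_exponent (\<lambda>x. ereal (p x)) x = (if p x = 1 then \<infinity> else ereal (p x / (p x - 1)))"
proof -
  have "1 - inverse (p x) = (p x - 1) / p x" using assms by (simp add: field_simps)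
  then show ?thesis using assms
    by (auto simp: conj_exponent_def one_ereal_def simp del: ereal_eq_1)
qed

lemma conj_exponent_nonneg:
  assumes "1 \<le> p x"
  shows "0 \<le> conj_exponent (\<lambda>x. ereal (p x)) x"
  using assms by (simp add: conj_exponent_real[of p x, OF assms])

text \<open>A crude form of Young's inequality for \<open>1 / q = 1 / \<alpha> + 1 / \<beta>\<close>: the left-hand side is at most the larger of the
  two terms on the right.\<close>

lemma mult_powr_le_add:
  fixes a t :: real
  assumes "0 \<le> a" "0 \<le> t" "0 < q" "0 < \<alpha>" "0 < \<beta>" and eq: "q * (\<alpha> + \<beta>) = \<alpha> * \<beta>"
  shows "(a * t) powr q \<le> a powr \<alpha> + t powr \<beta>"
proof -
  have *: "(a * t) powr q \<le> a powr \<alpha>"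
    if "0 \<le> a" "0 \<le> t" "0 < \<alpha>" "0 < \<beta>" "q * (\<alpha> + \<beta>) = \<alpha> * \<beta>" "t powr \<beta> \<le> a powr \<alpha>" for a t \<alpha> \<beta> :: real
  proof -
    have "t = (t powr \<beta>) powr (1 / \<beta>)" using that by (simp add: powr_powr)
    also have "\<dots> \<le> (a powr \<alpha>) powr (1 / \<beta>)" using that by (intro powr_mono2) auto
    finally have "t \<le> a powr (\<alpha> / \<beta>)" by (simp add: powr_powr)
    then have "(a * t) powr q \<le> (a * a powr (\<alpha> / \<beta>)) powr q"
      using that assms(3) by (intro powr_mono2 mult_left_mono) auto
    also have "a * a powr (\<alpha> / \<beta>) = a powr (1 + \<alpha> / \<beta>)" using that by (cases "a = 0") (auto simp: powr_add)
    also have "(a powr (1 + \<alpha> / \<beta>)) powr q = a powr \<alpha>"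
    proof -
      have "(1 + \<alpha> / \<beta>) * q = \<alpha>" using that by (simp add: field_simps)
      then show ?thesis by (simp add: powr_powr)
    qed
    finally show ?thesis .
  qed
  show ?thesis
  proof (cases "t powr \<beta> \<le> a powr \<alpha>")
    case True
    then show ?thesis using *[of a t \<alpha> \<beta>] assms by (simp add: add_increasing2)
  next
    case False
    then have "(t * a) powr q \<le> t powr \<beta>" using *[of t a \<beta> \<alpha>] assms by (simp add: algebra_simps)
    then show ?thesis by (simp add: mult.commute add_increasing)
  qed
qed


context bounded_exponent
begin

text \<open>The conjugate exponent is infinite where \<open>p = 1\<close>. The function \<open>\<Phi>\<close> and the almost everywhere bound are all
  that the two applications of Young's inequality below need to know about the conjugate modular.\<close>

lemma conj_modular_majorant:
  fixes k :: "real ^ 'n \<Rightarrow> real"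
  assumes k: "k \<in> borel_measurable lebesgue" "\<And>y. 0 \<le> k y" and Q: "Q \<in> sets lebesgue" and c: "0 < c"
    and le: "modular (conj_exponent (\<lambda>x. ereal (p x))) (\<lambda>y. ennreal (k y) * indicator Q y / ennreal c) \<le> 1"
  obtains \<Phi> where "\<Phi> \<in> borel_measurable lebesgue" "(\<integral>\<^sup>+y. \<Phi> y \<partial>lebesgue) \<le> 1"
    "AE y in lebesgue. y \<in> Q \<longrightarrow> p y = 1 \<longrightarrow> k y / c \<le> 1"
    "\<And>y. y \<in> Q \<Longrightarrow> p y \<noteq> 1 \<Longrightarrow> \<Phi> y = ennreal ((k y / c) powr (p y / (p y - 1)))"
proof -
  let ?q = "conj_exponent (\<lambda>x. ereal (p x))"
  let ?f = "\<lambda>y. ennreal (k y) * indicator Q y / ennreal c"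
  note [measurable] = k(1) Q
  have q: "?q y = (if p y = 1 then \<infinity> else ereal (p y / (p y - 1)))" for y
    using conj_exponent_real[of p y] p_ge_1 by blast
  have Om: "{y. ?q y = \<infinity>} = {y. p y = 1}" by (auto simp: q)
  define \<Phi> where "\<Phi> y = ennreal ((k y / c) powr (p y / (p y - 1))) * indicator (Q \<inter> {y \<in> space lebesgue. p y \<noteq> 1}) y" for y
  have f_eq: "?f y = ennreal (k y / c)" if "y \<in> Q" for y
    using that k(2) c by (simp add: divide_ennreal)
  have \<Phi>_meas: "\<Phi> \<in> borel_measurable lebesgue" unfolding \<Phi>_def by measurable
  have parts: "(\<integral>\<^sup>+y\<in>- {y. p y = 1}. ennreal_powr (?f y) (real_of_ereal (?q y)) \<partial>lebesgue) \<le> 1"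
    "esssup (restrict_space lebesgue {y. p y = 1}) ?f \<le> 1"
    using le unfolding modular_def Om by (auto intro: order_trans[rotated])
  have "(\<integral>\<^sup>+y. \<Phi> y \<partial>lebesgue) \<le> (\<integral>\<^sup>+y\<in>- {y. p y = 1}. ennreal_powr (?f y) (real_of_ereal (?q y)) \<partial>lebesgue)"
  proof (rule nn_integral_mono)
    fix y
    show "\<Phi> y \<le> ennreal_powr (?f y) (real_of_ereal (?q y)) * indicator (- {y. p y = 1}) y"
      using f_eq[of y] k(2)[of y] c by (auto simp: \<Phi>_def indicator_def q ennreal_powr_ennreal)
  qed
  then have \<Phi>_le: "(\<integral>\<^sup>+y. \<Phi> y \<partial>lebesgue) \<le> 1" using parts(1) by (rule order_trans)
  have "{y \<in> space lebesgue. p y = 1} \<in> sets lebesgue" by measurable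
  then have O_sets: "{y. p y = 1} \<in> sets lebesgue" by simp
  have "AE y in restrict_space lebesgue {y. p y = 1}. ?f y \<le> 1"
    using esssup_AE[of ?f "restrict_space lebesgue {y. p y = 1}"]
    by eventually_elim (use parts(2) in \<open>auto intro: order_trans\<close>)
  then have "AE y in lebesgue. y \<in> {y. p y = 1} \<longrightarrow> ?f y \<le> 1"
    using O_sets by (subst (asm) AE_restrict_space_iff) auto
  then have "AE y in lebesgue. y \<in> Q \<longrightarrow> p y = 1 \<longrightarrow> k y / c \<le> 1"
    by eventually_elim (use f_eq k(2) c in \<open>auto simp: ennreal_le_1\<close>)
  moreover have "\<Phi> y = ennreal ((k y / c) powr (p y / (p y - 1)))" if "y \<in> Q" "p y \<noteq> 1" for y
    using that by (simp add: \<Phi>_def)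
  ultimately show ?thesis using that \<Phi>_meas \<Phi>_le by blast
qed

text \<open>Hoelder's inequality with the constant \<open>2\<close>: by Young's inequality the integrand, divided by
  \<open>c * b\<close>, is bounded by the sum of two densities of mass at most \<open>1\<close>.\<close>

lemma conj_hoelder:
  fixes k f :: "real ^ 'n \<Rightarrow> real"
  assumes k: "k \<in> borel_measurable lebesgue" "\<And>y. 0 \<le> k y" and Q: "Q \<in> sets lebesgue" and c: "0 < c"
    and le: "modular (conj_exponent (\<lambda>x. ereal (p x))) (\<lambda>y. ennreal (k y) * indicator Q y / ennreal c) \<le> 1"
    and E: "E \<in> sets lebesgue" "E \<subseteq> Q" and f: "f \<in> borel_measurable lebesgue" "\<And>y. 0 \<le> f y"
    and b: "0 < b" "modl p E (\<lambda>y. f y / b) \<le> 1"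
  shows "(\<integral>\<^sup>+y\<in>E. ennreal (k y * f y) \<partial>lebesgue) \<le> ennreal (2 * c * b)"
proof -
  obtain \<Phi> where \<Phi>: "\<Phi> \<in> borel_measurable lebesgue" "(\<integral>\<^sup>+y. \<Phi> y \<partial>lebesgue) \<le> 1"
    "AE y in lebesgue. y \<in> Q \<longrightarrow> p y = 1 \<longrightarrow> k y / c \<le> 1"
    "\<And>y. y \<in> Q \<Longrightarrow> p y \<noteq> 1 \<Longrightarrow> \<Phi> y = ennreal ((k y / c) powr (p y / (p y - 1)))"
    using conj_modular_majorant[OF k Q c le] by blast
  note [measurable] = E(1) f(1) \<Phi>(1)
  have "(\<integral>\<^sup>+y\<in>E. ennreal (k y * f y) \<partial>lebesgue)
    \<le> (\<integral>\<^sup>+y. ennreal (c * b) * (\<Phi> y + ennreal ((f y / b) powr p y) * indicator E y) \<partial>lebesgue)"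
  proof (rule nn_integral_mono_AE)
    show "AE y in lebesgue. ennreal (k y * f y) * indicator E y
      \<le> ennreal (c * b) * (\<Phi> y + ennreal ((f y / b) powr p y) * indicator E y)"
      using \<Phi>(3)
    proof eventually_elim
      case (elim y)
      show ?case
      proof (cases "y \<in> E")
        case True
        have "ennreal (k y / c * (f y / b)) \<le> \<Phi> y + ennreal ((f y / b) powr p y)"
        proof (cases "p y = 1")
          case p1: True
          then have "k y / c * (f y / b) \<le> 1 * (f y / b)"
            using elim True E f b by (intro mult_right_mono) auto
          then have "ennreal (k y / c * (f y / b)) \<le> ennreal ((f y / b) powr p y)"
            using p1 f b by (intro ennreal_leI) simp
          then show ?thesis by (rule order_trans) simp
        next
          case False
          then have p: "1 < p y" using p_ge_1[of y] by simp
          have "(k y / c * (f y / b)) powr 1 \<le> (k y / c) powr (p y / (p y - 1)) + (f y / b) powr p y"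
            using p k c f b by (intro mult_powr_le_add) (auto simp: field_simps)
          then have "k y / c * (f y / b) \<le> (k y / c) powr (p y / (p y - 1)) + (f y / b) powr p y"
            using k(2)[of y] c f(2)[of y] b by simp
          then have "ennreal (k y / c * (f y / b)) \<le> ennreal ((k y / c) powr (p y / (p y - 1))) + ennreal ((f y / b) powr p y)"
            by (subst ennreal_plus[symmetric]) (simp_all add: ennreal_leI del: ennreal_plus)
          then show ?thesis using \<Phi>(4)[of y] True E False by auto
        qed
        then have "ennreal (c * b) * ennreal (k y / c * (f y / b)) \<le> ennreal (c * b) * (\<Phi> y + ennreal ((f y / b) powr p y))"
          by (rule mult_left_mono) simp
        moreover have "ennreal (c * b) * ennreal (k y / c * (f y / b)) = ennreal (k y * f y)"
          using c b k(2)[of y] f(2)[of y] by (subst ennreal_mult[symmetric]) auto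
        ultimately show ?thesis using True by simp
      qed simp
    qed
  qed
  also have "\<dots> = ennreal (c * b) * ((\<integral>\<^sup>+y. \<Phi> y \<partial>lebesgue) + modl p E (\<lambda>y. f y / b))"
    unfolding modl_def by (subst nn_integral_cmult, measurable, subst nn_integral_add, measurable)
  also have "\<dots> \<le> ennreal (c * b) * (1 + 1)"
    using \<Phi>(2) b(2) by (intro mult_left_mono add_mono) auto
  also have "\<dots> = ennreal (2 * c * b)"
  proof -
    have "(1 + 1 :: ennreal) = ennreal 2" by (simp add: one_add_one ennreal_numeral[symmetric] del: ennreal_numeral)
    then show ?thesis using c b by (simp only:) (subst ennreal_mult[symmetric], auto simp: mult_ac)
  qed
  finally show ?thesis .
qed

text \<open>Hoelder's inequality for the reciprocals \<open>1 - 1 / (s * p)\<close>, \<open>1 - 1 / p\<close> and \<open>(1 - 1 / s) / p\<close>, the latter two adding up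
  to the first. The second factor is the norm of an indicator function, bounded by a power of \<open>b\<close>.\<close>

lemma conj_norm_scaled_le:
  fixes k :: "real ^ 'n \<Rightarrow> real"
  assumes k: "k \<in> borel_measurable lebesgue" "\<And>y. 0 \<le> k y" and Q: "Q \<in> sets lebesgue"
    and b: "0 < b" "modl p Q (\<lambda>y. 1 / b) \<le> 1" and s: "1 \<le> s"
  shows "Lp_norm (conj_exponent (\<lambda>x. ereal (s * p x))) (\<lambda>y. ennreal (k y) * indicator Q y)
    \<le> ennreal (2 * b powr (1 - 1 / s)) * Lp_norm (conj_exponent (\<lambda>x. ereal (p x))) (\<lambda>y. ennreal (k y) * indicator Q y)"
proof (cases "s = 1")
  case True
  have "1 \<le> ennreal (2 * b powr 0)" using b by simp
  from mult_right_mono[OF this, of "Lp_norm (conj_exponent (\<lambda>x. ereal (p x))) (\<lambda>y. ennreal (k y) * indicator Q y)"]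
  show ?thesis using True by simp
next
  case False
  then have s1: "1 < s" using s by simp
  let ?N = "Lp_norm (conj_exponent (\<lambda>x. ereal (p x))) (\<lambda>y. ennreal (k y) * indicator Q y)"
  let ?\<theta> = "1 - 1 / s"
  define B where "B = 2 * b powr ?\<theta>"
  have B: "0 < B" using b by (simp add: B_def)
  note [measurable] = k(1) Q
  define q where "q y = s * p y / (s * p y - 1)" for y
  have sp: "1 < s * p y" for y
    using mult_left_mono[of 1 "p y" s] p_ge_1[of y] s1 by (intro less_le_trans[OF s1]) simp
  have conj: "conj_exponent (\<lambda>x. ereal (s * p x)) = (\<lambda>y. ereal (q y))"
  proof
    fix y
    show "conj_exponent (\<lambda>x. ereal (s * p x)) y = ereal (q y)"
      using conj_exponent_real[of "\<lambda>x. s * p x" y] sp[of y] by (auto simp: q_def)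
  qed
  have q1: "1 \<le> q y" for y using sp[of y] by (simp add: q_def field_simps)
  have main: "modular (conj_exponent (\<lambda>x. ereal (s * p x))) (\<lambda>y. ennreal (k y) * indicator Q y / ennreal (B * c)) \<le> 1"
    if c: "0 < c" and le: "modular (conj_exponent (\<lambda>x. ereal (p x))) (\<lambda>y. ennreal (k y) * indicator Q y / ennreal c) \<le> 1" for c
  proof -
    obtain \<Phi> where \<Phi>: "\<Phi> \<in> borel_measurable lebesgue" "(\<integral>\<^sup>+y. \<Phi> y \<partial>lebesgue) \<le> 1"
      "AE y in lebesgue. y \<in> Q \<longrightarrow> p y = 1 \<longrightarrow> k y / c \<le> 1"
      "\<And>y. y \<in> Q \<Longrightarrow> p y \<noteq> 1 \<Longrightarrow> \<Phi> y = ennreal ((k y / c) powr (p y / (p y - 1)))"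
      using conj_modular_majorant[OF k Q c le] by blast
    note [measurable] = \<Phi>(1)
    define t where "t = (1 / b) powr ?\<theta>"
    have t: "0 \<le> t" "t = 1 / b powr ?\<theta>" using b by (auto simp: t_def powr_divide)
    have "(\<integral>\<^sup>+y. ennreal_powr (ennreal (k y) * indicator Q y / ennreal (B * c)) (q y) \<partial>lebesgue)
      \<le> (\<integral>\<^sup>+y. ennreal (1 / 2) * (\<Phi> y + ennreal ((1 / b) powr p y) * indicator Q y) \<partial>lebesgue)"
    proof (rule nn_integral_mono_AE)
      show "AE y in lebesgue. ennreal_powr (ennreal (k y) * indicator Q y / ennreal (B * c)) (q y)
        \<le> ennreal (1 / 2) * (\<Phi> y + ennreal ((1 / b) powr p y) * indicator Q y)"
        using \<Phi>(3)
      proof eventually_elim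
        case (elim y)
        show ?case
        proof (cases "y \<in> Q")
          case True
          have k0: "0 \<le> k y / c" using k(2)[of y] c by simp
          have tb: "t powr (s * p y / (s - 1)) = (1 / b) powr p y"
          proof -
            have "?\<theta> * (s * p y / (s - 1)) = p y" using s1 by (simp add: field_simps)
            then show ?thesis unfolding t_def powr_powr by (simp only:)
          qed
          have le: "ennreal ((k y / c * t) powr q y) \<le> \<Phi> y + ennreal ((1 / b) powr p y)"
          proof (cases "p y = 1")
            case p1: True
            have "(k y / c * t) powr q y \<le> (1 * t) powr q y"
            proof (rule powr_mono2)
              show "0 \<le> k y / c * t" using k0 t(1) by (rule mult_nonneg_nonneg)
              show "k y / c * t \<le> 1 * t" using elim True p1 t(1) by (intro mult_right_mono) auto
            qed (use q1[of y] in simp)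
            also have "\<dots> = (1 / b) powr p y" using tb p1 by (simp add: q_def)
            finally have "ennreal ((k y / c * t) powr q y) \<le> ennreal ((1 / b) powr p y)" by (rule ennreal_leI)
            then show ?thesis by (rule order_trans) simp
          next
            case False
            then have p: "1 < p y" using p_ge_1[of y] by simp
            have "(k y / c * t) powr q y \<le> (k y / c) powr (p y / (p y - 1)) + t powr (s * p y / (s - 1))"
            proof (rule mult_powr_le_add[OF k0 t(1)])
              have "p y - 1 \<noteq> 0" "s - 1 \<noteq> 0" "s * p y - 1 \<noteq> 0" using p s1 sp[of y] by auto
              moreover have "p y / (p y - 1) + s * p y / (s - 1) = p y * (s * p y - 1) / ((p y - 1) * (s - 1))"
                using calculation by (simp add: field_simps)
              ultimately show "q y * (p y / (p y - 1) + s * p y / (s - 1)) = p y / (p y - 1) * (s * p y / (s - 1))"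
                by (simp add: q_def)
            qed (use p s1 q1[of y] in auto)
            then have "ennreal ((k y / c * t) powr q y) \<le> ennreal ((k y / c) powr (p y / (p y - 1))) + ennreal ((1 / b) powr p y)"
              unfolding tb by (subst ennreal_plus[symmetric]) (simp_all add: ennreal_leI del: ennreal_plus)
            then show ?thesis using \<Phi>(4)[of y] True False by auto
          qed
          have "k y / (B * c) = 1 / 2 * (k y / c * t)"
            using t(2) unfolding B_def by simp
          then have "(k y / (B * c)) powr q y = (1 / 2) powr q y * (k y / c * t) powr q y"
            by (simp only: powr_mult)
          also have "\<dots> \<le> (1 / 2) powr 1 * (k y / c * t) powr q y"
            using q1[of y] by (intro mult_right_mono powr_mono') auto
          finally have "ennreal ((k y / (B * c)) powr q y) \<le> ennreal (1 / 2 * (k y / c * t) powr q y)"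
            by (intro ennreal_leI) simp
          also have "\<dots> = ennreal (1 / 2) * ennreal ((k y / c * t) powr q y)" by (rule ennreal_mult) auto
          also have "\<dots> \<le> ennreal (1 / 2) * (\<Phi> y + ennreal ((1 / b) powr p y))"
            using le by (rule mult_left_mono) simp
          finally show ?thesis using True k(2)[of y] B c
            by (simp add: divide_ennreal ennreal_powr_ennreal del: ennreal_half)
        next
          case False
          then show ?thesis using q1[of y] ennreal_powr_ennreal[of 0 "q y"] by simp
        qed
      qed
    qed
    also have "\<dots> = ennreal (1 / 2) * ((\<integral>\<^sup>+y. \<Phi> y \<partial>lebesgue) + modl p Q (\<lambda>y. 1 / b))"
      unfolding modl_def by (subst nn_integral_cmult, measurable, subst nn_integral_add, measurable)
    also have "\<dots> \<le> ennreal (1 / 2) * (1 + 1)"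
      using \<Phi>(2) b(2) by (intro mult_left_mono add_mono) auto
    also have "\<dots> = 1"
    proof -
      have "(1 + 1 :: ennreal) = ennreal 2" by (simp add: one_add_one ennreal_numeral[symmetric] del: ennreal_numeral)
      then show ?thesis by (simp only:) (subst ennreal_mult[symmetric], auto)
    qed
    finally show ?thesis unfolding conj modular_real_exponent .
  qed
  show ?thesis
  proof (cases "?N = \<infinity>")
    case True
    then show ?thesis using B by (simp add: B_def ennreal_mult_top)
  next
    case False
    then obtain r where r: "?N = ennreal r" "0 \<le> r" by (cases ?N) auto
    have "Lp_norm (conj_exponent (\<lambda>x. ereal (s * p x))) (\<lambda>y. ennreal (k y) * indicator Q y) \<le> ennreal (B * r) + ennreal e"
      if e: "0 < e" for e
    proof -
      have pos: "0 < r + e / B" using r B e by (simp add: add_nonneg_pos)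
      have "?N < ennreal (r + e / B)" using r B e by (simp add: ennreal_less_iff)
      then have "modular (conj_exponent (\<lambda>x. ereal (p x))) (\<lambda>y. ennreal (k y) * indicator Q y / ennreal (r + e / B)) \<le> 1"
        by (intro modular_le_one_of_Lp_norm_less) (auto intro: conj_exponent_nonneg p_ge_1)
      from Lp_norm_leI[OF _ main[OF pos this]]
      have "Lp_norm (conj_exponent (\<lambda>x. ereal (s * p x))) (\<lambda>y. ennreal (k y) * indicator Q y) \<le> ennreal (B * (r + e / B))"
        using B pos by simp
      also have "B * (r + e / B) = B * r + e" using B by (simp add: field_simps)
      also have "ennreal (B * r + e) = ennreal (B * r) + ennreal e" using B r e by (intro ennreal_plus) auto
      finally show ?thesis .
    qed
    then have "Lp_norm (conj_exponent (\<lambda>x. ereal (s * p x))) (\<lambda>y. ennreal (k y) * indicator Q y) \<le> ennreal (B * r)"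
      by (rule ennreal_le_epsilon)
    also have "\<dots> = ennreal B * ?N" using r B by (simp add: ennreal_mult)
    finally show ?thesis unfolding B_def .
  qed
qed

end


section \<open>Log-Hoelder exponents\<close>

text \<open>A cube of side \<open>l\<close> has diameter at most \<open>n * l\<close>. If this is below \<open>1 / 2\<close> the continuity hypothesis applies;
  otherwise \<open>1 / l\<close> is bounded.\<close>

lemma local_log_holder_bound:
  fixes p :: "real ^ 'n \<Rightarrow> real"
  assumes lh: "\<And>x y. norm (x - y) < 1 / 2 \<Longrightarrow> \<bar>p x - p y\<bar> \<le> C0 / (- ln (norm (x - y)))"
    and osc: "\<And>x y. \<bar>p x - p y\<bar> \<le> P" and P: "0 \<le> P" and C0: "0 \<le> C0"
    and l: "0 < l" "l \<le> 1" and xy: "x \<in> hcube a l" "y \<in> hcube a l"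
  shows "(1 / l) powr \<bar>p x - p y\<bar> \<le> max (exp (C0 + P * ln CARD('n))) ((2 * CARD('n)) powr P)"
proof -
  let ?n = "real CARD('n)" and ?d = "\<bar>p x - p y\<bar>"
  have n: "1 \<le> ?n" by (simp add: Suc_leI)
  show ?thesis
  proof (cases "?n * l < 1 / 2")
    case True
    have r: "norm (x - y) \<le> ?n * l" using norm_less_of_hcube[OF xy] by simp
    have nl: "0 < ?n * l" using l by simp
    have neg: "ln (?n * l) < 0" using True nl by (simp add: ln_less_zero)
    have "?d * (- ln (?n * l)) \<le> C0"
    proof (cases "x = y")
      case True
      then show ?thesis using C0 by simp
    next
      case False
      then have r0: "0 < norm (x - y)" by simp
      have "ln (norm (x - y)) \<le> ln (?n * l)" using r r0 nl by (simp only: ln_le_cancel_iff)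
      then have neg': "0 < - ln (norm (x - y))" "- ln (?n * l) \<le> - ln (norm (x - y))" using neg by auto
      have "?d \<le> C0 / (- ln (norm (x - y)))" using r True by (intro lh) simp
      then have "?d * (- ln (norm (x - y))) \<le> C0" using pos_le_divide_eq[OF neg'(1)] by blast
      then show ?thesis using mult_left_mono[OF neg'(2), of ?d] by simp
    qed
    moreover have "ln (1 / l) = - ln (?n * l) + ln ?n" using l n by (simp add: ln_mult ln_div)
    moreover have "?d * ln ?n \<le> P * ln ?n" using osc[of x y] n by (intro mult_right_mono) auto
    ultimately have "?d * ln (1 / l) \<le> C0 + P * ln ?n" by (simp only: distrib_left)
    then have "(1 / l) powr ?d \<le> exp (C0 + P * ln ?n)" using l by (simp add: powr_def)
    then show ?thesis by simp
  next
    case False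
    then have "1 / l \<le> 2 * ?n" using l by (simp add: field_simps)
    then have "(1 / l) powr ?d \<le> (2 * ?n) powr ?d" using l by (intro powr_mono2) auto
    also have "\<dots> \<le> (2 * ?n) powr P" using osc[of x y] n by (intro powr_mono) linarith+
    finally show ?thesis by simp
  qed
qed

text \<open>The decay condition bounds \<open>p\<close> everywhere, as \<open>ln (e + |x|) \<ge> 1\<close>, and puts the limit \<open>u\<close> of \<open>p\<close>
  at infinity into the closure of the range of \<open>p\<close>, so that \<open>u \<ge> 1\<close>.\<close>

lemma exists_log_holder_exponent:
  fixes p :: "real ^ 'n \<Rightarrow> real"
  assumes pm: "p \<in> borel_measurable lebesgue" and p1: "\<And>x. 1 \<le> p x" and lh: "p \<in> log_holder"
  obtains P L pinf Cinf where "log_holder_exponent p P L pinf Cinf"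
proof -
  obtain C0 where C0: "\<And>x y. norm (x - y) < 1 / 2 \<Longrightarrow> \<bar>p x - p y\<bar> \<le> C0 / (- ln (norm (x - y)))"
    using lh unfolding log_holder_def by blast
  obtain C u where C: "\<And>x. \<bar>p x - u\<bar> \<le> C / ln (exp 1 + norm x)"
    using lh unfolding log_holder_def by blast
  have lnge: "1 \<le> ln (exp 1 + norm x)" for x :: "real ^ 'n"
  proof -
    have "ln (exp 1) \<le> ln (exp 1 + norm x)" by (subst ln_le_cancel_iff) (auto intro: add_pos_nonneg)
    then show ?thesis by simp
  qed
  have C_nonneg: "0 \<le> C"
  proof -
    have "0 \<le> C / ln (exp 1 + norm (0 :: real ^ 'n))" using C[of 0] abs_ge_zero order_trans by blast
    then show ?thesis by simp
  qed
  have dev: "\<bar>p x - u\<bar> \<le> C" for x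
  proof -
    have "C / ln (exp 1 + norm x) \<le> C / 1" using C_nonneg lnge[of x] by (intro divide_left_mono) auto
    then show ?thesis using C[of x] by simp
  qed
  have u1: "1 \<le> u"
  proof (rule ccontr)
    assume "\<not> 1 \<le> u"
    then have d: "0 < 1 - u" by simp
    \<comment> \<open>at distance \<open>R\<close> from the origin \<open>p\<close> is closer to \<open>u\<close> than \<open>1 - u\<close>\<close>
    define R where "R = exp (C / (1 - u) + 1)"
    obtain i :: 'n where True by simp
    define x :: "real ^ 'n" where "x = R *\<^sub>R axis i 1"
    have nx: "norm x = R" by (simp add: x_def R_def)
    have "ln R < ln (exp 1 + norm x)"
      unfolding nx by (subst ln_less_cancel_iff) (auto simp: R_def intro: add_pos_pos)
    then have "C / (1 - u) + 1 < ln (exp 1 + norm x)" by (simp add: R_def)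
    moreover have "1 - u \<le> C / ln (exp 1 + norm x)" using C[of x] p1[of x] by simp
    then have "(1 - u) * ln (exp 1 + norm x) \<le> C" using lnge[of x] by (simp add: field_simps)
    then have "ln (exp 1 + norm x) \<le> C / (1 - u)" using d by (simp add: field_simps)
    ultimately show False by simp
  qed
  define P where "P = u + C"
  have pP: "p x \<le> P" for x using dev[of x] by (simp add: P_def)
  have "\<bar>p x - p y\<bar> \<le> P" for x y using p1[of x] p1[of y] pP[of x] pP[of y] by simp
  note osc = this
  have C0': "norm (x - y) < 1 / 2 \<Longrightarrow> \<bar>p x - p y\<bar> \<le> \<bar>C0\<bar> / (- ln (norm (x - y)))" for x y
  proof -
    assume r: "norm (x - y) < 1 / 2"
    have "C0 / (- ln (norm (x - y))) \<le> \<bar>C0\<bar> / (- ln (norm (x - y)))"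
    proof (cases "x = y")
      case False
      then have "ln (norm (x - y)) < 0" using r by (intro ln_less_zero) auto
      then show ?thesis by (intro divide_right_mono) auto
    qed simp
    then show ?thesis using C0[OF r] by simp
  qed
  have "log_holder_exponent p P (max (exp (\<bar>C0\<bar> + P * ln CARD('n))) ((2 * CARD('n)) powr P)) u C"
  proof
    show "p \<in> borel_measurable lebesgue" by (rule pm)
    show "(1 / l) powr \<bar>p x - p y\<bar> \<le> max (exp (\<bar>C0\<bar> + P * ln CARD('n))) ((2 * CARD('n)) powr P)"
      if "0 < l" "l \<le> 1" "x \<in> hcube a l" "y \<in> hcube a l" for a l x y
      using local_log_holder_bound[OF C0' osc _ _ that] u1 C_nonneg by (simp add: P_def)
  qed (use p1 pP C u1 C_nonneg in \<open>auto simp: P_def\<close>)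
  then show ?thesis by (rule that)
qed

section \<open>The matrix weight\<close>

text \<open>Interchanging \<open>M\<close> and \<open>N\<close> squeezes \<open>\<Gamma> M\<close> between two continuous functions of \<open>M\<close> that agree at \<open>N\<close>. This
  makes norms in one variable measurable functions of the other.\<close>

lemma continuous_of_quotient_bound:
  fixes \<Gamma> :: "real ^ 'd ^ 'd \<Rightarrow> real"
  assumes le: "\<And>M N. det M \<noteq> 0 \<Longrightarrow> det N \<noteq> 0 \<Longrightarrow> \<Gamma> M \<le> op_norm (M ** matrix_inv N) * \<Gamma> N"
  shows "continuous_on {M. det M \<noteq> 0} \<Gamma>"
  unfolding continuous_on_def
proof
  let ?U = "{M :: real ^ 'd ^ 'd. det M \<noteq> 0}"
  fix N :: "real ^ 'd ^ 'd" assume N: "N \<in> ?U"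
  have inv: "invertible M" if "M \<in> ?U" for M :: "real ^ 'd ^ 'd" using that by (simp add: invertible_det_nz)
  have NN: "op_norm (N ** matrix_inv N) = 1"
    using matrix_inv_invertible[OF inv[OF N]] by (simp add: op_norm_id)
  have pos: "op_norm (N ** matrix_inv M) > 0" if "M \<in> ?U" for M
    using op_norm_quotient_pos inv N that by blast
  have ev: "\<forall>\<^sub>F M in at N within ?U. M \<in> ?U" by (simp add: eventually_at_filter)
  have up: "continuous_on ?U (\<lambda>M. op_norm (M ** matrix_inv N) * \<Gamma> N)"
    by (intro continuous_intros continuous_on_compose2[OF continuous_op_norm] continuous_matrix_mult) auto
  have low: "continuous_on ?U (\<lambda>M. \<Gamma> N / op_norm (N ** matrix_inv M))"
    by (intro continuous_intros continuous_on_compose2[OF continuous_op_norm] continuous_matrix_mult continuous_matrix_inv)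
      (use pos in force)+
  show "(\<Gamma> \<longlongrightarrow> \<Gamma> N) (at N within ?U)"
  proof (rule tendsto_sandwich)
    show "\<forall>\<^sub>F M in at N within ?U. \<Gamma> N / op_norm (N ** matrix_inv M) \<le> \<Gamma> M"
      using ev by eventually_elim (use le N pos in \<open>simp add: pos_divide_le_eq mult.commute\<close>)
    show "\<forall>\<^sub>F M in at N within ?U. \<Gamma> M \<le> op_norm (M ** matrix_inv N) * \<Gamma> N"
      using ev by eventually_elim (use le N in auto)
    show "((\<lambda>M. \<Gamma> N / op_norm (N ** matrix_inv M)) \<longlongrightarrow> \<Gamma> N) (at N within ?U)"
      using low N NN unfolding continuous_on_def by fastforce
    show "((\<lambda>M. op_norm (M ** matrix_inv N) * \<Gamma> N) \<longlongrightarrow> \<Gamma> N) (at N within ?U)"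
      using up N NN unfolding continuous_on_def by fastforce
  qed
qed

lemma Lp_norm_cube_le_A_const:
  fixes a :: "real ^ 'n"
  assumes l: "0 < l" and fin: "A_const p W < \<infinity>"
  shows "Lp_norm p (\<lambda>x. Lp_norm (conj_exponent p)
      (\<lambda>y. ennreal (op_norm (W x ** matrix_inv (W y))) * indicator (cbox a (a + vec l)) y) * indicator (cbox a (a + vec l)) x)
    \<le> ennreal (enn2real (A_const p W) * l ^ CARD('n))" (is "?N \<le> _")
proof -
  let ?Q = "cbox a (a + vec l)"
  have ln: "0 < l ^ CARD('n)" using l by simp
  have Q: "?Q \<in> cubes" unfolding cubes_def using l by auto
  have mQ: "emeasure lebesgue ?Q = ennreal (l ^ CARD('n))" using l by (intro emeasure_cube) simp
  have "inverse (emeasure lebesgue ?Q) * ?N \<le> A_const p W"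
    unfolding A_const_def by (rule SUP_upper2[OF Q]) simp
  then have "ennreal (l ^ CARD('n)) * (ennreal (inverse (l ^ CARD('n))) * ?N) \<le> ennreal (l ^ CARD('n)) * A_const p W"
    unfolding mQ using ln by (intro mult_left_mono) (auto simp: inverse_ennreal)
  also have "ennreal (l ^ CARD('n)) * (ennreal (inverse (l ^ CARD('n))) * ?N) = ?N"
  proof -
    have "l ^ CARD('n) * inverse (l ^ CARD('n)) = 1" using l by simp
    then show ?thesis
      unfolding mult.assoc[symmetric] using ln by (subst ennreal_mult[symmetric]) (simp_all only: less_imp_le inverse_nonnegative_iff_nonnegative ennreal_1 mult_1_left)
  qed
  also have "A_const p W = ennreal (enn2real (A_const p W))" using fin by (simp add: less_top)
  also have "ennreal (l ^ CARD('n)) * ennreal (enn2real (A_const p W)) = ennreal (enn2real (A_const p W) * l ^ CARD('n))"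
    using ln by (subst ennreal_mult[symmetric]) (auto simp: mult.commute)
  finally show ?thesis .
qed

context log_holder_exponent
begin

text \<open>For a fixed cube \<open>Q\<close> the inner norm \<open>g x\<close> is itself a scalar weight, and \<open>g x \<le> k x z * g z\<close> whenever \<open>W x\<close> and \<open>W z\<close> are
  invertible, where \<open>k x z = |W x W\<inverse> z|\<close>. So on invertible points \<open>g\<close> vanishes identically, or is infinite
  identically, or is positive and finite; the second case contradicts the finiteness of the constant of \<open>W\<close>. In the third, Hoelder's
  inequality in \<open>z\<close> over a part \<open>E\<close> of a cube \<open>D\<close> bounds \<open>|E| * g x\<close> by the inner norm for \<open>D\<close> times
  the norm of \<open>g\<close> on \<open>E\<close>; taking the norm in \<open>x\<close> over \<open>D\<close> shows \<open>cube_ainf\<close>, with a constant that depends only on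
  that of \<open>W\<close> and not on \<open>Q\<close>. The reverse Hoelder inequality for \<open>g\<close> and the comparison of the inner norms give
  the bound for \<open>s * p\<close>.\<close>

lemma A_const_scaled_finite:
  fixes W :: "real ^ 'n \<Rightarrow> real ^ 'd ^ 'd"
  assumes W: "W \<in> borel_measurable lebesgue" and inv: "AE x in lebesgue. invertible (W x)"
    and fin: "A_const (\<lambda>x. ereal (p x)) W < \<infinity>"
  obtains r where "1 < r" "\<And>s. 1 \<le> s \<Longrightarrow> s \<le> r \<Longrightarrow> A_const (\<lambda>x. ereal (s * p x)) W < \<infinity>"
proof -
  let ?n = "CARD('n)"
  define k where "k x y = op_norm (W x ** matrix_inv (W y))" for x y
  define A0 where "A0 = enn2real (A_const (\<lambda>x. ereal (p x)) W)"
  have A0: "0 \<le> A0" by (simp add: A0_def)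
  define G where "G a l M = Lp_norm (conj_exponent (\<lambda>x. ereal (p x)))
    (\<lambda>y. ennreal (op_norm (M ** matrix_inv (W y))) * indicator (cbox a (a + vec l)) y)" for a l M
  have q_meas: "(\<lambda>y. ennreal (op_norm (M ** matrix_inv (W y))) * indicator (cbox a (a + vec l)) y) \<in> borel_measurable lebesgue"
    for M :: "real ^ 'd ^ 'd" and a l
    by (intro borel_measurable_times_ennreal borel_measurable_indicator
        measurable_compose[OF op_norm_quotient_measurable[OF W] measurable_ennreal]) simp
  have k_meas: "k x \<in> borel_measurable lebesgue" for x
    unfolding k_def by (rule op_norm_quotient_measurable[OF W])
  have k_nonneg: "0 \<le> k x y" for x y unfolding k_def by (rule op_norm_nonneg)
  have Gk: "G a l (W x) = Lp_norm (conj_exponent (\<lambda>x. ereal (p x)))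
    (\<lambda>y. ennreal (k x y) * indicator (cbox a (a + vec l)) y)" for a l x
    unfolding G_def k_def ..
  have G_quot: "G a l M \<le> ennreal (op_norm (M ** matrix_inv N)) * G a l N"
    if "invertible M" "invertible N" for a l M N
    unfolding G_def
  proof (rule Lp_norm_le_cmult)
    show "0 < op_norm (M ** matrix_inv N)" using op_norm_quotient_pos that by blast
    fix x
    show "ennreal (op_norm (M ** matrix_inv (W x))) * indicator (cbox a (a + vec l)) x
      \<le> ennreal (op_norm (M ** matrix_inv N)) * (ennreal (op_norm (N ** matrix_inv (W x))) * indicator (cbox a (a + vec l)) x)"
      using op_norm_quotient_submult[OF that(2), of M "W x"]
      by (auto simp: indicator_def op_norm_nonneg ennreal_mult[symmetric] intro!: ennreal_leI)
    show "0 \<le> conj_exponent (\<lambda>x. ereal (p x)) x" by (rule conj_exponent_nonneg) (rule p_ge_1)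
  qed (rule q_meas)+
  have Lp_A: "Lp_norm (\<lambda>x. ereal (p x)) (\<lambda>x. G a l (W x) * indicator (cbox a (a + vec l)) x) \<le> ennreal (A0 * l ^ ?n)"
    if "0 < l" for a l
    using Lp_norm_cube_le_A_const[OF that fin, of a] unfolding G_def A0_def .
  \<comment> \<open>\<open>A0\<close> may be \<open>0\<close>; with \<open>A0 + 1\<close> the divisor is positive and strictly above the norm, hence admissible in its definition\<close>
  have G_modular: "(\<integral>\<^sup>+x. ennreal_powr (G a l (W x) * indicator (cbox a (a + vec l)) x / ennreal ((A0 + 1) * l ^ ?n)) (p x) \<partial>lebesgue) \<le> 1"
    if l: "0 < l" for a l
    unfolding modular_real_exponent[symmetric]
  proof (rule modular_le_one_of_Lp_norm_less)
    have "ennreal (A0 * l ^ ?n) < ennreal ((A0 + 1) * l ^ ?n)" using l A0 by (subst ennreal_less_iff) auto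
    then show "Lp_norm (\<lambda>x. ereal (p x)) (\<lambda>x. G a l (W x) * indicator (cbox a (a + vec l)) x) < ennreal ((A0 + 1) * l ^ ?n)"
      using Lp_A[OF l, of a] by (rule le_less_trans[rotated])
  qed (auto simp: p_nonneg)
  define A where "A = 2 * (A0 + 1)"
  have A: "1 \<le> A" using A0 by (simp add: A_def)
  obtain \<epsilon>0 C where RH: "0 < \<epsilon>0" "\<epsilon>0 \<le> 1" "1 \<le> C"
    "\<And>a l w s. 0 < l \<Longrightarrow> pos_weight w \<Longrightarrow> modl p (hcube a l) w < \<infinity> \<Longrightarrow>
      cube_ainf p A (hcube a l) w \<Longrightarrow> 1 \<le> s \<Longrightarrow> s \<le> 1 + \<epsilon>0 \<Longrightarrow>
      modl (\<lambda>x. s * p x) (hcube a l)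
        (\<lambda>x. vnorm p (hcube a l) (\<lambda>_. 1) powr (1 - 1 / s) * w x / (C * vnorm p (hcube a l) w)) \<le> 1"
    using reverse_hoelder[OF A] by blast
  have cube_bound: "Lp_norm (\<lambda>x. ereal (s * p x)) (\<lambda>x. Lp_norm (conj_exponent (\<lambda>x. ereal (s * p x)))
      (\<lambda>y. ennreal (k x y) * indicator (cbox a (a + vec l)) y) * indicator (cbox a (a + vec l)) x)
    \<le> ennreal (2 * C * (A0 + 1) * l ^ ?n)"
    if l: "0 < l" and s: "1 \<le> s" "s \<le> 1 + \<epsilon>0" for a :: "real ^ 'n" and l s :: real
  proof -
    define Q where "Q = cbox a (a + vec l)"
    define H where "H = hcube a l"
    define g where "g x = G a l (W x)" for x
    define X where "X = (A0 + 1) * l ^ ?n"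
    have ln: "0 < l ^ ?n" using l by simp
    have X: "0 < X" unfolding X_def using A0 ln by simp
    have Q_sets: "Q \<in> sets lebesgue" unfolding Q_def by simp
    have H_sets: "H \<in> sets lebesgue" "H \<subseteq> Q" unfolding H_def Q_def by (simp, rule hcube_cbox(2))
    have QH: "AE x in lebesgue. x \<in> Q \<longleftrightarrow> x \<in> H"
      unfolding Q_def H_def using l by (intro AE_cube_iff_hcube) simp
    have mH: "emeasure lebesgue H = ennreal (l ^ ?n)" unfolding H_def using l by (intro emeasure_hcube) simp
    have H_pos: "0 < emeasure lebesgue H" unfolding mH using ln by simp
    have one: "pos_weight (\<lambda>_::real ^ 'n. 1)" by (simp add: pos_weight_def)
    have fin1: "modl p H (\<lambda>_. 1) < \<infinity>" unfolding modl_def using mH H_sets by simp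
    define b where "b = vnorm p H (\<lambda>_. 1)"
    have b: "0 < b" unfolding b_def by (rule vnorm_pos[OF one H_sets(1) fin1 H_pos])
    have b_modl: "modl p H (\<lambda>_. 1 / b) \<le> 1"
      using modl_vnorm[OF one H_sets(1) fin1] b unfolding b_def by simp
    have b_modlQ: "modl p Q (\<lambda>_. 1 / b) \<le> 1"
    proof -
      have "modl p Q (\<lambda>_. 1 / b) = modl p H (\<lambda>_. 1 / b)"
        unfolding modl_def using QH by (intro nn_integral_cong_AE, eventually_elim) (auto simp: indicator_def)
      then show ?thesis using b_modl by simp
    qed
    define B where "B = 2 * b powr (1 - 1 / s)"
    have B: "0 < B" using b by (simp add: B_def)
    define F where "F x = Lp_norm (conj_exponent (\<lambda>x. ereal (s * p x))) (\<lambda>y. ennreal (k x y) * indicator Q y)" for x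
    have F_le: "F x \<le> ennreal B * g x" for x
      unfolding F_def g_def Gk B_def Q_def[symmetric]
      by (rule conj_norm_scaled_le[OF k_meas k_nonneg Q_sets b b_modlQ s(1)])
    have g_int: "(\<integral>\<^sup>+x. ennreal_powr (g x * indicator Q x / ennreal X) (p x) \<partial>lebesgue) \<le> 1"
      using G_modular[OF l, of a] unfolding g_def Q_def X_def .
    have g_quot: "g x \<le> ennreal (k x z) * g z" if "invertible (W x)" "invertible (W z)" for x z
      unfolding g_def k_def by (rule G_quot[OF that])
    have key: "Lp_norm (\<lambda>x. ereal (s * p x)) (\<lambda>x. F x * indicator Q x) \<le> ennreal (2 * C * X)"
    proof (cases "\<exists>z. invertible (W z) \<and> g z = 0")
      case True
      then obtain z where z: "invertible (W z)" "g z = 0" by blast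
      have "AE x in lebesgue. ennreal_powr (F x * indicator Q x / ennreal (2 * C * X)) (s * p x) = 0"
        using inv
      proof eventually_elim
        case (elim x)
        have "g x = 0" using g_quot[OF elim z(1)] z(2) by simp
        then have "F x = 0" using F_le[of x] by simp
        then show ?case using ennreal_powr_ennreal[of 0 "s * p x"] by simp
      qed
      then have "modular (\<lambda>x. ereal (s * p x)) (\<lambda>x. F x * indicator Q x / ennreal (2 * C * X)) = (\<integral>\<^sup>+x. 0 \<partial>(lebesgue :: (real ^ 'n) measure))"
        unfolding modular_real_exponent by (rule nn_integral_cong_AE)
      then show ?thesis using RH(3) X by (intro Lp_norm_leI) auto
    next
      case False
      have ex_fin: "\<exists>z. invertible (W z) \<and> g z < \<infinity>"
      proof (rule ccontr)
        assume no: "\<not> ?thesis"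
        have "AE x in lebesgue. x \<in> Q \<longrightarrow> ennreal_powr (g x * indicator Q x / ennreal X) (p x) = \<infinity>"
          using inv
        proof eventually_elim
          case (elim x)
          then have "g x = \<infinity>" using no top.not_eq_extremum[of "g x"] by auto
          then show ?case using X by (auto simp: ennreal_powr_def ennreal_top_divide)
        qed
        then have "AE x in lebesgue. \<infinity> * indicator Q x \<le> ennreal_powr (g x * indicator Q x / ennreal X) (p x)"
          by eventually_elim (auto simp: indicator_def)
        then have "(\<integral>\<^sup>+x. \<infinity> * indicator Q x \<partial>lebesgue) \<le> (\<integral>\<^sup>+x. ennreal_powr (g x * indicator Q x / ennreal X) (p x) \<partial>lebesgue)"
          by (rule nn_integral_mono_AE)
        then have "\<infinity> * emeasure lebesgue Q \<le> 1" using g_int Q_sets by (simp only: nn_integral_cmult_indicator order_trans)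
        moreover have "emeasure lebesgue H \<le> emeasure lebesgue Q" using H_sets Q_sets by (intro emeasure_mono)
        then have "emeasure lebesgue Q \<noteq> 0" using H_pos by auto
        ultimately show False by (simp add: ennreal_top_mult top_unique del: emeasure_completion)
      qed
      then obtain z0 where z0: "invertible (W z0)" "g z0 < \<infinity>" by blast
      have g_fin: "g x < \<infinity>" if "invertible (W x)" for x
      proof -
        have "g x \<le> ennreal (k x z0) * g z0" by (rule g_quot[OF that z0(1)])
        also have "\<dots> < \<infinity>" using z0(2) by (simp add: ennreal_mult_less_top)
        finally show ?thesis .
      qed
      define w where "w x = (if W x \<in> {M. det M \<noteq> 0} then enn2real (g x) else 1)" for x
      have w_g: "ennreal (w x) = g x" if "invertible (W x)" for x
        using that g_fin[OF that] by (simp add: w_def invertible_det_nz less_top)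
      have w_pos: "0 < w x" for x
      proof (cases "invertible (W x)")
        case True
        then have "g x \<noteq> 0" "g x < \<infinity>" using False g_fin by auto
        then show ?thesis using True by (simp add: w_def invertible_det_nz enn2real_positive_iff zero_less_iff_neq_zero)
      qed (simp add: w_def invertible_det_nz)
      have w_meas: "w \<in> borel_measurable lebesgue"
      proof -
        define \<Gamma> where "\<Gamma> M = enn2real (G a l M)" for M
        have finG: "G a l M < \<infinity>" if "det M \<noteq> 0" for M
        proof -
          have "G a l M \<le> ennreal (op_norm (M ** matrix_inv (W z0))) * g z0"
            unfolding g_def using that z0(1) by (intro G_quot) (auto simp: invertible_det_nz)
          also have "\<dots> < \<infinity>" using z0(2) by (simp add: ennreal_mult_less_top)
          finally show ?thesis .
        qed
        have "continuous_on {M. det M \<noteq> 0} \<Gamma>"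
        proof (rule continuous_of_quotient_bound)
          fix M N :: "real ^ 'd ^ 'd" assume MN: "det M \<noteq> 0" "det N \<noteq> 0"
          have "G a l M \<le> ennreal (op_norm (M ** matrix_inv N)) * G a l N"
            using MN by (intro G_quot) (auto simp: invertible_det_nz)
          also have "\<dots> = ennreal (op_norm (M ** matrix_inv N) * \<Gamma> N)"
            unfolding \<Gamma>_def using finG[OF MN(2)] by (simp add: ennreal_mult op_norm_nonneg less_top)
          finally show "\<Gamma> M \<le> op_norm (M ** matrix_inv N) * \<Gamma> N"
            unfolding \<Gamma>_def[of M] by (intro enn2real_leI) (simp_all add: op_norm_nonneg \<Gamma>_def)
        qed
        then have "(\<lambda>M. if M \<in> {M. det M \<noteq> 0} then \<Gamma> M else 1) \<in> borel_measurable borel"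
          by (intro borel_measurable_continuous_on_if borel_open open_invertible continuous_on_const)
        from measurable_compose[OF W this] show ?thesis
          unfolding w_def g_def \<Gamma>_def by simp
      qed
      have w: "pos_weight w" unfolding pos_weight_def using w_meas w_pos by blast
      have w_nonneg: "0 \<le> w x" for x using w_pos[of x] by simp
      have w_quot: "w x \<le> k x y * w y" if "invertible (W x)" "invertible (W y)" for x y
      proof -
        have "ennreal (w x) \<le> ennreal (k x y) * ennreal (w y)"
          using g_quot[OF that] w_g that by simp
        then show ?thesis using k_nonneg[of x y] w_nonneg[of y] by (simp add: ennreal_mult[symmetric] ennreal_le_iff)
      qed
      \<comment> \<open>modular bounds for \<open>w\<close> by the ones for the \<open>g\<close> of any cube\<close>
      have modl_le: "modl p D (\<lambda>x. u x / (m * ((A0 + 1) * h ^ ?n))) \<le> 1"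
        if h: "0 < h" and D: "D \<subseteq> cbox c (c + vec h)" and m: "0 < m" and u: "\<And>x. 0 \<le> u x"
          "\<And>x. invertible (W x) \<Longrightarrow> x \<in> D \<Longrightarrow> ennreal (u x) \<le> ennreal m * G c h (W x)" for u D m c h
      proof -
        define Y where "Y = (A0 + 1) * h ^ ?n"
        have Y: "0 < Y" unfolding Y_def using A0 h by simp
        have "modl p D (\<lambda>x. u x / (m * Y)) \<le> (\<integral>\<^sup>+x. ennreal_powr (G c h (W x) * indicator (cbox c (c + vec h)) x / ennreal Y) (p x) \<partial>lebesgue)"
          unfolding modl_def
        proof (rule nn_integral_mono_AE)
          show "AE x in lebesgue. ennreal ((u x / (m * Y)) powr p x) * indicator D x
            \<le> ennreal_powr (G c h (W x) * indicator (cbox c (c + vec h)) x / ennreal Y) (p x)"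
            using inv
          proof eventually_elim
            case (elim x)
            show ?case
            proof (cases "x \<in> D")
              case True
              have "ennreal (u x / (m * Y)) = ennreal (u x) / ennreal (m * Y)"
                using u(1)[of x] m Y by (simp add: divide_ennreal)
              also have "\<dots> \<le> ennreal m * G c h (W x) / ennreal (m * Y)"
                using u(2)[OF elim True] by (rule divide_right_mono_ennreal)
              also have "\<dots> = G c h (W x) / ennreal Y" using m Y by (rule ennreal_cancel_factor)
              finally have "ennreal_powr (ennreal (u x / (m * Y))) (p x) \<le> ennreal_powr (G c h (W x) / ennreal Y) (p x)"
                using p_nonneg by (rule ennreal_powr_mono)
              then show ?thesis using True D u(1)[of x] m Y by (auto simp: ennreal_powr_ennreal)
            qed simp
          qed
        qed
        also have "\<dots> \<le> 1" unfolding Y_def by (rule G_modular[OF h])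
        finally show ?thesis unfolding Y_def .
      qed
      have modl_w: "modl p H (\<lambda>x. w x / X) \<le> 1"
        using modl_le[OF l, of H a 1 w] H_sets(2) w_nonneg w_g unfolding X_def Q_def g_def by simp
      have wX: "pos_weight (\<lambda>x. w x / X)" by (rule pos_weight_divide[OF w X])
      have finw: "modl p H w < \<infinity>"
      proof -
        have "modl p H (\<lambda>x. w x / X / (1 / X)) < \<infinity>"
          using modl_w X by (intro modl_divide_finite[OF wX H_sets(1)]) (auto intro: order_le_less_trans)
        then show ?thesis using X by simp
      qed
      define V where "V = vnorm p H w"
      have V_le: "V \<le> X" unfolding V_def using X modl_w by (rule vnorm_le)
      have V: "0 < V" unfolding V_def by (rule vnorm_pos[OF w H_sets(1) finw H_pos])
      have ainf: "cube_ainf p A H w"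
        unfolding cube_ainf_def
      proof (intro allI impI)
        fix c :: "real ^ 'n" and h E
        assume h: "0 < h" and D: "hcube c h \<subseteq> H" and E: "E \<in> sets lebesgue" "E \<subseteq> hcube c h"
        have finE: "modl p E w < \<infinity>" by (rule order_le_less_trans[OF modl_set_mono[OF order_trans[OF E(2) D]] finw])
        have hn: "0 < h ^ ?n" using h by simp
        have fmD: "hcube c h \<in> fmeasurable lebesgue"
          using emeasure_hcube[of h c] h by (simp add: fmeasurable_def del: emeasure_completion)
        then have E_meas: "emeasure lebesgue E = ennreal (measure lebesgue E)"
          using fmeasurableI2[OF fmD E(2) E(1)] by (simp add: emeasure_eq_measure2 del: emeasure_completion)
        show "measure lebesgue E * vnorm p (hcube c h) w \<le> A * h ^ ?n * vnorm p E w"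
        proof (cases "measure lebesgue E = 0")
          case True
          then show ?thesis using A hn vnorm_nonneg[OF w E(1) finE] by simp
        next
          case False
          then have mE: "0 < measure lebesgue E" using measure_nonneg[of lebesgue E] by linarith
          have "0 < emeasure lebesgue E" unfolding E_meas using mE by simp
          then have f: "0 < vnorm p E w" by (intro vnorm_pos[OF w E(1) finE])
          have f_modl: "modl p E (\<lambda>y. w y / vnorm p E w) \<le> 1" using modl_vnorm[OF w E(1) finE f] by simp
          define m where "m = 2 * vnorm p E w / measure lebesgue E"
          have m: "0 < m" unfolding m_def using f mE by simp
          have E_box: "E \<subseteq> cbox c (c + vec h)" using E(2) hcube_cbox(2) by blast
          have w_le: "ennreal (w x) \<le> ennreal m * G c h (W x)" if x: "invertible (W x)" for x
          proof (cases "G c h (W x) = \<infinity>")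
            case True
            then show ?thesis using m by (simp add: ennreal_mult_top)
          next
            case False
            then obtain r where r: "G c h (W x) = ennreal r" "0 \<le> r" by (cases "G c h (W x)") auto
            have "measure lebesgue E * w x \<le> 2 * (r + e) * vnorm p E w" if e: "0 < e" for e
            proof -
              have "G c h (W x) < ennreal (r + e)" using r e by (simp add: ennreal_less_iff)
              then have mod: "modular (conj_exponent (\<lambda>x. ereal (p x)))
                (\<lambda>y. ennreal (k x y) * indicator (cbox c (c + vec h)) y / ennreal (r + e)) \<le> 1"
                unfolding Gk
                by (intro modular_le_one_of_Lp_norm_less disjI1 conj_exponent_nonneg p_ge_1)
                  (use q_meas[of "W x" c h] in \<open>simp_all add: k_def\<close>)
              have "ennreal (w x) * emeasure lebesgue E = (\<integral>\<^sup>+y\<in>E. ennreal (w x) \<partial>lebesgue)"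
                using E(1) by (simp add: nn_integral_cmult_indicator del: emeasure_completion)
              also have "\<dots> \<le> (\<integral>\<^sup>+y\<in>E. ennreal (k x y * w y) \<partial>lebesgue)"
                using inv by (intro nn_integral_mono_AE, eventually_elim)
                  (auto intro!: mult_right_mono ennreal_leI w_quot x)
              also have "\<dots> \<le> ennreal (2 * (r + e) * vnorm p E w)"
                by (rule conj_hoelder[OF k_meas k_nonneg _ _ mod E(1) E_box w_meas w_nonneg f f_modl]) (use r e in auto)
              finally have "ennreal (w x * measure lebesgue E) \<le> ennreal (2 * (r + e) * vnorm p E w)"
                unfolding E_meas using w_nonneg[of x] by (simp add: ennreal_mult)
              then show ?thesis using r e f by (simp add: ennreal_le_iff mult.commute)
            qed
            then have "measure lebesgue E * w x / (2 * vnorm p E w) \<le> r + e" if "0 < e" for e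
              using that f by (simp add: pos_divide_le_eq algebra_simps)
            then have "measure lebesgue E * w x / (2 * vnorm p E w) \<le> r" by (rule field_le_epsilon)
            then have "w x \<le> m * r" unfolding m_def using f mE by (simp add: field_simps)
            then show ?thesis unfolding r using m r(2) by (simp add: ennreal_mult[symmetric] ennreal_leI)
          qed
          have "modl p (hcube c h) (\<lambda>x. w x / (m * ((A0 + 1) * h ^ ?n))) \<le> 1"
            by (rule modl_le[OF h hcube_cbox(2) m w_nonneg w_le])
          then have "vnorm p (hcube c h) w \<le> m * ((A0 + 1) * h ^ ?n)"
            using m A0 hn by (intro vnorm_le) auto
          then have "measure lebesgue E * vnorm p (hcube c h) w \<le> measure lebesgue E * (m * ((A0 + 1) * h ^ ?n))"
            using mE by (intro mult_left_mono) auto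
          also have "\<dots> = A * h ^ ?n * vnorm p E w" unfolding m_def A_def using mE by simp
          finally show ?thesis .
        qed
      qed
      have rh: "modl (\<lambda>x. s * p x) H (\<lambda>x. b powr (1 - 1 / s) * w x / (C * V)) \<le> 1"
        unfolding b_def V_def H_def by (rule RH(4)[OF l w _ _ s]) (use finw ainf in \<open>auto simp: H_def\<close>)
      have CV: "0 < C * V" using RH(3) V by simp
      have "(\<integral>\<^sup>+x. ennreal_powr (F x * indicator Q x / ennreal (2 * C * V)) (s * p x) \<partial>lebesgue)
        \<le> modl (\<lambda>x. s * p x) H (\<lambda>x. b powr (1 - 1 / s) * w x / (C * V))"
        unfolding modl_def
      proof (rule nn_integral_mono_AE)
        show "AE x in lebesgue. ennreal_powr (F x * indicator Q x / ennreal (2 * C * V)) (s * p x)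
          \<le> ennreal ((b powr (1 - 1 / s) * w x / (C * V)) powr (s * p x)) * indicator H x"
          using inv QH
        proof eventually_elim
          case (elim x)
          show ?case
          proof (cases "x \<in> Q")
            case True
            have "F x / ennreal (2 * C * V) \<le> ennreal B * ennreal (w x) / ennreal (2 * C * V)"
              using F_le[of x] w_g[OF elim(1)] by (intro divide_right_mono_ennreal) simp
            also have "\<dots> = ennreal (B * w x / (2 * C * V))"
              using B w_nonneg[of x] CV by (subst ennreal_mult[symmetric]) (auto simp: divide_ennreal)
            also have "B * w x / (2 * C * V) = b powr (1 - 1 / s) * w x / (C * V)"
              unfolding B_def by simp
            finally have "ennreal_powr (F x / ennreal (2 * C * V)) (s * p x)
              \<le> ennreal_powr (ennreal (b powr (1 - 1 / s) * w x / (C * V))) (s * p x)"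
              using s p_nonneg by (intro ennreal_powr_mono) auto
            then show ?thesis using True elim(2) w_nonneg[of x] CV by (simp add: ennreal_powr_ennreal)
          next
            case False
            then show ?thesis using ennreal_powr_ennreal[of 0 "s * p x"] by simp
          qed
        qed
      qed
      then have "modular (\<lambda>x. ereal (s * p x)) (\<lambda>x. F x * indicator Q x / ennreal (2 * C * V)) \<le> 1"
        unfolding modular_real_exponent using rh by (rule order_trans)
      then have "Lp_norm (\<lambda>x. ereal (s * p x)) (\<lambda>x. F x * indicator Q x) \<le> ennreal (2 * C * V)"
        using CV by (intro Lp_norm_leI) auto
      also have "\<dots> \<le> ennreal (2 * C * X)" using V_le RH(3) by (intro ennreal_leI mult_left_mono) auto
      finally show ?thesis .
    qed
    then show ?thesis unfolding F_def Q_def X_def by (simp add: mult.assoc)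
  qed
  have "A_const (\<lambda>x. ereal (s * p x)) W \<le> ennreal (2 * C * (A0 + 1))" if s: "1 \<le> s" "s \<le> 1 + \<epsilon>0" for s
    unfolding A_const_def
  proof (rule SUP_least)
    fix Q :: "(real ^ 'n) set" assume "Q \<in> cubes"
    then obtain a l where Q: "Q = cbox a (a + vec l)" "0 < l" unfolding cubes_def by blast
    have ln: "0 < l ^ ?n" using Q by simp
    have mQ: "inverse (emeasure lebesgue Q) = ennreal (inverse (l ^ ?n))"
      unfolding Q using emeasure_cube(1)[of l a] Q(2) ln by (simp add: inverse_ennreal del: emeasure_completion)
    have "inverse (emeasure lebesgue Q) * Lp_norm (\<lambda>x. ereal (s * p x)) (\<lambda>x. Lp_norm (conj_exponent (\<lambda>x. ereal (s * p x)))
      (\<lambda>y. ennreal (op_norm (W x ** matrix_inv (W y))) * indicator Q y) * indicator Q x)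
      \<le> ennreal (inverse (l ^ ?n)) * ennreal (2 * C * (A0 + 1) * l ^ ?n)"
      unfolding mQ using cube_bound[OF Q(2) s, of a] unfolding k_def Q(1) by (intro mult_left_mono) auto
    also have "\<dots> = ennreal (2 * C * (A0 + 1))"
    proof -
      have "inverse (l ^ ?n) * (2 * C * (A0 + 1) * l ^ ?n) = 2 * C * (A0 + 1)" using Q(2) by simp
      then show ?thesis using ln RH(3) A0 by (subst ennreal_mult[symmetric]) auto
    qed
    finally show "inverse (emeasure lebesgue Q) * Lp_norm (\<lambda>x. ereal (s * p x)) (\<lambda>x. Lp_norm (conj_exponent (\<lambda>x. ereal (s * p x)))
      (\<lambda>y. ennreal (op_norm (W x ** matrix_inv (W y))) * indicator Q y) * indicator Q x) \<le> ennreal (2 * C * (A0 + 1))" .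
  qed
  note A_le = this
  have "A_const (\<lambda>x. ereal (s * p x)) W < \<infinity>" if "1 \<le> s" "s \<le> 1 + \<epsilon>0" for s
    using A_le[OF that] by (rule order_le_less_trans) simp
  then show ?thesis using that[of "1 + \<epsilon>0"] RH(1) by simp
qed

end

theorem theorem1p5:
  fixes p :: "real ^ 'n \<Rightarrow> real" and W :: "real ^ 'n \<Rightarrow> real ^ 'd ^ 'd"
  assumes "(\<lambda>x. ereal (p x)) \<in> exponent_functions" and "p \<in> log_holder"
    and "esssup lebesgue (\<lambda>x. ereal (p x)) < \<infinity>"
    and "matrix_weight W"
    and "W \<in> A_class (\<lambda>x. ereal (p x))"
  shows "\<exists>r::real. r > 1 \<and> (\<forall>s\<in>{1..r}. W \<in> A_class (\<lambda>x. ereal s * ereal (p x)))"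
proof -
  have pm: "p \<in> borel_measurable lebesgue" and p1: "\<And>x. 1 \<le> p x"
    using assms(1) unfolding exponent_functions_def by (auto simp: one_ereal_def)
  obtain P L pinf Cinf where "log_holder_exponent p P L pinf Cinf"
    using exists_log_holder_exponent[OF pm p1 assms(2)] by blast
  then interpret log_holder_exponent p P L pinf Cinf .
  have W: "invertible_weight W" "A_const (\<lambda>x. ereal (p x)) W < \<infinity>"
    using assms(5) unfolding A_class_def by auto
  have W_meas: "W \<in> borel_measurable lebesgue"
    using assms(4) unfolding matrix_weight_def by blast
  have "AE x in lebesgue. invertible (W x)"
    using W(1) unfolding invertible_weight_def by (auto elim!: eventually_mono intro: pos_def_invertible)
  then obtain r where "1 < r" "\<And>s. 1 \<le> s \<Longrightarrow> s \<le> r \<Longrightarrow> A_const (\<lambda>x. ereal (s * p x)) W < \<infinity>"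
    using A_const_scaled_finite[OF W_meas _ W(2)] by blast
  then show ?thesis using W(1) by (intro exI[of _ r]) (auto simp: A_class_def)
qed

end
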